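(* There is a Turing machine $M_{\mathsf{L}}$ that, given a closed term $s$ that has a normal form $t$, computes a heap $H$ and a closure $g$ such that $g\gg_H t$, in time $O(p(|s|,\mathrm{Time}(s)))$ for some polynomial $p$ and in space $O(\mathrm{Space}(s))$.
   Context: $\mathsf{L}$-terms (de Bruijn): $s::=n\mid st\mid\lambda s$, size $|n|=1+n$, $|\lambda s|=1+|s|$, $|st|=1+|s|+|t|$; closed means no free de Bruijn indices. Substitution $k^k_u=u$, $n^k_u=n$ ($n\ne k$), $(st)^k_u=(s^k_u)(t^k_u)$, $(\lambda s)^k_u=\lambda(s^{k+1}_u)$. Reduction: $(\lambda s)(\lambda t)\succ s^0_{\lambda t}$; $s\succ s'\Rightarrow st\succ s't$; $t\succ t'\Rightarrow(\lambda s)t\succ(\lambda s)t'$. If $s=s_0\succ\cdots\succ s_j=t$ with $t$ an abstraction (the normal form), $\mathrm{Time}(s)=j$ and $\mathrm{Space}(s)=\max_i|s_i|$. Programs are lists of commands $\mathsf{ret},\mathsf{var}\,n,\mathsf{lam},\mathsf{app}$; $\gamma n=[\mathsf{var}\,n]$, $\gamma(st)=\gamma s++\gamma t++[\mathsf{app}]$, $\gamma(\lambda s)=\mathsf{lam}::\gamma s++[\mathsf{ret}]$; terms are stored on tape as $\gamma s$ with unary indices. $P\gg s$ iff $P=\gamma u$ and $s=\lambda u$. A closure is a pair $(P,a)$ of a program and an address $a\in\mathbb N$; a heap entry is a pair $(g,b)$ of a closure and an address; a heap $H$ is a list of entries; $H[a]$ is the $a$-th entry for $1\le a\le|H|$,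 undefined otherwise. Lookup: if $H[a]=(g,b)$ then $H[a,0]=g$ and $H[a,n+1]=H[b,n]$; else undefined. Unfolding $\langle s,a\rangle\triangleright^H_k s'$: $\langle n,a\rangle\triangleright^H_k n$ if $n<k$; $\langle n,a\rangle\triangleright^H_k s'$ if $n\ge k$, $H[a,n-k]=(P,b)$, $P\gg u$, $\langle u,b\rangle\triangleright^H_0 s'$; $\langle\lambda s,a\rangle\triangleright^H_k\lambda s'$ if $\langle s,a\rangle\triangleright^H_{k+1}s'$; $\langle st,a\rangle\triangleright^H_k s't'$ if $\langle s,a\rangle\triangleright^H_k s'$ and $\langle t,a\rangle\triangleright^H_k t'$. $(P,a)\gg_H s$ iff $P\gg u$ and $\langle u,a\rangle\triangleright^H_0 s$ for some $u$. *)

theory Defs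
  imports Main
begin

datatype lterm = Var nat | App lterm lterm | Lam lterm

fun tsize :: "lterm \<Rightarrow> nat" where
  "tsize (Var n) = 1 + n"
| "tsize (Lam s) = 1 + tsize s"
| "tsize (App s t) = 1 + tsize s + tsize t"

fun bound :: "nat \<Rightarrow> lterm \<Rightarrow> bool" where
  "bound k (Var n) = (n < k)"
| "bound k (App s t) = (bound k s \<and> bound k t)"
| "bound k (Lam s) = bound (Suc k) s"

definition closed :: "lterm \<Rightarrow> bool" where
  "closed s = bound 0 s"

fun subst :: "lterm \<Rightarrow> nat \<Rightarrow> lterm \<Rightarrow> lterm" where
  "subst (Var n) k u = (if n = k then u else Var n)"
| "subst (App s t) k u = App (subst s k u) (subst t k u)"
| "subst (Lam s) k u = Lam (subst s (Suc k) u)"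

fun is_abs :: "lterm \<Rightarrow> bool" where
  "is_abs (Lam _) = True"
| "is_abs _ = False"

inductive step :: "lterm \<Rightarrow> lterm \<Rightarrow> bool" where
  beta: "step (App (Lam s) (Lam t)) (subst s 0 (Lam t))"
| appL: "step s s' \<Longrightarrow> step (App s t) (App s' t)"
| appR: "step t t' \<Longrightarrow> step (App (Lam s) t) (App (Lam s) t')"

text \<open>evaluates s t j m: there is a reduction s = s_0 > ... > s_j = t with t an
  abstraction (the normal form); then Time(s) = j and Space(s) = m = max_i |s_i|.\<close>
definition evaluates :: "lterm \<Rightarrow> lterm \<Rightarrow> nat \<Rightarrow> nat \<Rightarrow> bool" where
  "evaluates s t j m \<longleftrightarrow> (\<exists>ss. length ss = Suc j \<and> ss ! 0 = s \<and> ss ! j = t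
      \<and> (\<forall>i<j. step (ss ! i) (ss ! Suc i)) \<and> is_abs t
      \<and> m = Max (tsize ` set ss))"

datatype cmd = Ret | VarC nat | LamC | AppC

fun gamma :: "lterm \<Rightarrow> cmd list" where
  "gamma (Var n) = [VarC n]"
| "gamma (App s t) = gamma s @ gamma t @ [AppC]"
| "gamma (Lam s) = LamC # gamma s @ [Ret]"

definition prog_rep :: "cmd list \<Rightarrow> lterm \<Rightarrow> bool" where
  "prog_rep P s \<longleftrightarrow> (\<exists>u. P = gamma u \<and> s = Lam u)"

type_synonym closure = "cmd list \<times> nat"
type_synonym heap = "(closure \<times> nat) list"

fun lookup :: "heap \<Rightarrow> nat \<Rightarrow> nat \<Rightarrow> closure option" where
  "lookup H a n =
     (if 1 \<le> a \<and> a \<le> length H then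
        (case H ! (a - 1) of (g, b) \<Rightarrow> (case n of 0 \<Rightarrow> Some g | Suc n' \<Rightarrow> lookup H b n'))
      else None)"

inductive unf :: "heap \<Rightarrow> nat \<Rightarrow> nat \<Rightarrow> lterm \<Rightarrow> lterm \<Rightarrow> bool" where
  unf_bound: "n < k \<Longrightarrow> unf H a k (Var n) (Var n)"
| unf_free: "\<lbrakk>k \<le> n; lookup H a (n - k) = Some (P, b); prog_rep P u; unf H b 0 u s'\<rbrakk>
              \<Longrightarrow> unf H a k (Var n) s'"
| unf_lam: "unf H a (Suc k) s s' \<Longrightarrow> unf H a k (Lam s) (Lam s')"
| unf_app: "\<lbrakk>unf H a k s s'; unf H a k t t'\<rbrakk> \<Longrightarrow> unf H a k (App s t) (App s' t')"

definition clos_rep :: "heap \<Rightarrow> closure \<Rightarrow> lterm \<Rightarrow> bool" where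
  "clos_rep H g s \<longleftrightarrow> (\<exists>u. prog_rep (fst g) u \<and> unf H (snd g) 0 u s)"

section \<open>Multi-tape Turing machines (tapes as in Asperti/Ricciotti)\<close>

datatype 'a tape = Niltape | Leftof 'a "'a list" | Rightof 'a "'a list"
                 | Midtape "'a list" 'a "'a list"

fun current :: "'a tape \<Rightarrow> 'a option" where
  "current (Midtape _ a _) = Some a"
| "current _ = None"

fun tape_left :: "'a tape \<Rightarrow> 'a tape" where
  "tape_left (Midtape [] a rs) = Leftof a rs"
| "tape_left (Midtape (l # ls) a rs) = Midtape ls l (a # rs)"
| "tape_left (Rightof l ls) = Midtape ls l []"
| "tape_left t = t"

fun tape_right :: "'a tape \<Rightarrow> 'a tape" where
  "tape_right (Midtape ls a []) = Rightof a ls"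
| "tape_right (Midtape ls a (r # rs)) = Midtape (a # ls) r rs"
| "tape_right (Leftof r rs) = Midtape [] r rs"
| "tape_right t = t"

fun tape_write :: "'a option \<Rightarrow> 'a tape \<Rightarrow> 'a tape" where
  "tape_write None t = t"
| "tape_write (Some a) Niltape = Midtape [] a []"
| "tape_write (Some a) (Leftof r rs) = Midtape [] a (r # rs)"
| "tape_write (Some a) (Rightof l ls) = Midtape (l # ls) a []"
| "tape_write (Some a) (Midtape ls b rs) = Midtape ls a rs"

datatype move = L | R | N

fun tape_move :: "move \<Rightarrow> 'a tape \<Rightarrow> 'a tape" where
  "tape_move L t = tape_left t"
| "tape_move R t = tape_right t"
| "tape_move N t = t"

fun tape_size :: "'a tape \<Rightarrow> nat" where
  "tape_size Niltape = 0"
| "tape_size (Leftof _ rs) = Suc (length rs)"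
| "tape_size (Rightof _ ls) = Suc (length ls)"
| "tape_size (Midtape ls _ rs) = length ls + 1 + length rs"

fun tape_contents :: "'a tape \<Rightarrow> 'a list" where
  "tape_contents Niltape = []"
| "tape_contents (Leftof r rs) = r # rs"
| "tape_contents (Rightof l ls) = rev (l # ls)"
| "tape_contents (Midtape ls a rs) = rev ls @ a # rs"

fun init_tape :: "'a list \<Rightarrow> 'a tape" where
  "init_tape [] = Niltape"
| "init_tape (x # xs) = Midtape [] x xs"

text \<open>A machine with tm_tapes tapes, states 0..<tm_states, symbols 0..<tm_syms.\<close>
record tm =
  tm_tapes :: nat
  tm_states :: nat
  tm_syms :: nat
  tm_start :: nat
  tm_halt :: "nat \<Rightarrow> bool"
  tm_trans :: "nat \<Rightarrow> nat option list \<Rightarrow> nat \<times> (nat option \<times> move) list"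

definition wf_tm :: "tm \<Rightarrow> bool" where
  "wf_tm M \<longleftrightarrow> tm_start M < tm_states M \<and>
     (\<forall>q rd. q < tm_states M \<and> length rd = tm_tapes M \<and> (\<forall>x\<in>set rd. \<forall>a. x = Some a \<longrightarrow> a < tm_syms M)
        \<longrightarrow> fst (tm_trans M q rd) < tm_states M
          \<and> length (snd (tm_trans M q rd)) = tm_tapes M
          \<and> (\<forall>(w, m)\<in>set (snd (tm_trans M q rd)). \<forall>a. w = Some a \<longrightarrow> a < tm_syms M))"

type_synonym config = "nat \<times> nat tape list"

definition tm_step :: "tm \<Rightarrow> config \<Rightarrow> config" where
  "tm_step M c = (case c of (q, ts) \<Rightarrow>
     (case tm_trans M q (map current ts) of (q', acts) \<Rightarrow>
        (q', map2 (\<lambda>(w, m) t. tape_move m (tape_write w t)) acts ts)))"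

definition initial_config :: "tm \<Rightarrow> nat list \<Rightarrow> config" where
  "initial_config M w = (tm_start M, init_tape w # replicate (tm_tapes M - 1) Niltape)"

definition tm_halts_in :: "tm \<Rightarrow> config \<Rightarrow> nat \<Rightarrow> config \<Rightarrow> bool" where
  "tm_halts_in M c k c' \<longleftrightarrow> (tm_step M ^^ k) c = c' \<and> tm_halt M (fst c')
      \<and> (\<forall>i<k. \<not> tm_halt M (fst ((tm_step M ^^ i) c)))"

definition config_size :: "config \<Rightarrow> nat" where
  "config_size c = (\<Sum>t\<leftarrow>snd c. tape_size t)"

definition tm_space :: "tm \<Rightarrow> config \<Rightarrow> nat \<Rightarrow> nat" where
  "tm_space M c k = Max ((\<lambda>i. config_size ((tm_step M ^^ i) c)) ` {0..k})"

text \<open>symbols: 0 ret, 1 var, 2 unary successor, 3 lam, 4 app, 5 separator,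
  6/7 binary digits 0/1, 8 entry end\<close>
fun enc_cmd :: "cmd \<Rightarrow> nat list" where
  "enc_cmd Ret = [0]"
| "enc_cmd (VarC n) = 1 # replicate n 2"
| "enc_cmd LamC = [3]"
| "enc_cmd AppC = [4]"

definition enc_prog :: "cmd list \<Rightarrow> nat list" where
  "enc_prog P = concat (map enc_cmd P)"

fun enc_bin :: "nat \<Rightarrow> nat list" where
  "enc_bin n = (if n = 0 then [] else (if n mod 2 = 0 then 6 else 7) # enc_bin (n div 2))"

definition enc_clos :: "closure \<Rightarrow> nat list" where
  "enc_clos g = enc_prog (fst g) @ [5] @ enc_bin (snd g)"

definition enc_heap :: "heap \<Rightarrow> nat list" where
  "enc_heap H = concat (map (\<lambda>(g, b). enc_clos g @ [5] @ enc_bin b @ [8]) H)"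

end

theory Submission
  imports Defs
begin

text \<open>Substituting literally respects the space bound, but may take exponential time; sharing arguments
  through a heap takes polynomial time, but too much space. The machine alternates both under a
  space budget \<open>B\<close>. If substitution exceeds \<open>B\<close>, then \<open>B\<close> is at most a constant times \<open>Space(s)\<close>, so
  sharing may use space \<open>B\<close> as well; if sharing exceeds \<open>B\<close> too, the machine restarts with a larger
  budget. No step counter is needed: as \<open>s\<close> has a normal form, each phase either finishes or exceeds
  \<open>B\<close>, and substitution does so in time polynomial in \<open>B\<close> and \<open>Time(s)\<close>. Sharing succeeds once \<open>B\<close> is
  polynomial in \<open>|s|\<close> and \<open>Time(s)\<close>, so polynomially many restarts suffice.

  Both evaluators are one stack program: it rewrites \<open>(\<lambda>a)(\<lambda>b)\<close> to \<open>a\<close> with either \<open>\<lambda>b\<close> or a fresh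
  pointer to \<open>\<lambda>b\<close> substituted. The stored arguments \<open>v\<^sub>0, v\<^sub>1, \<dots>\<close> form one linear environment, in
  which \<open>v\<^sub>i\<close> refers only to earlier entries; so pointers become de Bruijn indices when the heap is printed.\<close>

section \<open>Stack programs and their compilation\<close>

text \<open>The demands on the two modes differ. Substitution needs space linear in the largest
  term, so each of its rounds runs in time linear in what it reads and writes; since a step adds at
  most one cell, the space bound is read off from the time bound. For sharing any polynomial will
  do, and there is one because a pointer can count as a single symbol: putting pointers for
  variables enlarges no term, so all code stays within the size of the input, and each reduction
  step stores one value.

  The budget is enforced from outside. Programs are verified as if space were unlimited; a bounded
  semantics then discards an overflowing step and jumps to a handler. As this may happen anywhere,
  the input must be recoverable even while it is being copied, and the result is collected on
  scratch stacks first and delivered only after success. The budget grows by one per overflow, so it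
  stays within two of the last budget at which substitution failed.\<close>

type_synonym store = "nat \<Rightarrow> nat list"

text \<open>\<open>Grow\<close> is invisible to \<open>istep\<close>: it asks for a larger budget,
  and only the bounded semantics \<open>bstep\<close> answers.\<close>

datatype prog = Skip | Push nat nat | Pop nat | Mv nat nat | Cp nat nat | Grow
  | Cond nat "nat set" prog prog | Loop nat "nat set" prog | Seq prog prog (infixr ";;" 60)

definition top_in :: "nat set \<Rightarrow> nat list \<Rightarrow> bool" where
  "top_in A xs \<longleftrightarrow> xs \<noteq> [] \<and> hd xs \<in> A"

lemma top_in_simps [simp]: "\<not> top_in A []" "top_in A (x # xs) \<longleftrightarrow> x \<in> A" "top_in UNIV xs \<longleftrightarrow> xs \<noteq> []"
  by (auto simp: top_in_def)

fun istep :: "prog list \<times> store \<Rightarrow> prog list \<times> store" where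
  "istep ([], s) = ([], s)"
| "istep (Skip # k, s) = (k, s)"
| "istep (Push j a # k, s) = (k, s(j := a # s j))"
| "istep (Pop i # k, s) = (k, s(i := tl (s i)))"
| "istep (Mv i j # k, s) = (k, if s i = [] then s else s(i := tl (s i), j := hd (s i) # s j))"
| "istep (Cp i j # k, s) = (k, if s i = [] then s else s(j := hd (s i) # s j))"
| "istep (Grow # k, s) = (k, s)"
| "istep (Cond i A p q # k, s) = ((if top_in A (s i) then p else q) # k, s)"
| "istep (Loop i A p # k, s) = (if top_in A (s i) then p # Loop i A p # k else k, s)"
| "istep (Seq p q # k, s) = (p # q # k, s)"

text \<open>The stacks of the evaluator: 0 and 3 the input (as a zipper), 1 and 2 the output tapes, 4 the
  mode (\<open>[]\<close> substitute, \<open>[2]\<close> share), 5 the values obtained so far (reversed),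
  6 the program still to be evaluated, 7 the shared values (reversed) and 14 their number in unary,
  8 the nesting depth in unary, 10 the text to be substituted, 17 and 19 the current heap address in
  unary and binary, 21 and 22 the output under construction, and the others are scratch.\<close>
definition nstacks :: nat where "nstacks = 23"

definition store_size :: "store \<Rightarrow> nat" where
  "store_size s = (\<Sum>i<nstacks. length (s i))"

text \<open>A popped cell cannot be erased from a tape, so the output stacks 1 and 2 must never be popped.\<close>
fun wf_prog :: "prog \<Rightarrow> bool" where
  "wf_prog (Push j a) \<longleftrightarrow> j < nstacks \<and> a < 10"
| "wf_prog (Pop i) \<longleftrightarrow> i < nstacks \<and> i \<noteq> 1 \<and> i \<noteq> 2"
| "wf_prog (Mv i j) \<longleftrightarrow> i < nstacks \<and> j < nstacks \<and> i \<noteq> j \<and> i \<noteq> 1 \<and> i \<noteq> 2"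
| "wf_prog (Cp i j) \<longleftrightarrow> i < nstacks \<and> j < nstacks"
| "wf_prog (Cond i A p q) \<longleftrightarrow> i < nstacks \<and> wf_prog p \<and> wf_prog q"
| "wf_prog (Loop i A p) \<longleftrightarrow> i < nstacks \<and> wf_prog p"
| "wf_prog (Seq p q) \<longleftrightarrow> wf_prog p \<and> wf_prog q"
| "wf_prog _ \<longleftrightarrow> True"

fun nexts :: "prog list \<Rightarrow> prog list set" where
  "nexts [] = {[]}"
| "nexts (Cond i A p q # k) = {p # k, q # k}"
| "nexts (Loop i A p # k) = {p # Loop i A p # k, k}"
| "nexts (Seq p q # k) = {p # q # k}"
| "nexts (_ # k) = {k}"

text \<open>An upper approximation of the continuations that arise from \<open>[p]\<close> under
  arbitrary outcomes of the tests. It is finite because a loop body returns to the same loop instead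
  of nesting deeper, so continuations can serve as machine states.\<close>

fun conts :: "prog \<Rightarrow> prog list set" where
  "conts (Seq p q) = {[Seq p q]} \<union> (\<lambda>c. c @ [q]) ` conts p \<union> conts q"
| "conts (Cond i A p q) = {[Cond i A p q]} \<union> conts p \<union> conts q"
| "conts (Loop i A p) = {[Loop i A p], []} \<union> (\<lambda>c. c @ [Loop i A p]) ` conts p"
| "conts p = {[p], []}"

lemma finite_conts [simp]: "finite (conts p)"
  by (induction p) auto

lemma conts_self [simp]: "[p] \<in> conts p"
  by (cases p) auto

lemma conts_nil [simp]: "[] \<in> conts p"
  by (induction p) auto

lemma nexts_append: "c \<noteq> [] \<Longrightarrow> nexts (c @ d) = (\<lambda>x. x @ d) ` nexts c"
  by (cases c rule: nexts.cases) auto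

text \<open>The delicate point is a finished part: when the continuation of the first part is empty,
  what remains is \<open>[q]\<close> or the loop itself, which starts the next family of
  continuations.\<close>

lemma nexts_conts: "c \<in> conts p \<Longrightarrow> nexts c \<subseteq> conts p"
proof (induction p arbitrary: c)
  case (Seq p q)
  show ?case
  proof (cases "c \<in> conts q \<or> c = [Seq p q]")
    case True
    then show ?thesis using Seq.IH(2) conts_self[of p] by (auto simp: image_iff)
  next
    case False
    then obtain c' where c': "c = c' @ [q]" "c' \<in> conts p" using Seq.prems by auto
    show ?thesis
    proof (cases "c' = []")
      case True
      then show ?thesis using Seq.IH(2)[OF conts_self] c' by auto
    next
      case nn: False
      show ?thesis using Seq.IH(1)[OF c'(2)] unfolding c'(1) nexts_append[OF nn] by auto
    qed
  qed
next
  case (Cond i A p q)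
  then show ?case by auto
next
  case (Loop i A p)
  show ?case
  proof (cases "c = [Loop i A p] \<or> c = []")
    case True
    then show ?thesis using conts_self[of p] by (auto simp: image_iff)
  next
    case False
    then obtain c' where c': "c = c' @ [Loop i A p]" "c' \<in> conts p" using Loop.prems by auto
    have n: "c' \<noteq> []" using False c' by auto
    show ?thesis using Loop.IH[OF c'(2)] unfolding c'(1) nexts_append[OF n] by auto
  qed
qed auto

lemma wf_prog_conts: "wf_prog p \<Longrightarrow> c \<in> conts p \<Longrightarrow> list_all wf_prog c"
  by (induction p arbitrary: c) auto

text \<open>An overflowing step is discarded together with its whole continuation: the handler
  starts from the store before the step, which still fits the budget.\<close>

definition bstep :: "prog list \<Rightarrow> prog list \<times> store \<times> nat \<Rightarrow> prog list \<times> store \<times> nat" where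
  "bstep h = (\<lambda>(c, s, B). let (c', s') = istep (c, s) in
     if store_size s' > B then (h, s, B)
     else (c', s', if c \<noteq> [] \<and> hd c = Grow then Suc B else B))"

section \<open>Store sizes, and stacks on tapes\<close>

lemma store_size_upd: "i < nstacks \<Longrightarrow> store_size (s(i := xs)) + length (s i) = store_size s + length xs"
  unfolding store_size_def
  by (simp add: sum.remove[of "{..<nstacks}" i] cong: sum.cong_simp)

lemma store_size_Suc: "i < nstacks \<Longrightarrow> store_size (s(i := x # s i)) = Suc (store_size s)"
  using store_size_upd[of i s "x # s i"] by simp

lemma store_size_tl: "i < nstacks \<Longrightarrow> s i \<noteq> [] \<Longrightarrow> Suc (store_size (s(i := tl (s i)))) = store_size s"
  using store_size_upd[of i s "tl (s i)"] by (cases "s i") auto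

lemma store_size_mv:
  "i < nstacks \<Longrightarrow> j < nstacks \<Longrightarrow> i \<noteq> j \<Longrightarrow> s i \<noteq> [] \<Longrightarrow> store_size (s(i := tl (s i), j := x # s j)) = store_size s"
  using store_size_tl[of i s] store_size_Suc[of j "s(i := tl (s i))" x] by simp

lemma length_le_store_size: "i < nstacks \<Longrightarrow> length (s i) \<le> store_size s"
  unfolding store_size_def by (simp add: sum.remove[of "{..<nstacks}" i])

text \<open>The head stands on the top of the stack. A pop just moves left, so old symbols may
  remain to the right, and an emptied stack leaves the head off the left end. With \<open>x\<close>
  such remains are excluded, and the stack can be read off from the tape contents.\<close>

fun stack_rep :: "bool \<Rightarrow> nat tape \<Rightarrow> nat list \<Rightarrow> bool" where
  "stack_rep x t [] \<longleftrightarrow> t = Niltape \<or> \<not> x \<and> (\<exists>r rs. t = Leftof r rs)"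
| "stack_rep x t (a # xs) \<longleftrightarrow> (\<exists>rs. t = Midtape xs a rs \<and> (x \<longrightarrow> rs = []))"

lemma stack_rep_current: "stack_rep x t xs \<Longrightarrow> current t = (if xs = [] then None else Some (hd xs))"
  by (cases xs) auto

text \<open>A push overwrites a leftover cell if there is one, so a tape is never longer than the
  highest stack it has held.\<close>

lemma stack_rep_push:
  assumes "stack_rep x t xs"
  shows "stack_rep x (tape_write (Some a) (tape_right t)) (a # xs)"
    "tape_size (tape_write (Some a) (tape_right t)) \<le> max (tape_size t) (Suc (length xs))"
proof -
  have "stack_rep x (tape_write (Some a) (tape_right t)) (a # xs) \<and>
    tape_size (tape_write (Some a) (tape_right t)) \<le> max (tape_size t) (Suc (length xs))"
  proof (cases xs)
    case Nil
    then show ?thesis using assms by auto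
  next
    case (Cons y ys)
    then obtain rs where "t = Midtape ys y rs" "x \<longrightarrow> rs = []" using assms by auto
    then show ?thesis using Cons by (cases rs) auto
  qed
  then show "stack_rep x (tape_write (Some a) (tape_right t)) (a # xs)"
    "tape_size (tape_write (Some a) (tape_right t)) \<le> max (tape_size t) (Suc (length xs))" by auto
qed

lemma stack_rep_pop: "stack_rep False t xs \<Longrightarrow> xs \<noteq> [] \<Longrightarrow> stack_rep False (tape_left t) (tl xs)"
  by (cases xs; cases "tl xs") auto

lemma tape_size_left [simp]: "tape_size (tape_left t) = tape_size t"
  by (cases t rule: tape_left.cases) auto

lemma tape_size_right [simp]: "tape_size (tape_right t) = tape_size t"
  by (cases t rule: tape_right.cases) auto

lemma tape_write_None [simp]: "tape_write None t = t"
  by (cases t) auto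

section \<open>The finite control and the machine\<close>

datatype ctl = Pre | Run "(nat \<times> nat) option" "prog list"

definition nop :: "nat \<Rightarrow> nat option \<times> move" where "nop = (\<lambda>_. (None, N))"

text \<open>A machine step writes before it moves, but a push has to move to a new cell before it
  writes. So a push takes two steps, and the control remembers the tape and the symbol in between.
  Returning a token is such a push onto the token tape.\<close>

fun delta1 :: "prog list \<Rightarrow> prog list \<Rightarrow> nat option list \<Rightarrow> ctl \<times> (nat \<Rightarrow> nat option \<times> move)" where
  "delta1 h [] rd = (Run None [], nop)"
| "delta1 h (Skip # k) rd = (Run None k, nop)"
| "delta1 h (Push j a # k) rd = (if rd ! nstacks = None then (Run None h, nop)
     else (Run (Some (j, a)) k, nop(nstacks := (None, L), j := (None, R))))"
| "delta1 h (Pop i # k) rd = (if rd ! i = None then (Run None k, nop)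
     else (Run (Some (nstacks, 2)) k, nop(i := (None, L), nstacks := (None, R))))"
| "delta1 h (Mv i j # k) rd = (case rd ! i of None \<Rightarrow> (Run None k, nop)
     | Some a \<Rightarrow> (Run (Some (j, a)) k, nop(i := (None, L), j := (None, R))))"
| "delta1 h (Cp i j # k) rd = (case rd ! i of None \<Rightarrow> (Run None k, nop)
     | Some a \<Rightarrow> if rd ! nstacks = None then (Run None h, nop)
         else (Run (Some (j, a)) k, nop(nstacks := (None, L), j := (None, R))))"
| "delta1 h (Grow # k) rd = (Run (Some (nstacks, 2)) k, nop(nstacks := (None, R)))"
| "delta1 h (Cond i A p q # k) rd =
     (Run None ((if rd ! i \<in> Some ` A then p else q) # k), nop)"
| "delta1 h (Loop i A p # k) rd =
     (Run None (if rd ! i \<in> Some ` A then p # Loop i A p # k else k), nop)"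
| "delta1 h (Seq p q # k) rd = (Run None (p # q # k), nop)"

fun delta :: "prog list \<Rightarrow> prog list \<Rightarrow> ctl \<Rightarrow> nat option list \<Rightarrow> ctl \<times> (nat \<Rightarrow> nat option \<times> move)" where
  "delta m h Pre rd = (if rd ! 0 = None then (Run None m, nop(0 := (None, L)))
     else (Pre, nop(0 := (None, R))))"
| "delta m h (Run (Some (j, a)) k) rd = (Run None k, nop(j := (Some a, N)))"
| "delta m h (Run None c) rd = delta1 h c rd"

definition ctls :: "prog \<Rightarrow> prog \<Rightarrow> ctl set" where
  "ctls m h = insert Pre ((\<lambda>(x, c). Run x c) `
     (insert None (Some ` ({..nstacks} \<times> {..<10})) \<times> (conts m \<union> conts h)))"

lemma finite_ctls: "finite (ctls m h)"
  by (simp add: ctls_def)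

lemma Pre_ctls [simp]: "Pre \<in> ctls m h"
  by (simp add: ctls_def)

lemma Run_ctls [simp]: "Run x c \<in> ctls m h \<longleftrightarrow>
   (c \<in> conts m \<or> c \<in> conts h) \<and> (case x of None \<Rightarrow> True | Some (j, a) \<Rightarrow> j \<le> nstacks \<and> a < 10)"
  by (cases x) (auto simp: ctls_def image_iff)

lemma nexts_ctls: "c' \<in> nexts c \<Longrightarrow> c \<in> conts m \<or> c \<in> conts h \<Longrightarrow> c' \<in> conts m \<or> c' \<in> conts h"
  using nexts_conts by blast

lemma delta_ctls:
  assumes "wf_prog m" "wf_prog h" "c \<in> ctls m h" "\<forall>x \<in> set rd. \<forall>a. x = Some a \<longrightarrow> a < 10" "length rd = Suc nstacks"
  shows "fst (delta [m] [h] c rd) \<in> ctls m h"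
    and "\<forall>i \<le> nstacks. \<forall>a. fst (snd (delta [m] [h] c rd) i) = Some a \<longrightarrow> a < 10"
proof -
  have rd: "a < 10" if "rd ! i = Some a" "i < Suc nstacks" for i a
    using assms(4,5) that by (metis nth_mem)
  have "fst (delta [m] [h] c rd) \<in> ctls m h \<and>
    (\<forall>i \<le> nstacks. \<forall>a. fst (snd (delta [m] [h] c rd) i) = Some a \<longrightarrow> a < 10)"
  proof (cases c)
    case Pre
    then show ?thesis by (auto simp: nop_def)
  next
    case (Run x k)
    show ?thesis
    proof (cases x)
      case (Some p)
      then show ?thesis using Run assms(3) by (cases p) (auto simp: nop_def)
    next
      case None
      have k: "k \<in> conts m \<or> k \<in> conts h" using assms(3) Run None by simp
      then have wf: "list_all wf_prog k" using wf_prog_conts assms(1,2) by blast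
      have nx: "\<forall>c' \<in> nexts k. c' \<in> conts m \<or> c' \<in> conts h"
        using nexts_ctls k by blast
      have "fst (delta1 [h] k rd) \<in> ctls m h \<and>
        (\<forall>i \<le> nstacks. \<forall>a. fst (snd (delta1 [h] k rd) i) = Some a \<longrightarrow> a < 10)"
        using nx wf
        by (cases "([h], k, rd)" rule: delta1.cases)
           (simp_all add: nop_def split: option.split, (meson less_SucI rd)+)
      then show ?thesis using Run None by simp
    qed
  qed
  then show "fst (delta [m] [h] c rd) \<in> ctls m h"
    "\<forall>i \<le> nstacks. \<forall>a. fst (snd (delta [m] [h] c rd) i) = Some a \<longrightarrow> a < 10" by auto
qed

definition idx :: "prog \<Rightarrow> prog \<Rightarrow> ctl \<Rightarrow> nat" where
  "idx m h = (SOME f. bij_betw f (ctls m h) {0..<card (ctls m h)})"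

lemma bij_idx: "bij_betw (idx m h) (ctls m h) {0..<card (ctls m h)}"
  unfolding idx_def using ex_bij_betw_finite_nat[OF finite_ctls] by (rule someI_ex)

definition unidx :: "prog \<Rightarrow> prog \<Rightarrow> nat \<Rightarrow> ctl" where
  "unidx m h = inv_into (ctls m h) (idx m h)"

lemma unidx_idx [simp]: "c \<in> ctls m h \<Longrightarrow> unidx m h (idx m h c) = c"
  unfolding unidx_def using bij_idx by (metis bij_betw_def inv_into_f_f)

lemma idx_less: "c \<in> ctls m h \<Longrightarrow> idx m h c < card (ctls m h)"
  using bij_idx by (metis atLeastLessThan_iff bij_betwE)

lemma unidx_in: "q < card (ctls m h) \<Longrightarrow> unidx m h q \<in> ctls m h"
  unfolding unidx_def using bij_idx
  by (metis atLeastLessThan_iff bij_betw_imp_surj_on inv_into_into zero_le)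

definition mach :: "prog \<Rightarrow> prog \<Rightarrow> tm" where
  "mach m h = \<lparr> tm_tapes = Suc nstacks, tm_states = card (ctls m h), tm_syms = 10,
     tm_start = idx m h Pre, tm_halt = (\<lambda>q. q = idx m h (Run None [])),
     tm_trans = (\<lambda>q rd. (idx m h (fst (delta [m] [h] (unidx m h q) rd)),
        map (snd (delta [m] [h] (unidx m h q) rd)) [0..<Suc nstacks])) \<rparr>"

lemma wf_mach:
  assumes "wf_prog m" "wf_prog h"
  shows "wf_tm (mach m h)"
proof -
  have "fst (tm_trans (mach m h) q rd) < tm_states (mach m h)
      \<and> length (snd (tm_trans (mach m h) q rd)) = tm_tapes (mach m h)
      \<and> (\<forall>(w, mv) \<in> set (snd (tm_trans (mach m h) q rd)). \<forall>a. w = Some a \<longrightarrow> a < tm_syms (mach m h))"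
    if *: "q < tm_states (mach m h)" "length rd = tm_tapes (mach m h)"
      "\<forall>x\<in>set rd. \<forall>a. x = Some a \<longrightarrow> a < tm_syms (mach m h)" for q rd
  proof -
    have q: "unidx m h q \<in> ctls m h" using * by (intro unidx_in) (simp add: mach_def)
    have rd: "\<forall>x\<in>set rd. \<forall>a. x = Some a \<longrightarrow> a < 10" "length rd = Suc nstacks"
      using * by (simp_all add: mach_def)
    note d = delta_ctls[OF assms q rd]
    show ?thesis using idx_less[OF d(1)] d(2)
      by (auto simp: mach_def split: prod.splits) (metis fst_conv less_Suc_eq_le order.refl less_imp_le)+
  qed
  moreover have "tm_start (mach m h) < tm_states (mach m h)"
    by (simp add: mach_def idx_less)
  ultimately show ?thesis unfolding wf_tm_def by blast
qed

section \<open>Simulation of stack programs by the machine\<close>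

lemma tm_step_mach:
  assumes "c \<in> ctls m h" "length ts = Suc nstacks"
    and "delta [m] [h] c (map current ts) = (c', act)"
  shows "tm_step (mach m h) (idx m h c, ts) = (idx m h c',
    map (\<lambda>i. tape_move (snd (act i)) (tape_write (fst (act i)) (ts ! i))) [0..<Suc nstacks])"
proof -
  have "map2 (\<lambda>(w, mv) t. tape_move mv (tape_write w t)) (map act [0..<Suc nstacks]) ts =
    map (\<lambda>i. tape_move (snd (act i)) (tape_write (fst (act i)) (ts ! i))) [0..<Suc nstacks]"
    by (rule nth_equalityI) (auto simp: assms(2) case_prod_unfold simp del: upt_Suc)
  then show ?thesis using assms by (simp add: tm_step_def mach_def del: upt_Suc)
qed

lemma step_nop:
  assumes "c \<in> ctls m h" "length ts = Suc nstacks" "delta [m] [h] c (map current ts) = (c', nop)"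
  shows "tm_step (mach m h) (idx m h c, ts) = (idx m h c', ts)"
  using tm_step_mach[OF assms]
  by (simp add: nop_def assms(2) del: upt_Suc) (metis assms(2) map_nth)

lemma step_act1:
  assumes "c \<in> ctls m h" "length ts = Suc nstacks" "q \<le> nstacks"
    and "delta [m] [h] c (map current ts) = (c', nop(q := (w, mv)))"
  shows "tm_step (mach m h) (idx m h c, ts) = (idx m h c', ts[q := tape_move mv (tape_write w (ts ! q))])"
  using tm_step_mach[OF assms(1,2,4)] assms(2,3)
  by (simp add: nop_def del: upt_Suc)
     (rule nth_equalityI, auto simp: nth_list_update simp del: upt_Suc)

lemma step_act2:
  assumes "c \<in> ctls m h" "length ts = Suc nstacks" "p \<le> nstacks" "q \<le> nstacks" "p \<noteq> q"
    and "delta [m] [h] c (map current ts) = (c', nop(p := (None, L), q := (None, R)))"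
  shows "tm_step (mach m h) (idx m h c, ts) =
    (idx m h c', ts[p := tape_left (ts ! p), q := tape_right (ts ! q)])"
  using tm_step_mach[OF assms(1,2,6)] assms(2-5)
  by (simp add: nop_def del: upt_Suc)
     (rule nth_equalityI, auto simp: nth_list_update simp del: upt_Suc)

text \<open>The budget limits the live cells of all stacks together, but leftovers keep every tape
  at its past maximum. So the bound \<open>B\<close> is imposed on each tape separately, at the
  price of a factor \<open>Suc nstacks\<close> in the space.\<close>

definition tapes_rep :: "store \<Rightarrow> nat \<Rightarrow> nat tape list \<Rightarrow> bool" where
  "tapes_rep t B ts \<longleftrightarrow> length ts = Suc nstacks \<and> (\<forall>i \<le> nstacks. stack_rep (i = 1 \<or> i = 2) (ts ! i) (t i)
     \<and> tape_size (ts ! i) \<le> B \<and> (\<forall>a \<in> set (t i). a < 10))"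

text \<open>Tape \<open>nstacks\<close> holds one token per unit of unused budget: a push takes a token and a pop
  returns it, so an exhausted budget shows as an empty tape.\<close>
definition with_tokens :: "store \<Rightarrow> nat \<Rightarrow> store" where
  "with_tokens s B = s(nstacks := replicate (B - store_size s) 2)"

lemma tapes_rep_mono: "tapes_rep t B ts \<Longrightarrow> B \<le> B' \<Longrightarrow> tapes_rep t B' ts"
  unfolding tapes_rep_def by (meson le_trans)

lemma tapes_rep_pop:
  assumes "tapes_rep t B ts" "p \<le> nstacks" "p \<noteq> 1" "p \<noteq> 2" "t p \<noteq> []"
  shows "tapes_rep (t(p := tl (t p))) B (ts[p := tape_left (ts ! p)])"
  using assms stack_rep_pop[of "ts ! p" "t p"] unfolding tapes_rep_def
  by (auto simp: nth_list_update list.set_sel(2))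

lemma tapes_rep_push:
  assumes "tapes_rep t B ts" "q \<le> nstacks" "a < 10" "Suc (length (t q)) \<le> B"
  shows "tapes_rep (t(q := a # t q)) B (ts[q := tape_write (Some a) (tape_right (ts ! q))])"
proof -
  have "stack_rep (q = 1 \<or> q = 2) (ts ! q) (t q)" "tape_size (ts ! q) \<le> B"
    using assms unfolding tapes_rep_def by auto
  from stack_rep_push[OF this(1), of a] this(2) show ?thesis
    using assms unfolding tapes_rep_def by (auto simp: nth_list_update simp del: stack_rep.simps)
qed

definition tapes_le :: "config \<Rightarrow> nat \<Rightarrow> bool" where
  "tapes_le C B \<longleftrightarrow> length (snd C) = Suc nstacks \<and> (\<forall>i \<le> nstacks. tape_size (snd C ! i) \<le> B)"

lemma tapes_le_size:
  assumes "tapes_le C B"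
  shows "config_size C \<le> Suc nstacks * B"
proof -
  have "config_size C \<le> (\<Sum>t\<leftarrow>snd C. B)"
    unfolding config_size_def using assms
    by (intro sum_list_mono) (auto simp: tapes_le_def in_set_conv_nth less_Suc_eq_le)
  also have "\<dots> = Suc nstacks * B" using assms by (simp add: tapes_le_def sum_list_triv)
  finally show ?thesis .
qed

lemma tapes_le_mono: "tapes_le C B \<Longrightarrow> B \<le> B' \<Longrightarrow> tapes_le C B'"
  unfolding tapes_le_def by (meson le_trans)

definition Rel :: "prog \<Rightarrow> prog \<Rightarrow> prog list \<times> store \<times> nat \<Rightarrow> config \<Rightarrow> bool" where
  "Rel m h = (\<lambda>(c, s, B) C. \<exists>ts. C = (idx m h (Run None c), ts) \<and> (c \<in> conts m \<or> c \<in> conts h)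
     \<and> store_size s \<le> B \<and> tapes_rep (with_tokens s B) B ts)"

abbreviation budget :: "'a \<times> 'b \<times> nat \<Rightarrow> nat" where "budget X \<equiv> snd (snd X)"

lemma Rel_tapes_le: "Rel m h X C \<Longrightarrow> tapes_le C (budget X)"
  unfolding Rel_def tapes_le_def tapes_rep_def by (auto split: prod.splits)

definition simstep :: "prog \<Rightarrow> prog \<Rightarrow> prog list \<times> store \<times> nat \<Rightarrow> config \<Rightarrow> nat \<Rightarrow> bool" where
  "simstep m h X C n \<longleftrightarrow> 1 \<le> n \<and> n \<le> 2 \<and> Rel m h X ((tm_step (mach m h) ^^ n) C) \<and>
     (\<forall>i<n. tapes_le ((tm_step (mach m h) ^^ i) C) (budget X))"

lemma simstep1:
  assumes "Rel m h (c, s, B) C" "C = (idx m h (Run None c), ts)"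
    and "delta [m] [h] (Run None c) (map current ts) = (Run None c', nop)"
    and "c' \<in> conts m \<or> c' \<in> conts h"
  shows "simstep m h (c', s, B) C 1"
proof -
  have C: "tapes_rep (with_tokens s B) B ts" "c \<in> conts m \<or> c \<in> conts h" "store_size s \<le> B"
    using assms(1,2) unfolding Rel_def by auto
  have "tm_step (mach m h) C = (idx m h (Run None c'), ts)"
    unfolding assms(2) using C assms(3) by (intro step_nop) (auto simp: tapes_rep_def)
  then show ?thesis unfolding simstep_def using C assms Rel_tapes_le[OF assms(1)] by (auto simp: Rel_def)
qed

lemma tapes_le_upd2:
  "tapes_le (q, ts) B \<Longrightarrow> p \<le> nstacks \<Longrightarrow> j \<le> nstacks \<Longrightarrow> tape_size t \<le> B \<Longrightarrow> tape_size u \<le> B \<Longrightarrow>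
     tapes_le (q', ts[p := t, j := u]) B"
  unfolding tapes_le_def by (auto simp: nth_list_update)

text \<open>With the token tape included, \<open>Push\<close>, \<open>Pop\<close>, \<open>Mv\<close>
  and \<open>Cp\<close> all take a cell from a tape \<open>p\<close> and put one on a tape
  \<open>q\<close>; a push pays with a token and a pop is paid with one. Hence one lemma serves all
  four.\<close>

lemma simstep2:
  assumes "Rel m h (c, s, B) C" "C = (idx m h (Run None c), ts)"
    and d: "delta [m] [h] (Run None c) (map current ts) =
      (Run (Some (q, a)) k, nop(p := (None, L), q := (None, R)))"
    and p: "p \<le> nstacks" "p \<noteq> 1" "p \<noteq> 2" "with_tokens s B p \<noteq> []" and q: "q \<le> nstacks" "a < 10" "p \<noteq> q"
    and k: "k \<in> conts m \<or> k \<in> conts h"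
    and e: "(with_tokens s B)(p := tl (with_tokens s B p), q := a # with_tokens s B q) = with_tokens s' B" and s': "store_size s' \<le> B"
  shows "simstep m h (k, s', B) C 2"
proof -
  have C: "tapes_rep (with_tokens s B) B ts" "c \<in> conts m \<or> c \<in> conts h"
    using assms(1,2) unfolding Rel_def by auto
  have l: "length ts = Suc nstacks" using C by (simp add: tapes_rep_def)
  define ts1 where "ts1 = ts[p := tape_left (ts ! p), q := tape_right (ts ! q)]"
  define ts2 where "ts2 = ts[p := tape_left (ts ! p), q := tape_write (Some a) (tape_right (ts ! q))]"
  have 1: "tm_step (mach m h) C = (idx m h (Run (Some (q, a)) k), ts1)"
    unfolding assms(2) ts1_def using C l p q d by (intro step_act2) auto
  have l1: "length ts1 = Suc nstacks" by (simp add: ts1_def l)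
  have "tm_step (mach m h) (idx m h (Run (Some (q, a)) k), ts1) =
      (idx m h (Run None k), ts1[q := tape_move N (tape_write (Some a) (ts1 ! q))])"
    using q k l1 by (intro step_act1) auto
  also have "ts1[q := tape_move N (tape_write (Some a) (ts1 ! q))] = ts2"
    using q l by (simp add: ts1_def ts2_def)
  finally have 2: "(tm_step (mach m h) ^^ 2) C = (idx m h (Run None k), ts2)"
    using 1 by (simp add: numeral_2_eq_2)
  have ext_len: "length (with_tokens s' B q) \<le> B"
    using q s' length_le_store_size[of q s'] by (auto simp: with_tokens_def)
  have "length (with_tokens s' B q) = Suc (length (with_tokens s B q))"
    unfolding e[symmetric] by simp
  then have "tapes_rep ((with_tokens s B)(p := tl (with_tokens s B p), q := a # with_tokens s B q)) B ts2"
    using tapes_rep_push[OF tapes_rep_pop[OF C(1) p], of q a] q ext_len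
    by (simp add: ts2_def)
  then have "Rel m h (k, s', B) ((tm_step (mach m h) ^^ 2) C)"
    unfolding 2 Rel_def using k s' e by auto
  moreover have "tapes_le C B" using Rel_tapes_le[OF assms(1)] by simp
  moreover have "tapes_le (tm_step (mach m h) C) B"
    unfolding 1 ts1_def using \<open>tapes_le C B\<close> p q unfolding assms(2)
    by (intro tapes_le_upd2) (auto simp: tapes_le_def)
  ultimately show ?thesis unfolding simstep_def by (auto simp: less_Suc_eq numeral_2_eq_2)
qed

lemma simstep_grow:
  assumes "Rel m h (Grow # k, s, B) C" and k: "k \<in> conts m \<or> k \<in> conts h"
  shows "simstep m h (k, s, Suc B) C 2"
proof -
  obtain ts where C: "C = (idx m h (Run None (Grow # k)), ts)" "tapes_rep (with_tokens s B) B ts" "store_size s \<le> B"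
    "Grow # k \<in> conts m \<or> Grow # k \<in> conts h"
    using assms(1) unfolding Rel_def by auto
  have l: "length ts = Suc nstacks" using C by (simp add: tapes_rep_def)
  define ts1 where "ts1 = ts[nstacks := tape_right (ts ! nstacks)]"
  define ts2 where "ts2 = ts[nstacks := tape_write (Some 2) (tape_right (ts ! nstacks))]"
  have "tm_step (mach m h) C = (idx m h (Run (Some (nstacks, 2)) k),
      ts[nstacks := tape_move R (tape_write None (ts ! nstacks))])"
    unfolding C(1) using C l by (intro step_act1) auto
  then have 1: "tm_step (mach m h) C = (idx m h (Run (Some (nstacks, 2)) k), ts1)"
    by (simp add: ts1_def)
  have l1: "length ts1 = Suc nstacks" by (simp add: ts1_def l)
  have "tm_step (mach m h) (idx m h (Run (Some (nstacks, 2)) k), ts1) =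
      (idx m h (Run None k), ts1[nstacks := tape_move N (tape_write (Some 2) (ts1 ! nstacks))])"
    using k l1 by (intro step_act1) auto
  also have "ts1[nstacks := tape_move N (tape_write (Some 2) (ts1 ! nstacks))] = ts2"
    using l by (simp add: ts1_def ts2_def)
  finally have 2: "(tm_step (mach m h) ^^ 2) C = (idx m h (Run None k), ts2)"
    using 1 by (simp add: numeral_2_eq_2)
  have e: "(with_tokens s B)(nstacks := 2 # with_tokens s B nstacks) = with_tokens s (Suc B)"
    using C(3) by (simp add: with_tokens_def Suc_diff_le)
  have "tapes_rep (with_tokens s B) (Suc B) ts" using tapes_rep_mono[OF C(2)] by simp
  from tapes_rep_push[OF this, of nstacks 2] have "tapes_rep (with_tokens s (Suc B)) (Suc B) ts2"
    unfolding e[symmetric] ts2_def by (simp add: with_tokens_def)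
  then have "Rel m h (k, s, Suc B) ((tm_step (mach m h) ^^ 2) C)"
    unfolding 2 Rel_def using k C(3) by auto
  moreover have *: "tapes_le C (Suc B)" using tapes_le_mono[OF Rel_tapes_le[OF assms(1)], of "Suc B"] by simp
  moreover have "tapes_le (tm_step (mach m h) C) (Suc B)"
    unfolding 1 ts1_def using * tapes_le_upd2[of _ ts "Suc B" nstacks nstacks "ts ! nstacks" "tape_right (ts ! nstacks)"]
    unfolding C(1) by (auto simp: tapes_le_def)
  ultimately show ?thesis unfolding simstep_def by (auto simp: less_Suc_eq numeral_2_eq_2)
qed

lemma sim_bstep:
  assumes "wf_prog m" "wf_prog h" and R: "Rel m h (c, s, B) C" and nn: "c \<noteq> []"
  shows "\<exists>n. simstep m h (bstep [h] (c, s, B)) C n"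
proof -
  obtain ts where C: "C = (idx m h (Run None c), ts)" "tapes_rep (with_tokens s B) B ts" "store_size s \<le> B"
    and c: "c \<in> conts m \<or> c \<in> conts h"
    using R unfolding Rel_def by auto
  have wf: "list_all wf_prog c" using wf_prog_conts assms(1,2) c by blast
  have nx: "\<forall>c' \<in> nexts c. c' \<in> conts m \<or> c' \<in> conts h"
    using nexts_ctls c by blast
  have l: "length ts = Suc nstacks" using C by (simp add: tapes_rep_def)
  have cur: "map current ts ! i = (if s i = [] then None else Some (hd (s i)))" if "i < nstacks" for i
  proof -
    have "stack_rep (i = 1 \<or> i = 2) (ts ! i) (s i)"
      using that C(2) unfolding tapes_rep_def with_tokens_def by (auto dest!: spec[of _ i] simp del: stack_rep.simps)
    from stack_rep_current[OF this] show ?thesis using that l by simp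
  qed
  \<comment> \<open>An empty token tape means that the store has size exactly \<open>B\<close>. As a
    push adds one cell, this test decides the overflow condition of \<open>bstep\<close>.\<close>
  have curn: "map current ts ! nstacks = (if B - store_size s = 0 then None else Some 2)"
    using C(2) l stack_rep_current[of _ "ts ! nstacks"] unfolding tapes_rep_def with_tokens_def
    by (auto simp del: stack_rep.simps)
  have sym: "hd (s i) < 10" if "i < nstacks" "s i \<noteq> []" for i
    using C(2) that unfolding tapes_rep_def with_tokens_def by (auto dest!: spec[of _ i] simp del: stack_rep.simps)
  have hh: "[h] \<in> conts m \<or> [h] \<in> conts h" by simp
  have top_in: "(map current ts ! i \<in> Some ` A) = top_in A (s i)" if "i < nstacks" for i A
    using cur[OF that] by (auto simp: top_in_def)
  have n12: "nstacks \<noteq> 1" "nstacks \<noteq> Suc 0" "nstacks \<noteq> 2" by (auto simp: nstacks_def)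
  show ?thesis
  proof (cases "(c, s)" rule: istep.cases)
    case (1 s') then show ?thesis using nn by simp
  next
    case (2 k s')
    then show ?thesis using simstep1[OF R C(1), of k] nx C(3) by (auto simp: bstep_def)
  next
    case (3 j a k s')
    then have c': "c = Push j a # k" by simp
    have j: "j < nstacks" "a < 10" using wf c' by auto
    show ?thesis
    proof (cases "B - store_size s = 0")
      case True
      then show ?thesis using simstep1[OF R C(1) _ hh] c' curn C(3) j
        by (auto simp: bstep_def store_size_Suc)
    next
      case False
      then have "simstep m h (k, s(j := a # s j), B) C 2"
        using c' curn nx j by (intro simstep2[OF R C(1), of j a k nstacks])
          (auto simp: n12 with_tokens_def store_size_Suc fun_eq_iff)
      then show ?thesis using c' False j C(3) by (auto simp: bstep_def store_size_Suc)
    qed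
  next
    case (4 i k s')
    then have c': "c = Pop i # k" by simp
    have i: "i < nstacks" "i \<noteq> 1" "i \<noteq> 2" using wf c' by auto
    show ?thesis
    proof (cases "s i = []")
      case True
      then have "s(i := tl (s i)) = s" by auto
      then show ?thesis using simstep1[OF R C(1), of k] nx C(3) c' cur[OF i(1)] True
        by (auto simp: bstep_def)
    next
      case False
      note z = store_size_tl[of i s, OF i(1) False]
      have "simstep m h (k, s(i := tl (s i)), B) C 2"
        using c' cur[OF i(1)] nx i z C(3) False by (intro simstep2[OF R C(1), of nstacks 2 k i])
          (auto simp: n12 with_tokens_def fun_eq_iff Suc_diff_le simp flip: replicate_Suc)
      then show ?thesis using c' False C(3) z by (auto simp: bstep_def)
    qed
  next
    case (5 i j k s')
    then have c': "c = Mv i j # k" by simp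
    have i: "i < nstacks" "i \<noteq> 1" "i \<noteq> 2" "j < nstacks" "i \<noteq> j" using wf c' by auto
    show ?thesis
    proof (cases "s i = []")
      case True
      then show ?thesis using simstep1[OF R C(1), of k] nx C(3) c' cur[OF i(1)] True
        by (auto simp: bstep_def)
    next
      case False
      note z = store_size_mv[of i j s "hd (s i)", OF i(1,4,5) False]
      have "simstep m h (k, s(i := tl (s i), j := hd (s i) # s j), B) C 2"
        using c' cur[OF i(1)] nx i z C(3) False sym[of i]
        by (intro simstep2[OF R C(1), of j "hd (s i)" k i])
          (auto simp: n12 with_tokens_def fun_eq_iff)
      then show ?thesis using c' False C(3) z by (auto simp: bstep_def)
    qed
  next
    case (6 i j k s')
    then have c': "c = Cp i j # k" by simp
    have i: "i < nstacks" "j < nstacks" using wf c' by auto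
    show ?thesis
    proof (cases "s i = []")
      case True
      then show ?thesis using simstep1[OF R C(1), of k] nx C(3) c' cur[OF i(1)] True
        by (auto simp: bstep_def)
    next
      case nonempty: False
      show ?thesis
      proof (cases "B - store_size s = 0")
        case True
        then show ?thesis using simstep1[OF R C(1) _ hh] c' curn C(3) i nonempty cur[OF i(1)]
          by (auto simp: bstep_def store_size_Suc)
      next
        case False
        then have "simstep m h (k, s(j := hd (s i) # s j), B) C 2"
          using c' curn nx i nonempty sym[of i] cur[OF i(1)]
          by (intro simstep2[OF R C(1), of j "hd (s i)" k nstacks])
            (auto simp: n12 with_tokens_def store_size_Suc fun_eq_iff)
        then show ?thesis using c' False i C(3) nonempty by (auto simp: bstep_def store_size_Suc)
      qed
    qed
  next
    case (7 k s')
    then show ?thesis using simstep_grow[of m h k s B C] R nx C(3) by (auto simp: bstep_def)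
  next
    case (8 i A p q k s')
    then show ?thesis using simstep1[OF R C(1), of "(if top_in A (s i) then p else q) # k"]
      nx C(3) top_in[of i A] wf by (auto simp: bstep_def)
  next
    case (9 i A p k s')
    then show ?thesis using simstep1[OF R C(1), of "if top_in A (s i) then p # Loop i A p # k else k"]
      nx C(3) top_in[of i A] wf by (auto simp: bstep_def)
  next
    case (10 p q k s')
    then show ?thesis using simstep1[OF R C(1), of "p # q # k"] nx C(3) by (auto simp: bstep_def)
  qed
qed

lemma budget_mono: "budget X \<le> budget (bstep h X)"
  by (auto simp: bstep_def Let_def split: prod.split)

lemma budget_mono_pow: "budget X \<le> budget ((bstep h ^^ n) X)"
  by (induction n) (auto intro: order.trans[OF _ budget_mono])

lemma bstep_nil: "store_size s \<le> B \<Longrightarrow> bstep h ([], s, B) = ([], s, B)"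
  by (simp add: bstep_def)

lemma sim_bsteps:
  assumes "wf_prog m" "wf_prog h" "Rel m h X C"
  shows "\<exists>k \<le> 2 * n. Rel m h ((bstep [h] ^^ n) X) ((tm_step (mach m h) ^^ k) C) \<and>
     (\<forall>i \<le> k. tapes_le ((tm_step (mach m h) ^^ i) C) (budget ((bstep [h] ^^ n) X)))"
proof (induction n)
  case 0
  then show ?case using assms(3) Rel_tapes_le by (intro exI[of _ 0]) auto
next
  case (Suc n)
  let ?M = "tm_step (mach m h)" and ?Y = "(bstep [h] ^^ n) X"
  from Suc obtain k where k: "k \<le> 2 * n" "Rel m h ?Y ((?M ^^ k) C)"
    "\<forall>i \<le> k. tapes_le ((?M ^^ i) C) (budget ?Y)" by blast
  obtain c s B where Y: "?Y = (c, s, B)" by (cases ?Y)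
  have le: "budget ?Y \<le> budget (bstep [h] ?Y)" by (rule budget_mono)
  show ?case
  proof (cases "c = []")
    case True
    have "store_size s \<le> B" using k(2) unfolding Y Rel_def by auto
    then have "bstep [h] ?Y = ?Y" unfolding Y True by (rule bstep_nil)
    then show ?thesis using k by (intro exI[of _ k]) auto
  next
    case False
    obtain n' where n': "simstep m h (bstep [h] ?Y) ((?M ^^ k) C) n'"
      using sim_bstep[OF assms(1,2), of c s B "(?M ^^ k) C"] k(2) False Y by auto
    have add: "(?M ^^ i) ((?M ^^ k) C) = (?M ^^ (i + k)) C" for i by (simp add: funpow_add)
    have "tapes_le ((?M ^^ i) C) (budget (bstep [h] ?Y))" if le_i: "i \<le> n' + k" for i
    proof (cases "i \<le> k")
      case True
      then show ?thesis using k(3) tapes_le_mono le by blast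
    next
      case nle: False
      then obtain i' where i': "i = i' + k" "i' \<le> n'" using le_i
        by (intro that[of "i - k"]) auto
      show ?thesis
      proof (cases "i' = n'")
        case True
        then show ?thesis using n' Rel_tapes_le unfolding simstep_def i' add by blast
      next
        case False
        then show ?thesis using n' i' unfolding simstep_def add by auto
      qed
    qed
    then show ?thesis using n' k(1) unfolding simstep_def add
      by (intro exI[of _ "n' + k"]) auto
  qed
qed

text \<open>The head scans past the right end and steps back, which puts the last symbol on top of
  stack 0. The initial budget is the input length, so the token tape starts empty and has to be
  prepared by nobody.\<close>

lemma Rel_start:
  assumes "wf_prog m" "wf_prog h" "w \<noteq> []" "\<forall>a \<in> set w. a < 10"
  shows "Rel m h ([m], (\<lambda>_. [])(0 := rev w), length w)
      ((tm_step (mach m h) ^^ Suc (length w)) (initial_config (mach m h) w)) \<and>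
     (\<forall>i \<le> Suc (length w). tapes_le ((tm_step (mach m h) ^^ i) (initial_config (mach m h) w)) (length w))"
proof -
  let ?M = "tm_step (mach m h)" and ?C = "initial_config (mach m h) w"
  define tp where "tp i = (if i < length w then Midtape (rev (take i w)) (w ! i) (drop (Suc i) w)
     else Rightof (last w) (rev (butlast w)))" for i
  have it: "init_tape w = tp 0" using assms(3) by (cases w) (auto simp: tp_def)
  have n1: "1 \<le> nstacks" by (simp add: nstacks_def)
  have ts: "tape_size (tp i) = length w" for i
    using assms(3) by (auto simp: tp_def)
  have rt: "tape_right (tp i) = tp (Suc i)" if "i < length w" for i
  proof (cases "Suc i < length w")
    case True
    then show ?thesis using that
      by (simp add: tp_def Cons_nth_drop_Suc[symmetric, of "Suc i"] take_Suc_conv_app_nth)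
  next
    case False
    then have *: "Suc i = length w" using that by simp
    then have "last w = w ! i" "butlast w = take i w" using assms(3)
      by (auto simp: last_conv_nth butlast_conv_take simp flip: *)
    then show ?thesis using * by (simp add: tp_def)
  qed
  have pre: "(?M ^^ i) ?C = (idx m h Pre, tp i # replicate nstacks Niltape)" if "i \<le> length w" for i
    using that
  proof (induction i)
    case 0
    then show ?case by (simp add: initial_config_def it mach_def)
  next
    case (Suc i)
    have "?M (idx m h Pre, tp i # replicate nstacks Niltape) = (idx m h Pre,
       (tp i # replicate nstacks Niltape)[0 := tape_move R (tape_write None ((tp i # replicate nstacks Niltape) ! 0))])"
      using Suc.prems by (intro step_act1) (auto simp: tp_def)
    then show ?case using Suc rt[of i] by simp
  qed
  let ?ts = "Midtape (rev (butlast w)) (last w) [] # replicate nstacks Niltape"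
  have "?M (idx m h Pre, tp (length w) # replicate nstacks Niltape) = (idx m h (Run None [m]),
       (tp (length w) # replicate nstacks Niltape)[0 := tape_move L (tape_write None ((tp (length w) # replicate nstacks Niltape) ! 0))])"
    by (intro step_act1) (auto simp: tp_def)
  then have deliver_prog: "(?M ^^ Suc (length w)) ?C = (idx m h (Run None [m]), ?ts)"
    using pre[of "length w"] by (simp add: tp_def)
  let ?s = "(\<lambda>_. [])(0 := rev w)"
  have szs: "store_size ?s = length w" using store_size_upd[of 0 "\<lambda>_. []" "rev w"] n1 by (simp add: store_size_def)
  have rw: "rev w = last w # rev (butlast w)" using assms(3)
    by (cases w rule: rev_cases) auto
  have "tapes_rep (with_tokens ?s (length w)) (length w) ?ts"
    unfolding tapes_rep_def
  proof (intro conjI allI impI)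
    fix i assume i: "i \<le> nstacks"
    show "stack_rep (i = 1 \<or> i = 2) (?ts ! i) (with_tokens ?s (length w) i)"
      using i n1 by (cases i) (auto simp: with_tokens_def szs[unfolded rw] rw)
    show "tape_size (?ts ! i) \<le> length w"
      using i assms(3) by (cases i) auto
    show "\<forall>a\<in>set (with_tokens ?s (length w) i). a < 10"
      using i assms(4) by (cases i) (auto simp: with_tokens_def szs)
  qed simp
  then have R: "Rel m h ([m], ?s, length w) ((?M ^^ Suc (length w)) ?C)"
    unfolding deliver_prog Rel_def using szs by auto
  have "tapes_le ((?M ^^ i) ?C) (length w)" if "i \<le> Suc (length w)" for i
  proof (cases "i = Suc (length w)")
    case True
    then show ?thesis using Rel_tapes_le[OF R] by simp
  next
    case False
    then have "i \<le> length w" using that by simp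
    from pre[OF this] show ?thesis
      by (auto simp: tapes_le_def ts nth_Cons' )
  qed
  then show ?thesis using R by blast
qed

lemma stack_rep_exact: "stack_rep True t xs \<Longrightarrow> tape_contents t = rev xs"
  by (cases xs) auto

text \<open>The halting configuration is a fixed point of \<^const>\<open>tm_step\<close>, so that the first halting
  time can be taken as the running time.\<close>
theorem mach_correct:
  assumes wf: "wf_prog m" "wf_prog h" and w: "w \<noteq> []" "\<forall>a \<in> set w. a < 10"
    and run: "(bstep [h] ^^ n) ([m], (\<lambda>_. [])(0 := rev w), length w) = ([], s, B)"
  shows "\<exists>k c'. tm_halts_in (mach m h) (initial_config (mach m h) w) k c' \<and>
    tape_contents (snd c' ! 1) = rev (s 1) \<and> tape_contents (snd c' ! 2) = rev (s 2) \<and>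
    k \<le> Suc (length w) + 2 * n \<and>
    tm_space (mach m h) (initial_config (mach m h) w) k \<le> Suc nstacks * B"
proof -
  let ?M = "tm_step (mach m h)" and ?C = "initial_config (mach m h) w" and ?s = "(\<lambda>_. [])(0 := rev w)"
  define C1 where "C1 = (?M ^^ Suc (length w)) ?C"
  note start = Rel_start[OF wf w, folded C1_def]
  obtain k where k: "k \<le> 2 * n" "Rel m h ([], s, B) ((?M ^^ k) C1)"
    "\<forall>i \<le> k. tapes_le ((?M ^^ i) C1) B"
    using sim_bsteps[OF wf conjunct1[OF start], of n] unfolding run by auto
  let ?K = "k + Suc (length w)"
  define cf where "cf = (?M ^^ ?K) ?C"
  have cf: "cf = (?M ^^ k) C1" 
    unfolding cf_def C1_def by (simp only: funpow_add o_apply)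
  have BB: "length w \<le> B" using budget_mono_pow[of "([m], ?s, length w)" n "[h]"] run by simp
  have sp: "tapes_le ((?M ^^ i) ?C) B" if le_i: "i \<le> ?K" for i
  proof (cases "i \<le> Suc (length w)")
    case True
    then show ?thesis using start tapes_le_mono BB by blast
  next
    case False
    then obtain i' where i': "i = i' + Suc (length w)" "i' \<le> k" using le_i
      by (intro that[of "i - Suc (length w)"]) auto
    then have "(?M ^^ i) ?C = (?M ^^ i') C1" 
      unfolding C1_def by (simp only: funpow_add o_apply)
    then show ?thesis using k(3) i' by simp
  qed
  have hlt: "tm_halt (mach m h) = (\<lambda>q. q = idx m h (Run None []))" by (simp add: mach_def)
  have fst_cf: "fst cf = idx m h (Run None [])" using k(2) unfolding cf Rel_def by auto
  define k0 where "k0 = (LEAST k. fst ((?M ^^ k) ?C) = idx m h (Run None []))"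
  have k0: "fst ((?M ^^ k0) ?C) = idx m h (Run None [])"
    unfolding k0_def by (rule LeastI[of _ ?K]) (use fst_cf cf_def in auto)
  have k0le: "k0 \<le> ?K" unfolding k0_def by (rule Least_le) (use fst_cf cf_def in auto)
  have halted: "(?M ^^ i) c = c"
    if fc: "fst c = idx m h (Run None [])" "length (snd c) = Suc nstacks" for c i
  proof (induction i)
    case (Suc i)
    have "?M c = c" using fc step_nop[of "Run None []" m h "snd c" "Run None []"]
      by (cases c) auto
    then show ?case using Suc by simp
  qed simp
  have "?K = (?K - k0) + k0" using k0le by simp
  then have "cf = (?M ^^ (?K - k0)) ((?M ^^ k0) ?C)"
    unfolding cf_def by (metis comp_apply funpow_add)
  also have "\<dots> = (?M ^^ k0) ?C"
    using sp[OF k0le] by (intro halted k0) (simp add: tapes_le_def)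
  finally have cf0: "(?M ^^ k0) ?C = cf" by simp
  have halts: "tm_halts_in (mach m h) ?C k0 cf"
    unfolding tm_halts_in_def hlt using cf0 fst_cf not_less_Least
    by (auto simp: k0_def)
  have srep1: "stack_rep True (snd cf ! 1) (s 1)" "stack_rep True (snd cf ! 2) (s 2)"
    using k(2) unfolding cf[symmetric] Rel_def tapes_rep_def with_tokens_def
    by (auto simp: nstacks_def dest: spec[of _ 1] spec[of _ 2] simp del: stack_rep.simps)
  have "tm_space (mach m h) ?C k0 \<le> Suc nstacks * B"
  proof -
    have "config_size ((?M ^^ i) ?C) \<le> Suc nstacks * B" if "i \<le> k0" for i
      using that k0le by (intro tapes_le_size sp) auto
    then show ?thesis unfolding tm_space_def by (subst Max_le_iff) auto
  qed
  then show ?thesis using halts srep1 k(1) k0le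
    by (intro exI[of _ k0] exI[of _ cf]) (auto dest!: stack_rep_exact)
qed

section \<open>Running stack programs: basic routines\<close>

definition reaches :: "prog list \<times> store \<Rightarrow> nat \<Rightarrow> prog list \<times> store \<Rightarrow> bool" where
  "reaches c t c' \<longleftrightarrow> (\<exists>n \<le> t. (istep ^^ n) c = c')"

lemma reaches_refl [simp]: "reaches c t c"
  unfolding reaches_def by (auto intro: exI[of _ 0])

lemma reaches_trans: "reaches c t c' \<Longrightarrow> reaches c' t' c'' \<Longrightarrow> reaches c (t + t') c''"
proof -
  assume "reaches c t c'" "reaches c' t' c''"
  then obtain n n' where n: "n \<le> t" "(istep ^^ n) c = c'" "n' \<le> t'" "(istep ^^ n') c' = c''"
    unfolding reaches_def by auto
  then have "(istep ^^ (n' + n)) c = c''" by (simp add: funpow_add)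
  then show ?thesis unfolding reaches_def using n by (intro exI[of _ "n' + n"]) auto
qed

lemma reaches_mono: "reaches c t c' \<Longrightarrow> t \<le> t' \<Longrightarrow> reaches c t' c'"
  unfolding reaches_def using le_trans by blast

lemma reaches_step: "reaches (istep c) t c' \<Longrightarrow> reaches c (Suc t) c'"
  unfolding reaches_def by (metis Suc_le_mono comp_apply funpow_Suc_right)

definition does :: "prog \<Rightarrow> store \<Rightarrow> nat \<Rightarrow> store \<Rightarrow> bool" where
  "does p s t s' \<longleftrightarrow> (\<forall>k. reaches (p # k, s) t (k, s'))"

text \<open>For a loop \<open>p\<close>, a run from loop head to loop head. Such runs compose, so a
  loop can be analysed by recursion on the data it traverses instead of by counting rounds.\<close>

definition iter :: "prog \<Rightarrow> store \<Rightarrow> nat \<Rightarrow> store \<Rightarrow> bool" where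
  "iter p s t s' \<longleftrightarrow> (\<forall>k. reaches (p # k, s) t (p # k, s'))"

lemma does_eq: "does p s t s' \<Longrightarrow> s' = s'' \<Longrightarrow> t \<le> t' \<Longrightarrow> does p s t' s''"
  unfolding does_def using reaches_mono by blast

lemma does_Skip: "does Skip s 1 s"
  and does_Push: "does (Push j a) s 1 (s(j := a # s j))"
  and does_Pop: "does (Pop i) s 1 (s(i := tl (s i)))"
  and does_Mv: "s i = x # xs \<Longrightarrow> does (Mv i j) s 1 (s(i := xs, j := x # s j))"
  and does_Cp: "s i = x # xs \<Longrightarrow> does (Cp i j) s 1 (s(j := x # s j))"
  unfolding does_def by (auto intro!: reaches_step)

lemma does_Seq: "does p s t s' \<Longrightarrow> does q s' t' s'' \<Longrightarrow> does (p ;; q) s (Suc (t + t')) s''"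
  unfolding does_def by (force intro!: reaches_step intro: reaches_trans)

lemma does_Cond: "does (if top_in A (s i) then p else q) s t s' \<Longrightarrow> does (Cond i A p q) s (Suc t) s'"
  unfolding does_def by (auto intro!: reaches_step split: if_splits)

lemma iter_refl [simp]: "iter p s t s"
  by (simp add: iter_def)

lemma iter_trans: "iter p s t s' \<Longrightarrow> iter p s' t' s'' \<Longrightarrow> iter p s (t + t') s''"
  unfolding iter_def using reaches_trans by blast

lemma iter_eq: "iter p s t s' \<Longrightarrow> s' = s'' \<Longrightarrow> t \<le> t' \<Longrightarrow> iter p s t' s''"
  unfolding iter_def using reaches_mono by blast

lemma iter_step: "top_in A (s i) \<Longrightarrow> does p s t s' \<Longrightarrow> iter (Loop i A p) s (Suc t) s'"
  unfolding iter_def does_def by (auto intro!: reaches_step)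

lemma does_Loop: "iter (Loop i A p) s t s' \<Longrightarrow> \<not> top_in A (s' i) \<Longrightarrow> does (Loop i A p) s (Suc t) s'"
proof -
  assume a: "iter (Loop i A p) s t s'" "\<not> top_in A (s' i)"
  have "reaches (Loop i A p # k, s') 1 (k, s')" for k
    using a(2) reaches_step[of "(Loop i A p # k, s')" 0] by simp
  then show ?thesis using a(1) reaches_trans unfolding iter_def does_def
    by (metis Suc_eq_plus1)
qed

lemma iter_mv:
  "s i = xs @ ys \<Longrightarrow> set xs \<subseteq> A \<Longrightarrow> i \<noteq> j \<Longrightarrow>
     iter (Loop i A (Mv i j)) s (2 * length xs) (s(i := ys, j := rev xs @ s j))"
proof (induction xs arbitrary: s)
  case Nil
  then show ?case by (auto intro!: iter_eq[OF iter_refl])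
next
  case (Cons x xs)
  let ?s = "s(i := xs @ ys, j := x # s j)"
  have 1: "iter (Loop i A (Mv i j)) s (Suc 1) ?s"
    using Cons.prems by (intro iter_step does_Mv) auto
  have "iter (Loop i A (Mv i j)) ?s (2 * length xs) (?s(i := ys, j := rev xs @ ?s j))"
    using Cons.prems by (intro Cons.IH) auto
  from iter_trans[OF 1 this] show ?case
    by (rule iter_eq) (use Cons.prems in auto)
qed

lemma does_mv:
  assumes "s i = xs @ ys" "set xs \<subseteq> A" "i \<noteq> j" "\<not> top_in A ys"
  shows "does (Loop i A (Mv i j)) s (2 * length xs + 1) (s(i := ys, j := rev xs @ s j))"
  by (rule does_eq[OF does_Loop[OF iter_mv[of s i xs ys A j]]]) (use assms in auto)

definition move_all :: "nat \<Rightarrow> nat \<Rightarrow> prog" where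
  "move_all i j = Loop i UNIV (Mv i j)"

lemma does_move_all:
  "i \<noteq> j \<Longrightarrow> does (move_all i j) s (2 * length (s i) + 1) (s(i := [], j := rev (s i) @ s j))"
  unfolding move_all_def by (rule does_mv) auto

definition clear :: "nat \<Rightarrow> prog" where
  "clear i = Loop i UNIV (Pop i)"

lemma does_clear: "does (clear i) s (2 * length (s i) + 1) (s(i := []))"
proof -
  have "iter (clear i) s (2 * length (s i)) (s(i := []))"
    unfolding clear_def
  proof (induction "s i" arbitrary: s)
    case Nil
    then show ?case by (auto intro!: iter_eq[OF iter_refl])
  next
    case (Cons x xs)
    have 1: "iter (Loop i UNIV (Pop i)) s (Suc 1) (s(i := tl (s i)))"
      using Cons(2) by (intro iter_step does_Pop) auto
    show ?case
      by (rule iter_eq[OF iter_trans[OF 1 Cons(1)]]) (use Cons(2) in \<open>auto simp flip: Cons(2)\<close>)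
  qed
  then show ?thesis unfolding clear_def by (intro does_eq[OF does_Loop]) auto
qed

definition copy_all :: "nat \<Rightarrow> nat \<Rightarrow> nat \<Rightarrow> prog" where
  "copy_all i j l = Loop i UNIV (Cp i j ;; Mv i l)"

lemma does_copy_all:
  assumes "i \<noteq> j" "i \<noteq> l" "j \<noteq> l"
  shows "does (copy_all i j l) s (4 * length (s i) + 1)
    (s(i := [], j := rev (s i) @ s j, l := rev (s i) @ s l))"
proof -
  have "iter (copy_all i j l) s (4 * length xs) (s(i := [], j := rev xs @ s j, l := rev xs @ s l))"
    if "s i = xs" for xs
    using that
  proof (induction xs arbitrary: s)
    case Nil
    then show ?case by (auto intro!: iter_eq[OF iter_refl])
  next
    case (Cons x xs)
    have 1: "iter (copy_all i j l) s (Suc (Suc (1 + 1))) (s(i := xs, j := x # s j, l := x # s l))"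
      unfolding copy_all_def using Cons.prems assms
      by (intro iter_step does_Seq[OF does_Cp[of s i x xs j]] does_eq[OF does_Mv[of _ i x xs l]])
        (auto simp: fun_eq_iff)
    show ?case
      by (rule iter_eq[OF iter_trans[OF 1 Cons.IH]]) (use assms in auto)
  qed
  then show ?thesis using assms unfolding copy_all_def by (intro does_eq[OF does_Loop]) auto
qed

section \<open>Moving a bracketed block\<close>

inductive balanced :: "nat \<Rightarrow> nat \<Rightarrow> nat list \<Rightarrow> bool" for b c where
  balanced_nil: "balanced b c []"
| balanced_sym: "x \<noteq> b \<Longrightarrow> x \<noteq> c \<Longrightarrow> balanced b c [x]"
| balanced_blk: "balanced b c xs \<Longrightarrow> balanced b c (b # xs @ [c])"
| balanced_app: "balanced b c xs \<Longrightarrow> balanced b c ys \<Longrightarrow> balanced b c (xs @ ys)"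

lemma balanced_rev: "balanced b c xs \<Longrightarrow> balanced c b (rev xs)"
proof (induction rule: balanced.induct)
  case (balanced_blk xs)
  then show ?case using balanced.balanced_blk[of c b "rev xs"] by simp
qed (auto intro: balanced.intros)

lemma balanced_replicate: "x \<noteq> b \<Longrightarrow> x \<noteq> c \<Longrightarrow> balanced b c (replicate n x)"
proof (induction n)
  case (Suc n)
  then show ?case using balanced_app[OF balanced_sym[of x b c], of "replicate n x"] by simp
qed (simp add: balanced_nil)

definition block_loop :: "nat \<Rightarrow> nat \<Rightarrow> nat \<Rightarrow> nat \<Rightarrow> prog" where
  "block_loop b c i j = Loop 8 UNIV (Cond i {b} (Push 8 2) (Cond i {c} (Pop 8) Skip) ;; Mv i j)"

definition move_block :: "nat \<Rightarrow> nat \<Rightarrow> nat \<Rightarrow> nat \<Rightarrow> prog" where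
  "move_block b c i j = Mv i j ;; Push 8 2 ;; block_loop b c i j"

lemma block_loop_step:
  assumes "i \<noteq> j" "i \<noteq> 8" "j \<noteq> 8" "s 8 \<noteq> []" "s i = x # xs"
  shows "iter (block_loop b c i j) s 6 (s(8 := (if x = b then 2 # s 8 else if x = c then tl (s 8) else s 8),
     i := xs, j := x # s j))"
proof -
  have a: "does (Cond i {b} (Push 8 2) (Cond i {c} (Pop 8) Skip)) s 3
    (s(8 := (if x = b then 2 # s 8 else if x = c then tl (s 8) else s 8)))"
    using assms
    by (auto intro!: does_eq[OF does_Cond] does_Push does_Pop does_Skip does_eq[OF does_Skip]
        does_eq[OF does_Cond, where t' = 2] simp: numeral_3_eq_3 numeral_2_eq_2)
  show ?thesis unfolding block_loop_def
    by (rule iter_eq, rule iter_step, use assms in simp, rule does_Seq, rule a, rule does_Mv)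
       (use assms in auto)
qed

text \<open>A balanced word never takes the depth below its initial value and restores it at the
  end. Starting from a nonempty stack 8, the loop therefore cannot stop inside the word.\<close>

lemma iter_bal:
  assumes "balanced b c xs" "b \<noteq> c" "i \<noteq> j" "i \<noteq> 8" "j \<noteq> 8" "s 8 \<noteq> []" "s i = xs @ ys"
  shows "iter (block_loop b c i j) s (6 * length xs) (s(i := ys, j := rev xs @ s j))"
  using assms(1,6,7)
proof (induction arbitrary: s ys)
  case balanced_nil
  then show ?case by (auto intro!: iter_eq[OF iter_refl])
next
  case (balanced_sym x)
  show ?case
    by (rule iter_eq[OF block_loop_step[OF assms(3-5), of s x ys]]) (use balanced_sym assms in auto)
next
  case (balanced_blk xs)
  let ?s = "s(8 := 2 # s 8, i := xs @ c # ys, j := b # s j)"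
  have 1: "iter (block_loop b c i j) s 6 ?s"
    by (rule iter_eq[OF block_loop_step[OF assms(3-5), of s b "xs @ c # ys"]]) (use balanced_blk assms in auto)
  let ?s2 = "?s(i := c # ys, j := rev xs @ ?s j)"
  have 2: "iter (block_loop b c i j) ?s (6 * length xs) ?s2"
    using assms(3-5) by (intro balanced_blk.IH) auto
  have 3: "iter (block_loop b c i j) ?s2 6 (s(i := ys, j := c # rev xs @ b # s j))"
    by (rule iter_eq[OF block_loop_step[OF assms(3-5), of ?s2 c ys]]) (use balanced_blk assms in \<open>auto simp: fun_eq_iff\<close>)
  show ?case by (rule iter_eq[OF iter_trans[OF iter_trans[OF 1 2] 3]]) auto
next
  case (balanced_app xs zs)
  let ?s = "s(i := zs @ ys, j := rev xs @ s j)"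
  have 1: "iter (block_loop b c i j) s (6 * length xs) ?s"
    using balanced_app.prems by (intro balanced_app.IH(1)) auto
  have 2: "iter (block_loop b c i j) ?s (6 * length zs) (?s(i := ys, j := rev zs @ ?s j))"
    using assms(3-5) balanced_app.prems by (intro balanced_app.IH(2)) auto
  show ?case by (rule iter_eq[OF iter_trans[OF 1 2]]) (use assms in auto)
qed

lemma does_move_block:
  assumes "balanced b c xs" "b \<noteq> c" "i \<noteq> j" "i \<noteq> 8" "j \<noteq> 8" "s 8 = []" "s i = b # xs @ c # ys"
  shows "does (move_block b c i j) s (6 * length xs + 11) (s(i := ys, j := c # rev xs @ b # s j))"
proof -
  let ?s = "s(i := xs @ c # ys, j := b # s j, 8 := [2])"
  let ?s2 = "?s(i := c # ys, j := rev xs @ ?s j)"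
  have 2: "iter (block_loop b c i j) ?s (6 * length xs) ?s2"
    by (rule iter_bal) (use assms in auto)
  have 3: "iter (block_loop b c i j) ?s2 6 (s(i := ys, j := c # rev xs @ b # s j))"
    by (rule iter_eq[OF block_loop_step[OF assms(3-5), of ?s2 c ys]]) (use assms in \<open>auto simp: fun_eq_iff\<close>)
  have 4: "does (block_loop b c i j) ?s (Suc (6 * length xs + 6)) (s(i := ys, j := c # rev xs @ b # s j))"
    using iter_trans[OF 2 3] assms unfolding block_loop_def by (intro does_Loop) auto
  have 1: "does (Mv i j) s 1 (s(i := xs @ c # ys, j := b # s j))"
    using assms by (intro does_Mv) auto
  have 5: "does (Push 8 2) (s(i := xs @ c # ys, j := b # s j)) 1 ?s"
    by (rule does_eq[OF does_Push]) (use assms in auto)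
  show ?thesis unfolding move_block_def
    by (rule does_eq[OF does_Seq[OF 1 does_Seq[OF 5 4]]]) auto
qed

section \<open>Terms with pointers, their code, and the fetching of stored values\<close>

datatype pterm = PVar nat | PPtr nat | PApp pterm pterm | PLam pterm

text \<open>Symbol 9 is the extra tape symbol for pointers.\<close>
fun enc :: "pterm \<Rightarrow> nat list" where
  "enc (PVar n) = 1 # replicate n 2"
| "enc (PPtr n) = 9 # replicate n 2"
| "enc (PApp s t) = enc s @ enc t @ [4]"
| "enc (PLam s) = 3 # enc s @ [0]"

fun emb :: "lterm \<Rightarrow> pterm" where
  "emb (Var n) = PVar n"
| "emb (App s t) = PApp (emb s) (emb t)"
| "emb (Lam s) = PLam (emb s)"

text \<open>Pointers are absolute, numbered in the order of storing, and refer to closed values: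
  neither binders nor later entries require any adjustment. For the same reason \<open>u\<close> is
  not shifted under a binder.\<close>

fun psubst :: "pterm \<Rightarrow> nat \<Rightarrow> pterm \<Rightarrow> pterm" where
  "psubst (PVar n) k u = (if n = k then u else PVar n)"
| "psubst (PPtr n) k u = PPtr n"
| "psubst (PApp s t) k u = PApp (psubst s k u) (psubst t k u)"
| "psubst (PLam s) k u = PLam (psubst s (Suc k) u)"

lemma emb_subst: "emb (subst s k u) = psubst (emb s) k (emb u)"
  by (induction s arbitrary: k) auto

lemma enc_emb: "enc_prog (gamma s) = enc (emb s)"
  by (induction s) (auto simp: enc_prog_def)

lemma balanced_enc: "balanced 3 0 (enc p)"
proof (induction p)
  case (PVar n)
  show ?case using balanced_app[OF balanced_sym[of 1 3 0] balanced_replicate[of 2 3 0 n]] by simp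
next
  case (PPtr n)
  show ?case using balanced_app[OF balanced_sym[of 9 3 0] balanced_replicate[of 2 3 0 n]] by simp
next
  case (PApp s t)
  then show ?case by (auto intro!: balanced_app balanced_sym)
next
  case (PLam s)
  then show ?case using balanced_blk by simp
qed

lemma enc_nonempty [simp]: "enc p \<noteq> []"
  by (induction p) auto

lemma hd_enc: "hd (enc p) \<noteq> 2"
  by (induction p) auto

text \<open>A unary index ends where the digits \<open>2\<close> end, so what follows it in the
  program must not begin with this digit.\<close>

definition hd_ok :: "nat list \<Rightarrow> bool" where
  "hd_ok ps \<longleftrightarrow> ps = [] \<or> hd ps \<noteq> 2"

lemma hd_ok_simps [simp]: "hd_ok []" "x \<noteq> 2 \<Longrightarrow> hd_ok (x # xs)" "hd_ok (enc p @ ps)"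
  using hd_enc[of p] by (auto simp: hd_ok_def)

text \<open>Stack 7 is reversed, so turning it over onto stack 16 brings the oldest entry to the
  top, and the pointer is the number of entries to skip. All entries, including the fetched one, are
  put back in their old order.\<close>

definition fetch :: prog where
  "fetch = Pop 6 ;; move_all 7 16 ;; Loop 6 {2} (Pop 6 ;; move_block 3 0 16 7) ;;
     move_block 3 0 16 9 ;; move_all 9 15 ;; copy_all 15 5 7 ;; move_all 16 7"

definition enc_entries :: "pterm list \<Rightarrow> nat list" where
  "enc_entries es = concat (map (\<lambda>e. enc (PLam e)) es)"

lemma enc_entries_simps [simp]: "enc_entries [] = []" "enc_entries (e # es) = enc (PLam e) @ enc_entries es"
  "enc_entries (es @ es') = enc_entries es @ enc_entries es'"
  by (simp_all add: enc_entries_def)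

lemma iter_fetch:
  "s 8 = [] \<Longrightarrow> s 16 = enc_entries es @ fs \<Longrightarrow> s 6 = replicate (length es) 2 @ ps \<Longrightarrow>
    iter (Loop 6 {2} (Pop 6 ;; move_block 3 0 16 7)) s (14 * length (enc_entries es))
     (s(6 := ps, 16 := fs, 7 := rev (enc_entries es) @ s 7))"
proof (induction es arbitrary: s)
  case Nil
  then show ?case by (auto intro!: iter_eq[OF iter_refl])
next
  case (Cons e es)
  let ?s = "s(6 := replicate (length es) 2 @ ps, 16 := enc_entries es @ fs, 7 := rev (enc (PLam e)) @ s 7)"
  have 1: "iter (Loop 6 {2} (Pop 6 ;; move_block 3 0 16 7)) s (14 * length (enc (PLam e))) ?s"
    by (rule iter_eq, rule iter_step, use Cons.prems in simp, rule does_Seq, rule does_Pop,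
        rule does_move_block[OF balanced_enc[of e], of _ _ _ "enc_entries es @ fs"])
       (use Cons.prems in \<open>auto simp: fun_eq_iff\<close>)
  have 2: "iter (Loop 6 {2} (Pop 6 ;; move_block 3 0 16 7)) ?s (14 * length (enc_entries es))
     (?s(6 := ps, 16 := fs, 7 := rev (enc_entries es) @ ?s 7))"
    by (rule Cons.IH) (use Cons.prems in auto)
  show ?case by (rule iter_eq[OF iter_trans[OF 1 2]]) auto
qed

lemma does_fetch:
  assumes "s 6 = enc (PPtr n) @ ps" "hd_ok ps" "n < length es" "s 7 = rev (enc_entries es)"
    "s 8 = []" "s 9 = []" "s 15 = []" "s 16 = []"
  shows "does fetch s (60 * length (enc_entries es) + 40)
    (s(6 := ps, 5 := rev (enc (PLam (es ! n))) @ s 5))"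
proof -
  define xs ys where "xs = enc_entries (take n es)" and "ys = enc_entries (drop (Suc n) es)"
  have es: "enc_entries es = xs @ enc (PLam (es ! n)) @ ys"
    unfolding xs_def ys_def using id_take_nth_drop[OF assms(3)]
    by (metis enc_entries_simps(2,3) append_assoc)
  let ?v = "enc (PLam (es ! n))"
  have 0: "does (Pop 6) s 1 (s(6 := replicate n 2 @ ps))"
    by (rule does_eq[OF does_Pop]) (use assms in auto)
  let ?s1 = "s(6 := replicate n 2 @ ps, 7 := [], 16 := xs @ ?v @ ys)"
  have 1: "does (move_all 7 16) (s(6 := replicate n 2 @ ps)) (2 * length (enc_entries es) + 1) ?s1"
    by (rule does_eq[OF does_move_all]) (use assms es in auto)
  let ?s2 = "s(6 := ps, 7 := rev xs, 16 := ?v @ ys)"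
  have 2: "does (Loop 6 {2} (Pop 6 ;; move_block 3 0 16 7)) ?s1 (Suc (14 * length xs)) ?s2"
  proof (rule does_Loop, rule iter_eq)
    show "iter (Loop 6 {2} (Pop 6 ;; move_block 3 0 16 7)) ?s1 (14 * length (enc_entries (take n es)))
       (?s1(6 := ps, 16 := ?v @ ys, 7 := rev (enc_entries (take n es)) @ ?s1 7))"
      by (rule iter_fetch) (use assms in \<open>auto simp: xs_def min_def\<close>)
  qed (use assms in \<open>auto simp: xs_def hd_ok_def top_in_def fun_eq_iff\<close>)
  let ?s3 = "s(6 := ps, 7 := rev xs, 16 := ys, 9 := rev ?v)"
  have 3: "does (move_block 3 0 16 9) ?s2 (6 * length (enc (es ! n)) + 11) ?s3"
    by (rule does_eq[OF does_move_block[OF balanced_enc[of "es ! n"], of _ _ _ ys]]) (use assms in \<open>auto simp: fun_eq_iff\<close>)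
  let ?s4 = "s(6 := ps, 7 := rev xs, 16 := ys, 15 := ?v)"
  have 4: "does (move_all 9 15) ?s3 (2 * length ?v + 1) ?s4"
    by (rule does_eq[OF does_move_all]) (use assms in \<open>auto simp: fun_eq_iff\<close>)
  let ?s5 = "s(6 := ps, 7 := rev ?v @ rev xs, 16 := ys, 5 := rev ?v @ s 5)"
  have 5: "does (copy_all 15 5 7) ?s4 (4 * length ?v + 1) ?s5"
    by (rule does_eq[OF does_copy_all]) (use assms in \<open>auto simp: fun_eq_iff\<close>)
  have 6: "does (move_all 16 7) ?s5 (2 * length ys + 1) (s(6 := ps, 5 := rev ?v @ s 5))"
    by (rule does_eq[OF does_move_all]) (use assms es in \<open>auto simp: fun_eq_iff\<close>)
  show ?thesis unfolding fetch_def
    by (rule does_eq[OF does_Seq[OF 0 does_Seq[OF 1 does_Seq[OF 2 does_Seq[OF 3 does_Seq[OF 4 does_Seq[OF 5 6]]]]]]])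
       (simp_all add: es)
qed

section \<open>Substitution\<close>

text \<open>At binder depth \<open>k\<close> stack 8 holds \<open>k + 1\<close> marks, and index
  \<open>n\<close> is turned into \<open>n + 1\<close> marks on stack 11. Pairing them off empties
  stack 8 iff \<open>n = k\<close>; the case \<open>n > k\<close> is excluded by the scope. Both
  stacks are then rebuilt.\<close>

definition var_case :: prog where
  "var_case = Loop 5 {2} (Mv 5 11) ;; Cond 5 {9} (move_all 11 6 ;; Mv 5 6)
     (Push 11 2 ;; Loop 11 UNIV (Mv 11 12 ;; Mv 8 13) ;;
      Cond 8 UNIV (move_all 13 8 ;; Pop 12 ;; move_all 12 6 ;; Mv 5 6)
        (move_all 13 8 ;; clear 12 ;; Pop 5 ;; copy_all 10 6 9 ;; move_all 9 10))"

text \<open>The body is read from its end, so \<open>0\<close> opens an abstraction and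
  \<open>3\<close> closes it. The \<open>3\<close> that empties stack 8 belongs to the abstraction
  being applied and is dropped, which ends the loop. The result lands in front of the remaining
  program, ready to be evaluated.\<close>

definition sub_body :: prog where
  "sub_body = Cond 5 {0} (Mv 5 6 ;; Push 8 2)
     (Cond 5 {3} (Pop 8 ;; Cond 8 UNIV (Mv 5 6) (Pop 5)) (Cond 5 {4} (Mv 5 6) var_case))"

definition sub_loop :: prog where
  "sub_loop = Loop 8 UNIV sub_body"

fun scoped :: "nat \<Rightarrow> nat \<Rightarrow> pterm \<Rightarrow> bool" where
  "scoped a d (PVar n) \<longleftrightarrow> n < d"
| "scoped a d (PPtr n) \<longleftrightarrow> n < a"
| "scoped a d (PApp s t) \<longleftrightarrow> scoped a d s \<and> scoped a d t"
| "scoped a d (PLam s) \<longleftrightarrow> scoped a (Suc d) s"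

lemma iter_cmp:
  "s 11 = xs \<Longrightarrow> s 8 = ys @ zs \<Longrightarrow> length ys = length xs \<Longrightarrow>
    iter (Loop 11 UNIV (Mv 11 12 ;; Mv 8 13)) s (4 * length xs)
     (s(11 := [], 12 := rev xs @ s 12, 8 := zs, 13 := rev ys @ s 13))"
proof (induction xs arbitrary: s ys)
  case Nil
  then show ?case by (auto intro!: iter_eq[OF iter_refl])
next
  case (Cons x xs)
  then obtain y ys' where ys: "ys = y # ys'" by (cases ys) auto
  let ?s = "s(11 := xs, 12 := x # s 12, 8 := ys' @ zs, 13 := y # s 13)"
  have 1: "iter (Loop 11 UNIV (Mv 11 12 ;; Mv 8 13)) s 4 ?s"
    by (rule iter_eq[OF iter_step[OF _ does_Seq[OF does_Mv[of s 11 x xs 12] does_Mv[of _ 8 y "ys' @ zs" 13]]]])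
      (use Cons.prems ys in \<open>auto simp: fun_eq_iff\<close>)
  have 2: "iter (Loop 11 UNIV (Mv 11 12 ;; Mv 8 13)) ?s (4 * length xs)
     (?s(11 := [], 12 := rev xs @ ?s 12, 8 := zs, 13 := rev ys' @ ?s 13))"
    using Cons.prems ys by (intro Cons.IH) auto
  show ?case by (rule iter_eq[OF iter_trans[OF 1 2]]) (use ys in \<open>auto simp: fun_eq_iff\<close>)
qed

lemma iter_sub1:
  assumes "s 8 \<noteq> []" "does sub_body s t s'"
  shows "iter sub_loop s (Suc t) s'"
  unfolding sub_loop_def using assms by (intro iter_step) auto

lemma sub_app_step: "s 5 = 4 # vs \<Longrightarrow> does sub_body s 4 (s(5 := vs, 6 := 4 # s 6))"
  unfolding sub_body_def
  by (rule does_eq, rule does_Cond, simp, rule does_Cond, simp, rule does_Cond, simp, rule does_Mv) auto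

lemma sub_ret_step: "s 5 = 0 # vs \<Longrightarrow> does sub_body s 4 (s(5 := vs, 6 := 0 # s 6, 8 := 2 # s 8))"
  unfolding sub_body_def
  by (rule does_eq, rule does_Cond, simp, rule does_Seq, rule does_Mv, assumption, rule does_Push) auto

lemma sub_lam_step:
  "s 5 = 3 # vs \<Longrightarrow> tl (s 8) \<noteq> [] \<Longrightarrow> does sub_body s 6 (s(5 := vs, 6 := 3 # s 6, 8 := tl (s 8)))"
  unfolding sub_body_def
  by (rule does_eq, rule does_Cond, simp, rule does_Cond, simp, rule does_Seq, rule does_Pop,
      rule does_Cond, simp, rule does_Mv) (auto simp: fun_eq_iff)

lemma sub_end_step: "s 5 = 3 # vs \<Longrightarrow> s 8 = [2] \<Longrightarrow> does sub_body s 6 (s(5 := vs, 8 := []))"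
  unfolding sub_body_def
  by (rule does_eq, rule does_Cond, simp, rule does_Cond, simp, rule does_Seq, rule does_Pop,
      rule does_Cond, simp, rule does_Pop) (auto simp: fun_eq_iff)

lemma var_start:
  assumes "s 5 = rev (x # replicate n 2) @ vs" "x \<noteq> 2" "s 11 = []"
  shows "does (Loop 5 {2} (Mv 5 11)) s (2 * n + 1) (s(5 := x # vs, 11 := replicate n 2))"
  by (rule does_eq[OF does_mv[of s 5 "replicate n 2" "x # vs" "{2}" 11]]) (use assms in auto)

lemma sub_ptr_step:
  assumes "s 5 = rev (enc (PPtr n)) @ vs" "s 11 = []"
  shows "does sub_body s (4 * n + 10) (s(5 := vs, 6 := enc (PPtr n) @ s 6))"
proof -
  have ne: "\<not> top_in {0} (s 5)" "\<not> top_in {3} (s 5)" "\<not> top_in {4} (s 5)"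
  proof -
    have "s 5 = replicate n 2 @ 9 # vs" using assms(1) by simp
    then show "\<not> top_in {0} (s 5)" "\<not> top_in {3} (s 5)" "\<not> top_in {4} (s 5)" by (cases n; simp)+
  qed
  have v: "does var_case s (4 * n + 7) (s(5 := vs, 6 := enc (PPtr n) @ s 6))"
    unfolding var_case_def
    by (rule does_eq, rule does_Seq, rule var_start[of s 9 n vs], use assms in simp, simp, use assms in simp,
        rule does_Cond, simp, rule does_Seq, rule does_move_all, simp, rule does_Mv, simp)
      (use assms in \<open>auto simp: fun_eq_iff\<close>)
  show ?thesis unfolding sub_body_def
    by (rule does_eq, rule does_Cond, simp add: ne, rule does_Cond, simp add: ne, rule does_Cond, simp add: ne, rule v)
      auto
qed

lemma sub_var_step:
  assumes "s 5 = rev (enc (PVar n)) @ vs" "s 8 = replicate (Suc k) 2" "n \<le> k" "s 10 = rev (enc r)"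
    "s 9 = []" "s 11 = []" "s 12 = []" "s 13 = []"
  shows "does sub_body s (12 * n + 6 * length (enc (psubst (PVar n) k r)) + 30)
    (s(5 := vs, 6 := enc (psubst (PVar n) k r) @ s 6))"
proof -
  have ne: "\<not> top_in {0} (s 5)" "\<not> top_in {3} (s 5)" "\<not> top_in {4} (s 5)"
  proof -
    have "s 5 = replicate n 2 @ 1 # vs" using assms(1) by simp
    then show "\<not> top_in {0} (s 5)" "\<not> top_in {3} (s 5)" "\<not> top_in {4} (s 5)" by (cases n; simp)+
  qed
  let ?s1 = "s(5 := 1 # vs, 11 := replicate n 2)"
  have 1: "does (Loop 5 {2} (Mv 5 11)) s (2 * n + 1) ?s1"
    using assms by (intro var_start) auto
  let ?s2 = "s(5 := 1 # vs, 11 := replicate (Suc n) 2)"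
  have 2: "does (Push 11 2) ?s1 1 ?s2"
    by (rule does_eq[OF does_Push]) (auto simp: fun_eq_iff)
  let ?s3 = "s(5 := 1 # vs, 12 := replicate (Suc n) 2, 8 := replicate (k - n) 2, 13 := replicate (Suc n) 2)"
  have 3: "does (Loop 11 UNIV (Mv 11 12 ;; Mv 8 13)) ?s2 (Suc (4 * Suc n)) ?s3"
  proof (rule does_Loop)
    have "replicate (Suc k) (2::nat) = replicate (Suc n) 2 @ replicate (k - n) 2"
      using assms(3) by (simp flip: replicate_add del: replicate_Suc)
    then show "iter (Loop 11 UNIV (Mv 11 12 ;; Mv 8 13)) ?s2 (4 * Suc n) ?s3"
      by (intro iter_eq[OF iter_cmp[of _ "replicate (Suc n) 2" "replicate (Suc n) 2" "replicate (k - n) 2"]])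
        (use assms in \<open>auto simp: fun_eq_iff simp del: replicate_Suc\<close>)
  qed (use assms in auto)
  let ?s' = "s(5 := vs, 6 := enc (psubst (PVar n) k r) @ s 6)"
  have D: "replicate (Suc n) 2 @ replicate (k - n) 2 = s 8"
    using assms(2,3) by (simp flip: replicate_add del: replicate_Suc)
  have v: "does var_case s (12 * n + 6 * length (enc (psubst (PVar n) k r)) + 27) ?s'"
  proof (cases "n = k")
    case True
    show ?thesis
      unfolding var_case_def
      by (rule does_eq, rule does_Seq, rule 1, rule does_Cond, simp del: One_nat_def,
        rule does_Seq, rule 2, rule does_Seq, rule 3, rule does_Cond, simp add: True, rule does_Seq,
        rule does_move_all, simp, rule does_Seq, rule does_clear, rule does_Seq, rule does_Pop,
        rule does_Seq, rule does_copy_all, simp, simp, simp, rule does_move_all, simp)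
       (use assms D True in \<open>auto simp: fun_eq_iff replicate_append_same\<close>)
  next
    case False
    then have nk: "\<not> k \<le> n" using assms(3) by simp
    show ?thesis
      unfolding var_case_def
      by (rule does_eq, rule does_Seq, rule 1, rule does_Cond, simp del: One_nat_def,
        rule does_Seq, rule 2, rule does_Seq, rule 3, rule does_Cond, simp add: nk, rule does_Seq, rule does_move_all, simp,
        rule does_Seq, rule does_Pop, rule does_Seq, rule does_move_all, simp, rule does_Mv, simp)
       (use assms D False in \<open>auto simp: fun_eq_iff replicate_append_same\<close>)
  qed
  show ?thesis unfolding sub_body_def
    by (rule does_eq, rule does_Cond, simp add: ne, rule does_Cond, simp add: ne, rule does_Cond, simp add: ne, rule v)
      auto
qed

text \<open>The cost is linear in input plus output, as every replaced occurrence is paid for by the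
  copy it produces. This linearity carries over to the space bound of the substitution mode.
  Arguments come before functions because the code is read backwards.\<close>

lemma iter_sub:
  "s 5 = rev (enc p) @ vs \<Longrightarrow> s 8 = replicate (Suc k) 2 \<Longrightarrow> scoped a (Suc k) p \<Longrightarrow> s 10 = rev (enc r) \<Longrightarrow>
    s 9 = [] \<Longrightarrow> s 11 = [] \<Longrightarrow> s 12 = [] \<Longrightarrow> s 13 = [] \<Longrightarrow>
    iter sub_loop s (40 * (length (enc p) + length (enc (psubst p k r))))
      (s(5 := vs, 6 := enc (psubst p k r) @ s 6))"
proof (induction p arbitrary: s vs k)
  case (PVar n)
  have d: "does sub_body s (12 * n + 6 * length (enc (psubst (PVar n) k r)) + 30)
    (s(5 := vs, 6 := enc (psubst (PVar n) k r) @ s 6))"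
    by (rule sub_var_step) (use PVar in auto)
  have l: "length (enc (psubst (PVar n) k r)) \<ge> 1" by (simp add: Suc_le_eq)
  show ?case by (rule iter_eq[OF iter_sub1[OF _ d]]) (use PVar.prems(2) l in auto)
next
  case (PPtr n)
  show ?case
    by (rule iter_eq[OF iter_sub1[OF _ sub_ptr_step[of s n vs]]]) (use PPtr in auto)
next
  case (PApp p q)
  let ?s1 = "s(5 := rev (enc q) @ rev (enc p) @ vs, 6 := 4 # s 6)"
  have 1: "iter sub_loop s 5 ?s1"
    by (rule iter_eq[OF iter_sub1[OF _ sub_app_step]]) (use PApp.prems in auto)
  let ?s2 = "s(5 := rev (enc p) @ vs, 6 := enc (psubst q k r) @ 4 # s 6)"
  have 2: "iter sub_loop ?s1 (40 * (length (enc q) + length (enc (psubst q k r)))) ?s2"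
    by (rule iter_eq[OF PApp.IH(2)[of ?s1 "rev (enc p) @ vs" k]]) (use PApp.prems in \<open>auto simp: fun_eq_iff\<close>)
  have 3: "iter sub_loop ?s2 (40 * (length (enc p) + length (enc (psubst p k r))))
    (s(5 := vs, 6 := enc (psubst (PApp p q) k r) @ s 6))"
    by (rule iter_eq[OF PApp.IH(1)[of ?s2 vs k]]) (use PApp.prems in \<open>auto simp: fun_eq_iff\<close>)
  show ?case by (rule iter_eq[OF iter_trans[OF 1 iter_trans[OF 2 3]]]) auto
next
  case (PLam p)
  let ?s1 = "s(5 := rev (enc p) @ 3 # vs, 6 := 0 # s 6, 8 := replicate (Suc (Suc k)) 2)"
  have 1: "iter sub_loop s 5 ?s1"
    by (rule iter_eq[OF iter_sub1[OF _ sub_ret_step]]) (use PLam.prems in \<open>auto simp: fun_eq_iff\<close>)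
  let ?s2 = "s(5 := 3 # vs, 6 := enc (psubst p (Suc k) r) @ 0 # s 6, 8 := replicate (Suc (Suc k)) 2)"
  have 2: "iter sub_loop ?s1 (40 * (length (enc p) + length (enc (psubst p (Suc k) r)))) ?s2"
    by (rule iter_eq[OF PLam.IH[of ?s1 "3 # vs" "Suc k"]]) (use PLam.prems in \<open>auto simp: fun_eq_iff\<close>)
  have 3: "iter sub_loop ?s2 7 (s(5 := vs, 6 := enc (psubst (PLam p) k r) @ s 6))"
    by (rule iter_eq[OF iter_sub1[OF _ sub_lam_step[of ?s2 vs]]]) (use PLam.prems in \<open>auto simp: fun_eq_iff\<close>)
  show ?case by (rule iter_eq[OF iter_trans[OF 1 iter_trans[OF 2 3]]]) auto
qed

text \<open>The number of values stored so far is the index of the new one. Copying it from stack 14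
  on top of \<open>9\<close> yields the reversed code of the pointer, just as
  \<open>sub_loop\<close> expects its replacement.\<close>

definition share :: prog where
  "share = move_all 9 7 ;; Push 10 9 ;; copy_all 14 10 15 ;; move_all 15 14 ;; Push 14 2"

definition apply_prog :: prog where
  "apply_prog = Pop 6 ;; move_block 0 3 5 9 ;; Cond 4 {2} share (move_all 9 10) ;;
     Pop 5 ;; Push 8 2 ;; sub_loop ;; clear 10"

text \<open>Here \<open>r\<close> is what replaces the variable, and \<open>e'\<close>,
  \<open>n'\<close> are the stored values and their number afterwards. The modes differ only in
  these three, so one run covers both.\<close>

lemma does_apply:
  assumes s: "s 6 = 4 # ps" "s 5 = rev (enc (PLam b)) @ rev (enc (PLam a)) @ vs"
    "s 8 = []" "s 9 = []" "s 10 = []" "s 11 = []" "s 12 = []" "s 13 = []" "s 15 = []"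
    and mode: "s 4 = [] \<and> r = PLam b \<and> e' = s 7 \<and> n' = s 14 \<or>
      s 4 = [2] \<and> s 14 = replicate n 2 \<and> r = PPtr n \<and> e' = rev (enc (PLam b)) @ s 7 \<and> n' = 2 # s 14"
    and sc: "scoped l 1 a"
  shows "does apply_prog s (40 * (length (enc (PLam a)) + length (enc (psubst a 0 r))) + 10 * length (enc (PLam b))
      + 10 * length n' + 100)
    (s(5 := vs, 6 := enc (psubst a 0 r) @ ps, 7 := e', 14 := n'))"
proof -
  let ?s1 = "s(6 := ps)"
  have 1: "does (Pop 6) s 1 ?s1"
    by (rule does_eq[OF does_Pop]) (use s in auto)
  let ?s2 = "s(6 := ps, 5 := rev (enc (PLam a)) @ vs, 9 := enc (PLam b))"
  have 2: "does (move_block 0 3 5 9) ?s1 (6 * length (enc b) + 11) ?s2"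
    by (rule does_eq[OF does_move_block[OF balanced_rev[OF balanced_enc[of b]], of _ _ _ "rev (enc (PLam a)) @ vs"]])
      (use s in \<open>auto simp: fun_eq_iff\<close>)
  let ?s3 = "s(6 := ps, 5 := rev (enc (PLam a)) @ vs, 10 := rev (enc r), 7 := e', 14 := n')"
  have 3: "does (Cond 4 {2} share (move_all 9 10)) ?s2 (2 * length (enc (PLam b)) + 8 * length n' + 20) ?s3"
  proof (cases "s 4 = []")
    case True
    show ?thesis
      by (rule does_eq, rule does_Cond, simp add: True, rule does_move_all, simp)
        (use s mode True in \<open>auto simp: fun_eq_iff\<close>)
  next
    case False
    then have m: "s 4 = [2]" "s 14 = replicate n 2" "r = PPtr n" "e' = rev (enc (PLam b)) @ s 7" "n' = 2 # s 14"
      using mode by auto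
    show ?thesis
      unfolding share_def
      by (rule does_eq, rule does_Cond, simp add: m(1), rule does_Seq, rule does_move_all, simp, rule does_Seq,
          rule does_Push, rule does_Seq, rule does_copy_all, simp, simp, simp, rule does_Seq, rule does_move_all, simp,
          rule does_Push)
        (use s m in \<open>auto simp: fun_eq_iff replicate_append_same\<close>)
  qed
  let ?s4 = "?s3(5 := rev (enc a) @ 3 # vs)"
  have 4: "does (Pop 5) ?s3 1 ?s4"
    by (rule does_eq[OF does_Pop]) (auto simp: fun_eq_iff)
  let ?s5 = "?s4(8 := [2])"
  have 5: "does (Push 8 2) ?s4 1 ?s5"
    by (rule does_eq[OF does_Push]) (use s in \<open>auto simp: fun_eq_iff\<close>)
  let ?s6 = "?s5(5 := 3 # vs, 6 := enc (psubst a 0 r) @ ps)"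
  have 6: "iter sub_loop ?s5 (40 * (length (enc a) + length (enc (psubst a 0 r)))) ?s6"
    by (rule iter_eq[OF iter_sub[of ?s5 a "3 # vs" 0 l r]]) (use s sc in \<open>auto simp: fun_eq_iff\<close>)
  let ?s7 = "?s3(5 := vs, 6 := enc (psubst a 0 r) @ ps)"
  have 7: "iter sub_loop ?s6 7 ?s7"
    by (rule iter_eq[OF iter_sub1[OF _ sub_end_step[of ?s6 vs]]]) (use s in \<open>auto simp: fun_eq_iff\<close>)
  have 8: "does sub_loop ?s5 (Suc (40 * (length (enc a) + length (enc (psubst a 0 r))) + 7)) ?s7"
    unfolding sub_loop_def
    by (rule does_Loop[OF iter_trans[OF 6 7, unfolded sub_loop_def]]) (use s in auto)
  have lr: "2 * length (enc r) \<le> 2 * length (enc (PLam b)) + 2 * length n'"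
    using mode by auto
  have 9: "does (clear 10) ?s7 (2 * length (enc r) + 1) (s(5 := vs, 6 := enc (psubst a 0 r) @ ps, 7 := e', 14 := n'))"
    by (rule does_eq[OF does_clear]) (use s in \<open>auto simp: fun_eq_iff\<close>)
  show ?thesis unfolding apply_prog_def
    by (rule does_eq[OF does_Seq[OF 1 does_Seq[OF 2 does_Seq[OF 3 does_Seq[OF 4 does_Seq[OF 5 does_Seq[OF 8 9]]]]]]])
      (use lr in auto)
qed

section \<open>Output\<close>

text \<open>A closure stored as entry \<open>a\<close> only refers to entries \<open>k < a\<close>; following links from
  address \<open>a\<close> reaches entry \<open>k\<close> (at address \<open>k + 1\<close>) after \<open>a - 1 - k\<close> steps.\<close>
fun close_ptrs :: "nat \<Rightarrow> nat \<Rightarrow> pterm \<Rightarrow> lterm" where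
  "close_ptrs a d (PVar n) = Var n"
| "close_ptrs a d (PPtr k) = Var (d + (a - 1 - k))"
| "close_ptrs a d (PApp s t) = App (close_ptrs a d s) (close_ptrs a d t)"
| "close_ptrs a d (PLam s) = Lam (close_ptrs a (Suc d) s)"

lemma enc_prog_simps: "enc_prog [] = []" "enc_prog (c # cs) = enc_cmd c @ enc_prog cs"
  "enc_prog (cs @ ds) = enc_prog cs @ enc_prog ds"
  by (simp_all add: enc_prog_def)

text \<open>Computes the index \<open>d + (a - 1 - k)\<close> in unary: \<open>d\<close> is copied
  from stack 8; then \<open>k\<close> marks and one more are set aside from the \<open>a\<close>
  marks on stack 17, and the rest is copied. Stacks 8 and 17 are restored.\<close>

definition conv_ptr :: "nat \<Rightarrow> nat \<Rightarrow> prog" where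
  "conv_ptr i j = Pop i ;; Push j 1 ;; copy_all 8 j 13 ;; move_all 13 8 ;; Loop i {2} (Pop i ;; Mv 17 18) ;;
     Mv 17 18 ;; copy_all 17 j 18 ;; move_all 18 17"

definition conv_loop :: "nat \<Rightarrow> nat \<Rightarrow> prog" where
  "conv_loop i j = Loop 8 UNIV (Cond i {3} (Push 8 2 ;; Mv i j)
     (Cond i {0} (Pop 8 ;; Cond 8 UNIV (Mv i j) (Pop i)) (Cond i {9} (conv_ptr i j) (Mv i j))))"

text \<open>A closure for \<open>Lam u\<close> stores only the code of \<open>u\<close>, so the
  outer brackets are dropped. The initial mark on stack 8 both keeps the loop running and records
  the binder depth 1 of the body.\<close>

definition conv_prog :: "nat \<Rightarrow> nat \<Rightarrow> prog" where
  "conv_prog i j = Pop i ;; Push 8 2 ;; conv_loop i j"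

lemma iter_count:
  "s i = replicate n 2 @ ys \<Longrightarrow> s 17 = replicate (n + m) 2 \<Longrightarrow> i \<noteq> 17 \<Longrightarrow> i \<noteq> 18 \<Longrightarrow>
    iter (Loop i {2} (Pop i ;; Mv 17 18)) s (4 * n)
     (s(i := ys, 17 := replicate m 2, 18 := replicate n 2 @ s 18))"
proof (induction n arbitrary: s)
  case 0
  then show ?case by (auto intro!: iter_eq[OF iter_refl])
next
  case (Suc n)
  let ?s = "s(i := replicate n 2 @ ys, 17 := replicate (n + m) 2, 18 := 2 # s 18)"
  have 1: "iter (Loop i {2} (Pop i ;; Mv 17 18)) s 4 ?s"
    by (rule iter_eq[OF iter_step[OF _ does_Seq[OF does_Pop does_Mv[of _ 17 2 "replicate (n + m) 2" 18]]]])
      (use Suc.prems in \<open>auto simp: fun_eq_iff\<close>)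
  have 2: "iter (Loop i {2} (Pop i ;; Mv 17 18)) ?s (4 * n)
     (?s(i := ys, 17 := replicate m 2, 18 := replicate n 2 @ ?s 18))"
    using Suc.prems by (intro Suc.IH) auto
  show ?case by (rule iter_eq[OF iter_trans[OF 1 2]])
      (use Suc.prems in \<open>auto simp: fun_eq_iff replicate_app_Cons_same\<close>)
qed

context
  fixes i j :: nat
  assumes ij: "i \<noteq> j" "i \<noteq> 8" "i \<noteq> 13" "i \<noteq> 17" "i \<noteq> 18" "j \<noteq> 8" "j \<noteq> 13" "j \<noteq> 17" "j \<noteq> 18"
begin

lemma does_ptr:
  assumes "s i = enc (PPtr k) @ ys" "hd_ok ys" "s 8 = replicate d 2" "s 17 = replicate a 2" "k < a"
    "s 13 = []" "s 18 = []"
  shows "does (conv_ptr i j) s (6 * d + 6 * a + 20)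
    (s(i := ys, j := rev (enc_prog (gamma (close_ptrs a d (PPtr k)))) @ s j))"
proof -
  let ?s1 = "s(i := replicate k 2 @ ys)"
  have 1: "does (Pop i) s 1 ?s1"
    by (rule does_eq[OF does_Pop]) (use assms in auto)
  let ?s2 = "?s1(j := 1 # s j)"
  have 2: "does (Push j 1) ?s1 1 ?s2"
    by (rule does_eq[OF does_Push]) (use ij in auto)
  let ?s3 = "?s1(j := replicate d 2 @ 1 # s j, 8 := [], 13 := replicate d 2)"
  have 3: "does (copy_all 8 j 13) ?s2 (4 * d + 1) ?s3"
    by (rule does_eq[OF does_copy_all]) (use ij assms in \<open>auto simp: fun_eq_iff\<close>)
  let ?s4 = "?s1(j := replicate d 2 @ 1 # s j)"
  have 4: "does (move_all 13 8) ?s3 (2 * d + 1) ?s4"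
    by (rule does_eq[OF does_move_all]) (use ij assms in \<open>auto simp: fun_eq_iff\<close>)
  let ?s5 = "?s4(i := ys, 17 := replicate (a - k) 2, 18 := replicate k 2)"
  have 5: "does (Loop i {2} (Pop i ;; Mv 17 18)) ?s4 (Suc (4 * k)) ?s5"
  proof (rule does_Loop)
    show "iter (Loop i {2} (Pop i ;; Mv 17 18)) ?s4 (4 * k) ?s5"
      by (rule iter_eq[OF iter_count[of ?s4 i k ys "a - k"]]) (use ij assms in \<open>auto simp: fun_eq_iff\<close>)
  qed (use ij assms in \<open>auto simp: hd_ok_def top_in_def\<close>)
  have ak: "a - k = Suc (a - 1 - k)" using assms by simp
  let ?s6 = "?s4(i := ys, 17 := replicate (a - 1 - k) 2, 18 := replicate (Suc k) 2)"
  have 6: "does (Mv 17 18) ?s5 1 ?s6"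
    by (rule does_eq[OF does_Mv[of _ 17 2 "replicate (a - 1 - k) 2"]])
      (use ij assms in \<open>auto simp: fun_eq_iff ak simp flip: replicate_Suc\<close>)
  let ?s7 = "?s4(i := ys, j := replicate (d + (a - 1 - k)) 2 @ 1 # s j, 17 := [], 18 := replicate a 2)"
  have aa: "replicate (a - 1 - k) 2 @ replicate (Suc k) 2 = replicate a (2::nat)"
    using assms by (simp flip: replicate_add del: replicate_Suc)
  have 7: "does (copy_all 17 j 18) ?s6 (4 * (a - 1 - k) + 1) ?s7"
    by (rule does_eq[OF does_copy_all])
       (use ij assms aa in \<open>auto simp: fun_eq_iff replicate_add[symmetric] add.commute simp flip: append_assoc\<close>)
  have 8: "does (move_all 18 17) ?s7 (2 * a + 1)
    (s(i := ys, j := rev (enc_prog (gamma (close_ptrs a d (PPtr k)))) @ s j))"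
    by (rule does_eq[OF does_move_all]) (use ij assms in \<open>auto simp: fun_eq_iff enc_prog_def\<close>)
  show ?thesis unfolding conv_ptr_def
    by (rule does_eq[OF does_Seq[OF 1 does_Seq[OF 2 does_Seq[OF 3 does_Seq[OF 4 does_Seq[OF 5
      does_Seq[OF 6 does_Seq[OF 7 8]]]]]]]]) (use assms in auto)
qed

lemma conv_step:
  assumes "s 8 \<noteq> []" "does (Cond i {3} (Push 8 2 ;; Mv i j)
     (Cond i {0} (Pop 8 ;; Cond 8 UNIV (Mv i j) (Pop i)) (Cond i {9} (conv_ptr i j) (Mv i j)))) s t s'"
  shows "iter (conv_loop i j) s (Suc t) s'"
  unfolding conv_loop_def using assms by (intro iter_step) auto

lemma conv_sym:
  "s 8 \<noteq> [] \<Longrightarrow> s i = xs @ ys \<Longrightarrow> set xs \<inter> {0, 3, 9} = {} \<Longrightarrow>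
    iter (conv_loop i j) s (5 * length xs) (s(i := ys, j := rev xs @ s j))"
proof (induction xs arbitrary: s)
  case Nil
  then show ?case by (auto intro!: iter_eq[OF iter_refl])
next
  case (Cons x xs)
  have 1: "iter (conv_loop i j) s 5 (s(i := xs @ ys, j := x # s j))"
    by (rule iter_eq, rule conv_step, use Cons.prems in simp, rule does_Cond, use Cons.prems in simp,
        rule does_Cond, use Cons.prems in simp, rule does_Cond, use Cons.prems in simp, rule does_Mv)
      (use Cons.prems in auto)
  have 2: "iter (conv_loop i j) (s(i := xs @ ys, j := x # s j)) (5 * length xs)
     (s(i := ys, j := rev (x # xs) @ s j))"
    by (rule iter_eq[OF Cons.IH]) (use Cons.prems ij in auto)
  show ?case by (rule iter_eq[OF iter_trans[OF 1 2]]) auto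
qed

lemma iter_conv:
  "s i = enc p @ ys \<Longrightarrow> hd_ok ys \<Longrightarrow> s 8 = replicate d 2 \<Longrightarrow> 0 < d \<Longrightarrow> s 17 = replicate a 2 \<Longrightarrow>
    scoped a d p \<Longrightarrow> s 13 = [] \<Longrightarrow> s 18 = [] \<Longrightarrow> d + length (enc p) \<le> dm \<Longrightarrow>
    iter (conv_loop i j) s (30 * (1 + a * (1 + dm)) * length (enc p))
      (s(i := ys, j := rev (enc_prog (gamma (close_ptrs a d p))) @ s j))"
proof (induction p arbitrary: s ys d)
  case (PVar n)
  have "iter (conv_loop i j) s (5 * length (enc (PVar n))) (s(i := ys, j := rev (enc (PVar n)) @ s j))"
    by (rule conv_sym) (use PVar.prems in auto)
  then show ?case by (rule iter_eq) (auto simp: enc_prog_def algebra_simps)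
next
  case (PPtr k)
  \<comment> \<open>A pointer in scope forces \<open>a > 0\<close>. So the part of the cost that
    grows with the depth can be charged to the term \<open>a * dm\<close>, which vanishes when there
    are no stored values.\<close>
  have da: "d \<le> a * dm" using PPtr.prems by (cases a) auto
  have 1: "iter (conv_loop i j) s (6 * d + 6 * a + 24)
      (s(i := ys, j := rev (enc_prog (gamma (close_ptrs a d (PPtr k)))) @ s j))"
    by (rule iter_eq, rule conv_step, use PPtr.prems in simp, rule does_Cond, use PPtr.prems in simp,
        rule does_Cond, use PPtr.prems in simp, rule does_Cond, use PPtr.prems in simp, rule does_ptr)
      (use PPtr.prems in auto)
  have "6 * d + 6 * a + 24 \<le> 30 * (1 + a * (1 + dm)) * 1"
    using da by (simp add: algebra_simps)
  also have "\<dots> \<le> 30 * (1 + a * (1 + dm)) * length (enc (PPtr k))"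
    by (intro mult_le_mono2) simp
  finally show ?case by (intro iter_eq[OF 1]) auto
next
  case (PApp p q)
  let ?W = "30 * (1 + a * (1 + dm))"
  let ?s1 = "s(i := enc q @ 4 # ys, j := rev (enc_prog (gamma (close_ptrs a d p))) @ s j)"
  have 1: "iter (conv_loop i j) s (?W * length (enc p)) ?s1"
    by (rule PApp.IH(1)) (use PApp.prems in auto)
  let ?s2 = "?s1(i := 4 # ys, j := rev (enc_prog (gamma (close_ptrs a d q))) @ ?s1 j)"
  have 2: "iter (conv_loop i j) ?s1 (?W * length (enc q)) ?s2"
    by (rule PApp.IH(2)) (use PApp.prems ij in auto)
  have 3: "iter (conv_loop i j) ?s2 (5 * length [4::nat]) (?s2(i := ys, j := rev [4] @ ?s2 j))"
    by (rule conv_sym) (use PApp.prems ij in auto)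
  show ?case
    by (rule iter_eq[OF iter_trans[OF 1 iter_trans[OF 2 3]]]) (use ij in \<open>auto simp: enc_prog_simps algebra_simps\<close>)
next
  case (PLam p)
  let ?W = "30 * (1 + a * (1 + dm))"
  let ?s1 = "s(i := enc p @ 0 # ys, j := 3 # s j, 8 := replicate (Suc d) 2)"
  have 1: "iter (conv_loop i j) s 5 ?s1"
    by (rule iter_eq, rule conv_step, use PLam.prems in simp, rule does_Cond, use PLam.prems in simp,
        rule does_Seq, rule does_Push, rule does_Mv[of _ _ 3 "enc p @ 0 # ys"])
       (use PLam.prems ij in \<open>auto simp: fun_eq_iff\<close>)
  let ?s2 = "?s1(i := 0 # ys, j := rev (enc_prog (gamma (close_ptrs a (Suc d) p))) @ ?s1 j)"
  have 2: "iter (conv_loop i j) ?s1 (?W * length (enc p)) ?s2"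
    by (rule PLam.IH) (use PLam.prems ij in auto)
  have 3: "iter (conv_loop i j) ?s2 8 (s(i := ys, j := rev (enc_prog (gamma (close_ptrs a d (PLam p)))) @ s j))"
    by (rule iter_eq, rule conv_step, use ij in simp, rule does_Cond, use ij in simp,
        rule does_Cond, use ij in simp, rule does_Seq, rule does_Pop, rule does_Cond, use ij PLam.prems in simp,
        rule does_Mv[of _ _ 0 ys])
       (use PLam.prems ij in \<open>auto simp: fun_eq_iff enc_prog_simps\<close>)
  show ?case
    by (rule iter_eq[OF iter_trans[OF 1 iter_trans[OF 2 3]]]) (use ij in \<open>auto simp: enc_prog_simps algebra_simps\<close>)
qed

lemma does_conv:
  assumes "s i = enc (PLam p) @ ys" "s 8 = []" "s 17 = replicate a 2" "scoped a 1 p" "s 13 = []" "s 18 = []"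
    "length (enc (PLam p)) \<le> dm"
  shows "does (conv_prog i j) s (30 * (1 + a * (1 + dm)) * dm + 13)
    (s(i := ys, j := rev (enc_prog (gamma (close_ptrs a 1 p))) @ s j))"
proof -
  let ?W = "30 * (1 + a * (1 + dm))"
  let ?s1 = "s(i := enc p @ 0 # ys)"
  have 1: "does (Pop i) s 1 ?s1"
    by (rule does_eq[OF does_Pop]) (use assms in auto)
  let ?s2 = "s(i := enc p @ 0 # ys, 8 := [2])"
  have 2: "does (Push 8 2) ?s1 1 ?s2"
    by (rule does_eq[OF does_Push]) (use assms ij in auto)
  let ?s3 = "?s2(i := 0 # ys, j := rev (enc_prog (gamma (close_ptrs a 1 p))) @ ?s2 j)"
  have 3: "iter (conv_loop i j) ?s2 (?W * length (enc p)) ?s3"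
    by (rule iter_conv) (use assms ij in auto)
  have 4: "iter (conv_loop i j) ?s3 8 (s(i := ys, j := rev (enc_prog (gamma (close_ptrs a 1 p))) @ s j))"
    by (rule iter_eq, rule conv_step, use ij in simp, rule does_Cond, use ij in simp,
        rule does_Cond, use ij in simp, rule does_Seq, rule does_Pop, rule does_Cond, use ij assms in simp,
        rule does_Pop)
       (use assms ij in \<open>auto simp: fun_eq_iff\<close>)
  have 5: "does (conv_loop i j) ?s2 (Suc (?W * length (enc p) + 8))
      (s(i := ys, j := rev (enc_prog (gamma (close_ptrs a 1 p))) @ s j))"
    unfolding conv_loop_def by (rule does_Loop[OF iter_trans[OF 3 4, unfolded conv_loop_def]])
      (use assms ij in auto)
  have "?W * length (enc p) \<le> ?W * dm" using assms by (intro mult_le_mono2) simp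
  then show ?thesis unfolding conv_prog_def
    by (intro does_eq[OF does_Seq[OF 1 does_Seq[OF 2 5]]]) auto
qed

end

section \<open>Binary addresses\<close>

declare enc_bin.simps [simp del]

fun incr_bits :: "nat list \<Rightarrow> nat list" where
  "incr_bits [] = [7]"
| "incr_bits (x # xs) = (if x = 7 then 6 # incr_bits xs else 7 # xs)"

lemma enc_bin_Suc: "enc_bin (Suc a) = incr_bits (enc_bin a)"
proof (induction a rule: less_induct)
  case (less a)
  show ?case
  proof (cases "a mod 2 = 0")
    case True
    then have "Suc a mod 2 = 1" "Suc a div 2 = a div 2" by presburger+
    then show ?thesis using True
      by (cases "a = 0") (simp_all add: enc_bin.simps[of a] enc_bin.simps[of "Suc a"] enc_bin.simps[of 0]
        enc_bin.simps[of "Suc 0"])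
  next
    case False
    then have a: "Suc a mod 2 = 0" "Suc a div 2 = Suc (a div 2)" "a div 2 < a" "a > 0" by presburger+
    show ?thesis using less[OF a(3)] False a(1,2,4)
      by (simp add: enc_bin.simps[of a] enc_bin.simps[of "Suc a"])
  qed
qed

lemma length_incr_bits: "length (incr_bits xs) \<le> Suc (length xs)"
  by (induction xs) auto

lemma enc_bin_0 [simp]: "enc_bin 0 = []"
  by (simp add: enc_bin.simps)

lemma length_enc_bin: "length (enc_bin a) \<le> a"
  by (induction a) (auto simp: enc_bin_Suc intro: order.trans[OF length_incr_bits])

text \<open>After the carry either a digit \<open>6\<close> or the end of the number is reached.
  Popping an empty stack does nothing, so both cases are handled by popping and then pushing
  \<open>7\<close>.\<close>

definition incr_prog :: prog where
  "incr_prog = Loop 19 {7} (Pop 19 ;; Push 20 6) ;; Pop 19 ;; Push 19 7 ;; move_all 20 19"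

lemma iter_inc:
  "s 19 = xs \<Longrightarrow> \<exists>ys n. (n \<le> length xs) \<and> iter (Loop 19 {7} (Pop 19 ;; Push 20 6)) s (4 * length xs)
     (s(19 := ys, 20 := replicate n 6 @ s 20)) \<and> \<not> top_in {7} ys \<and> incr_bits xs = replicate n 6 @ 7 # tl ys"
proof (induction xs arbitrary: s)
  case Nil
  then show ?case by (intro exI[of _ "[]"] exI[of _ 0]) (auto intro!: iter_eq[OF iter_refl])
next
  case (Cons x xs)
  show ?case
  proof (cases "x = 7")
    case True
    let ?s = "s(19 := xs, 20 := 6 # s 20)"
    have 1: "iter (Loop 19 {7} (Pop 19 ;; Push 20 6)) s 4 ?s"
      by (rule iter_eq[OF iter_step[OF _ does_Seq[OF does_Pop does_Push]]])
        (use Cons.prems True in \<open>auto simp: fun_eq_iff\<close>)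
    have xs: "?s 19 = xs" by simp
    obtain ys n where 2: "n \<le> length xs" "iter (Loop 19 {7} (Pop 19 ;; Push 20 6)) ?s (4 * length xs)
     (?s(19 := ys, 20 := replicate n 6 @ ?s 20))" "\<not> top_in {7} ys" "incr_bits xs = replicate n 6 @ 7 # tl ys"
      using Cons.IH[of ?s, OF xs] by blast
    have "iter (Loop 19 {7} (Pop 19 ;; Push 20 6)) s (4 * length (x # xs))
     (s(19 := ys, 20 := replicate (Suc n) 6 @ s 20))"
      by (rule iter_eq[OF iter_trans[OF 1 2(2)]]) (auto simp: fun_eq_iff replicate_app_Cons_same)
    moreover have "Suc n \<le> length (x # xs)" "incr_bits (x # xs) = replicate (Suc n) 6 @ 7 # tl ys"
      using 2 True by simp_all
    ultimately show ?thesis using 2(3) by blast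
  next
    case False
    then show ?thesis using Cons.prems
      by (intro exI[of _ "x # xs"] exI[of _ 0]) (auto intro!: iter_eq[OF iter_refl])
  qed
qed

lemma does_inc:
  assumes "s 19 = enc_bin a" "s 20 = []"
  shows "does incr_prog s (6 * a + 10) (s(19 := enc_bin (Suc a)))"
proof -
  let ?L = "Loop 19 {7} (Pop 19 ;; Push 20 6)"
  obtain ys n where n: "n \<le> length (enc_bin a)" "iter ?L s (4 * length (enc_bin a))
     (s(19 := ys, 20 := replicate n 6))" "\<not> top_in {7} ys" "incr_bits (enc_bin a) = replicate n 6 @ 7 # tl ys"
    using iter_inc[of s "enc_bin a"] assms by auto
  have 1: "does ?L s (Suc (4 * length (enc_bin a))) (s(19 := ys, 20 := replicate n 6))"
    by (rule does_Loop[OF n(2)]) (use n(3) in simp)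
  have 2: "does (Pop 19) (s(19 := ys, 20 := replicate n 6)) 1 (s(19 := tl ys, 20 := replicate n 6))"
    by (rule does_eq[OF does_Pop]) (auto simp: fun_eq_iff)
  have 3: "does (Push 19 7) (s(19 := tl ys, 20 := replicate n 6)) 1 (s(19 := 7 # tl ys, 20 := replicate n 6))"
    by (rule does_eq[OF does_Push]) (auto simp: fun_eq_iff)
  have 4: "does (move_all 20 19) (s(19 := 7 # tl ys, 20 := replicate n 6)) (2 * n + 1) (s(19 := enc_bin (Suc a)))"
    by (rule does_eq[OF does_move_all]) (use n(4) assms in \<open>auto simp: fun_eq_iff enc_bin_Suc\<close>)
  show ?thesis unfolding incr_prog_def
    by (rule does_eq[OF does_Seq[OF 1 does_Seq[OF 2 does_Seq[OF 3 4]]]])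
      (use n(1) length_enc_bin[of a] in auto)
qed

definition bin_prog :: "nat \<Rightarrow> prog" where
  "bin_prog j = copy_all 19 j 20 ;; move_all 20 19"

lemma does_bin:
  assumes "s 19 = enc_bin a" "s 20 = []" "j \<noteq> 19" "j \<noteq> 20"
  shows "does (bin_prog j) s (6 * a + 3) (s(j := rev (enc_bin a) @ s j))"
proof -
  have 1: "does (copy_all 19 j 20) s (4 * a + 1) (s(19 := [], j := rev (enc_bin a) @ s j, 20 := rev (enc_bin a)))"
    by (rule does_eq[OF does_copy_all]) (use assms length_enc_bin[of a] in auto)
  have 2: "does (move_all 20 19) (s(19 := [], j := rev (enc_bin a) @ s j, 20 := rev (enc_bin a))) (2 * a + 1)
     (s(j := rev (enc_bin a) @ s j))"
    by (rule does_eq[OF does_move_all]) (use assms length_enc_bin[of a] in \<open>auto simp: fun_eq_iff\<close>)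
  show ?thesis unfolding bin_prog_def by (rule does_eq[OF does_Seq[OF 1 2]]) auto
qed

section \<open>Printing the heap and the result\<close>

definition entry_body :: prog where
  "entry_body = conv_prog 16 22 ;; Push 22 5 ;; bin_prog 22 ;; Push 22 5 ;; bin_prog 22 ;; Push 22 8 ;; Push 17 2 ;; incr_prog"

definition out_prog :: prog where
  "out_prog = move_all 7 16 ;; Loop 16 UNIV entry_body ;; move_block 0 3 5 15 ;; conv_prog 15 21 ;; Push 21 5 ;; bin_prog 21"

text \<open>Entry number \<open>a\<close> has address \<open>a + 1\<close>, since addresses start at
  1 and address 0 stands for the empty environment. Both the environment of its closure and its link
  are \<open>a\<close>, the address of the preceding entry, so the heap is a single chain.\<close>

fun heap_of :: "nat \<Rightarrow> pterm list \<Rightarrow> heap" where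
  "heap_of a [] = []"
| "heap_of a (e # es) = ((gamma (close_ptrs a 1 e), a), a) # heap_of (Suc a) es"

lemma enc_heap_simps [simp]: "enc_heap [] = []"
  "enc_heap ((g, b) # H) = enc_clos g @ [5] @ enc_bin b @ [8] @ enc_heap H"
  by (simp_all add: enc_heap_def)

lemma does_entry:
  assumes "s 16 = enc (PLam e) @ fs" "s 17 = replicate a 2" "s 19 = enc_bin a" "s 20 = []" "s 8 = []"
    "s 13 = []" "s 18 = []" "scoped a 1 e" "length (enc (PLam e)) \<le> dm"
  shows "does entry_body s (30 * (1 + a * (1 + dm)) * dm + 18 * a + 50)
    (s(16 := fs, 17 := replicate (Suc a) 2, 19 := enc_bin (Suc a),
       22 := rev (enc_heap [((gamma (close_ptrs a 1 e), a), a)]) @ s 22))"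
proof -
  let ?p = "rev (enc_prog (gamma (close_ptrs a 1 e)))" and ?a = "rev (enc_bin a)"
  let ?S = "\<lambda>x. s(16 := fs, 22 := x)"
  have 1: "does (conv_prog 16 22) s (30 * (1 + a * (1 + dm)) * dm + 13) (?S (?p @ s 22))"
    by (rule does_eq[OF does_conv[of 16 22 s e fs a dm]]) (use assms in auto)
  have 2: "does (Push 22 5) (?S x) 1 (?S (5 # x))" for x
    by (rule does_eq[OF does_Push]) (auto simp: fun_eq_iff)
  have 3: "does (bin_prog 22) (?S x) (6 * a + 3) (?S (?a @ x))" for x
    by (rule does_eq[OF does_bin]) (use assms in \<open>auto simp: fun_eq_iff\<close>)
  have 4: "does (Push 22 8) (?S x) 1 (?S (8 # x))" for x
    by (rule does_eq[OF does_Push]) (auto simp: fun_eq_iff)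
  let ?s5 = "\<lambda>x. s(16 := fs, 22 := x, 17 := replicate (Suc a) 2)"
  have 5: "does (Push 17 2) (?S x) 1 (?s5 x)" for x
    by (rule does_eq[OF does_Push]) (use assms in \<open>auto simp: fun_eq_iff\<close>)
  have 6: "does incr_prog (?s5 x) (6 * a + 10) ((?s5 x)(19 := enc_bin (Suc a)))" for x
    by (rule does_inc) (use assms in auto)
  show ?thesis unfolding entry_body_def
    by (rule does_eq[OF does_Seq[OF 1 does_Seq[OF 2 does_Seq[OF 3 does_Seq[OF 2 does_Seq[OF 3
      does_Seq[OF 4 does_Seq[OF 5 6]]]]]]]]) (auto simp: fun_eq_iff enc_clos_def)
qed

lemma iter_entries:
  "s 16 = enc_entries es \<Longrightarrow> s 17 = replicate a 2 \<Longrightarrow> s 19 = enc_bin a \<Longrightarrow> s 20 = [] \<Longrightarrow> s 8 = [] \<Longrightarrow>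
    s 13 = [] \<Longrightarrow> s 18 = [] \<Longrightarrow> (\<forall>k < length es. scoped (a + k) 1 (es ! k) \<and> length (enc (PLam (es ! k))) \<le> dm) \<Longrightarrow>
    a + length es \<le> J \<Longrightarrow>
    iter (Loop 16 UNIV entry_body) s (length es * (30 * (1 + J * (1 + dm)) * dm + 18 * J + 51))
    (s(16 := [], 17 := replicate (a + length es) 2, 19 := enc_bin (a + length es),
       22 := rev (enc_heap (heap_of a es)) @ s 22))"
proof (induction es arbitrary: s a)
  case Nil
  then show ?case by (auto intro!: iter_eq[OF iter_refl])
next
  case (Cons e es)
  let ?s1 = "s(16 := enc_entries es, 17 := replicate (Suc a) 2, 19 := enc_bin (Suc a),
       22 := rev (enc_heap [((gamma (close_ptrs a 1 e), a), a)]) @ s 22)"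
  let ?c = "30 * (1 + J * (1 + dm)) * dm + 18 * J + 51"
  have sc: "scoped a 1 e" "length (enc (PLam e)) \<le> dm" using Cons.prems(8) by (auto dest: spec[of _ 0])
  have "30 * (1 + a * (1 + dm)) * dm \<le> 30 * (1 + J * (1 + dm)) * dm"
    using Cons.prems(9) by (intro mult_le_mono mult_le_mono2 add_mono) auto
  then have c: "Suc (30 * (1 + a * (1 + dm)) * dm + 18 * a + 50) \<le> ?c"
    using Cons.prems(9) by linarith
  have d: "does entry_body s (30 * (1 + a * (1 + dm)) * dm + 18 * a + 50) ?s1"
    by (rule does_entry) (use Cons.prems sc in auto)
  have 1: "iter (Loop 16 UNIV entry_body) s ?c ?s1"
    by (rule iter_eq[OF iter_step[OF _ d] refl c]) (use Cons.prems in simp)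
  have sc': "\<forall>k < length es. scoped (Suc a + k) 1 (es ! k) \<and> length (enc (PLam (es ! k))) \<le> dm"
    using Cons.prems(8) by (auto dest: spec[of _ "Suc _"])
  have 2: "iter (Loop 16 UNIV entry_body) ?s1 (length es * ?c)
    (?s1(16 := [], 17 := replicate (Suc a + length es) 2, 19 := enc_bin (Suc a + length es),
       22 := rev (enc_heap (heap_of (Suc a) es)) @ ?s1 22))"
    by (rule Cons.IH) (use Cons.prems sc' in auto)
  show ?case by (rule iter_eq[OF iter_trans[OF 1 2]]) (auto simp: fun_eq_iff)
qed

text \<open>For \<open>J = 0\<close> this is linear in \<open>dm\<close>, although in general it is
  not. That matters: after evaluation by substitution no values are stored, and the space for the
  output is bounded by this time.\<close>

definition out_cost :: "nat \<Rightarrow> nat \<Rightarrow> nat" where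
  "out_cost J dm = Suc J * (30 * (1 + J * (1 + dm)) * dm + 18 * J + 10 * dm + 60)"

lemma does_out:
  assumes s: "s 7 = rev (enc_entries es)" "s 5 = rev (enc (PLam u))" "s 8 = []" "s 13 = []" "s 15 = []" "s 16 = []"
    "s 17 = []" "s 18 = []" "s 19 = []" "s 20 = []" "s 21 = []" "s 22 = []"
    and sc: "\<forall>k < length es. scoped k 1 (es ! k) \<and> length (enc (PLam (es ! k))) \<le> dm"
    and u: "scoped (length es) 1 u" "length (enc (PLam u)) \<le> dm" and J: "length es = J"
  shows "\<exists>s'. does out_prog s (out_cost J dm) s' \<and> s' 21 = rev (enc_clos (gamma (close_ptrs J 1 u), J)) \<and>
    s' 22 = rev (enc_heap (heap_of 0 es)) \<and> s' 9 = s 9 \<and> s' 1 = s 1 \<and> s' 2 = s 2"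
proof -
  let ?c = "30 * (1 + J * (1 + dm)) * dm + 18 * J + 51"
  let ?s1 = "s(7 := [], 16 := enc_entries es)"
  have 1: "does (move_all 7 16) s (2 * length (enc_entries es) + 1) ?s1"
    by (rule does_eq[OF does_move_all]) (use s in auto)
  have le: "length (enc_entries es) \<le> J * dm"
  proof -
    have "length (enc_entries es) \<le> length es * dm" if "\<forall>k < length es. length (enc (PLam (es ! k))) \<le> dm" for es
      using that by (induction es) (auto simp: All_less_Suc2)
    then show ?thesis using sc J by auto
  qed
  let ?s2 = "s(7 := [], 16 := [], 17 := replicate J 2, 19 := enc_bin J, 22 := rev (enc_heap (heap_of 0 es)))"
  have 2: "does (Loop 16 UNIV entry_body) ?s1 (Suc (J * ?c)) ?s2"
  proof (rule does_Loop)
    show "iter (Loop 16 UNIV entry_body) ?s1 (J * ?c) ?s2"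
      by (rule iter_eq[OF iter_entries[of ?s1 es 0 dm J]]) (use s sc J in \<open>auto simp: fun_eq_iff\<close>)
  qed simp
  let ?s3 = "?s2(5 := [], 15 := enc (PLam u))"
  have 3: "does (move_block 0 3 5 15) ?s2 (6 * length (enc u) + 11) ?s3"
    by (rule does_eq[OF does_move_block[OF balanced_rev[OF balanced_enc[of u]], of _ _ _ "[]"]])
      (use s in \<open>auto simp: fun_eq_iff\<close>)
  let ?s4 = "?s3(15 := [], 21 := rev (enc_prog (gamma (close_ptrs J 1 u))))"
  have 4: "does (conv_prog 15 21) ?s3 (30 * (1 + J * (1 + dm)) * dm + 13) ?s4"
    by (rule does_eq[OF does_conv[of 15 21 ?s3 u "[]" J dm]]) (use s u J in \<open>auto simp: fun_eq_iff\<close>)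
  let ?s5 = "?s4(21 := 5 # rev (enc_prog (gamma (close_ptrs J 1 u))))"
  have 5: "does (Push 21 5) ?s4 1 ?s5"
    by (rule does_eq[OF does_Push]) (auto simp: fun_eq_iff)
  let ?s6 = "?s5(21 := rev (enc_clos (gamma (close_ptrs J 1 u), J)))"
  have 6: "does (bin_prog 21) ?s5 (6 * J + 3) ?s6"
    by (rule does_eq[OF does_bin[of _ J]]) (use s in \<open>auto simp: fun_eq_iff enc_clos_def\<close>)
  have "does out_prog s (out_cost J dm) ?s6" unfolding out_prog_def
    by (rule does_eq[OF does_Seq[OF 1 does_Seq[OF 2 does_Seq[OF 3 does_Seq[OF 4 does_Seq[OF 5 6]]]]]])
      (use le u(2) in \<open>auto simp: out_cost_def algebra_simps\<close>)
  then show ?thesis by (intro exI[of _ ?s6]) auto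
qed

text \<open>Output tapes cannot be erased, so the result is prepared on stacks 21 and 22 and
  transferred only when complete. Each transfer passes through stack 9 to keep the order, and since
  it only moves cells it cannot overflow.\<close>

definition deliver_prog :: prog where
  "deliver_prog = move_all 21 9 ;; move_all 9 1 ;; move_all 22 9 ;; move_all 9 2"

lemma does_fin:
  assumes "s 9 = []" "s 1 = []" "s 2 = []"
  shows "does deliver_prog s (4 * length (s 21) + 4 * length (s 22) + 10) (s(21 := [], 22 := [], 1 := s 21, 2 := s 22))"
  unfolding deliver_prog_def
  by (rule does_eq, rule does_Seq, rule does_move_all, simp, rule does_Seq, rule does_move_all, simp, rule does_Seq,
      rule does_move_all, simp, rule does_move_all, simp)
     (use assms in \<open>auto simp: fun_eq_iff\<close>)

section \<open>Reductions and the two evaluation modes\<close>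

text \<open>The last two arguments are the length of the reduction and the exact maximum of the term
  sizes along it: while \<open>s\<close> is reduced, \<open>t\<close> stands next to it, and while
  \<open>t\<close> is reduced, \<open>Lam a\<close> does.\<close>

inductive big_step :: "lterm \<Rightarrow> lterm \<Rightarrow> nat \<Rightarrow> nat \<Rightarrow> bool" where
  big_step_lam: "big_step (Lam u) (Lam u) 0 (tsize (Lam u))"
| big_step_app: "big_step s (Lam a) j1 m1 \<Longrightarrow> big_step t (Lam b) j2 m2 \<Longrightarrow> big_step (subst a 0 (Lam b)) v j3 m3 \<Longrightarrow>
    m = max (Suc (m1 + tsize t)) (max (Suc (tsize (Lam a) + m2)) m3) \<Longrightarrow>
    big_step (App s t) v (Suc (j1 + j2 + j3)) m"

lemma big_step_size: "big_step s v j m \<Longrightarrow> tsize s \<le> m \<and> tsize v \<le> m \<and> 1 \<le> m \<and> (\<exists>u. v = Lam u)"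
  by (induction rule: big_step.induct) auto

inductive_cases big_step_LamE: "big_step (Lam u) v j m"
inductive_cases big_step_AppE: "big_step (App s t) v j m"

text \<open>Closure under head expansion: prefixing one step adds only the size of the new first
  term to the maximum. Reductions are turned into derivations from their end.\<close>

lemma step_big_step: "step s s' \<Longrightarrow> big_step s' v j m \<Longrightarrow> big_step s v (Suc j) (max (tsize s) m)"
proof (induction arbitrary: v j m rule: step.induct)
  case (beta s t)
  have "max (Suc (tsize (Lam s) + tsize (Lam t))) (max (Suc (tsize (Lam s) + tsize (Lam t))) m) =
    max (tsize (App (Lam s) (Lam t))) m" by simp
  then show ?case using big_step_app[OF big_step_lam big_step_lam beta refl] by simp
next
  case (appL s s' t)
  from appL.prems obtain a j1 m1 b j2 m2 j3 m3 where
    *: "big_step s' (Lam a) j1 m1" "big_step t (Lam b) j2 m2" "big_step (subst a 0 (Lam b)) v j3 m3"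
    "j = Suc (j1 + j2 + j3)" "m = max (Suc (m1 + tsize t)) (max (Suc (Suc (tsize a + m2))) m3)"
    by (rule big_step_AppE)
  show ?case
    using big_step_app[OF appL.IH[OF *(1)] *(2,3) refl] big_step_size[OF *(1)]
    by (simp add: *(4,5) max_def split: if_splits)
next
  case (appR t t' s)
  from appR.prems obtain a j1 m1 b j2 m2 j3 m3 where
    *: "big_step (Lam s) (Lam a) j1 m1" "big_step t' (Lam b) j2 m2" "big_step (subst a 0 (Lam b)) v j3 m3"
    "j = Suc (j1 + j2 + j3)" "m = max (Suc (m1 + tsize t')) (max (Suc (Suc (tsize a + m2))) m3)"
    by (rule big_step_AppE)
  have l: "a = s" "j1 = 0" "m1 = tsize (Lam s)" using *(1) by (auto elim: big_step_LamE)
  have "max (Suc (m1 + tsize t)) (max (Suc (tsize (Lam a) + max (tsize t) m2)) m3) =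
    max (tsize (App (Lam s) t)) m"
    using big_step_size[OF *(2)] big_step_size[OF *(3)] unfolding *(5) l by auto
  then show ?case
    using big_step_app[OF *(1) appR.IH[OF *(2)] *(3) refl] by (simp add: *(4))
qed

lemma evaluates_big_step: "evaluates s t j m \<Longrightarrow> big_step s t j m"
proof (induction j arbitrary: s m)
  case 0
  then obtain ss where "length ss = Suc 0" "ss ! 0 = s" "ss ! 0 = t" "is_abs t" "m = Max (tsize ` set ss)"
    unfolding evaluates_def by auto
  moreover obtain u where "t = Lam u" using \<open>is_abs t\<close> by (cases t) auto
  ultimately show ?case using big_step_lam[of u] by (auto simp: length_Suc_conv)
next
  case (Suc j)
  then obtain ss where ss: "length ss = Suc (Suc j)" "ss ! 0 = s" "ss ! Suc j = t"
    "\<forall>i<Suc j. step (ss ! i) (ss ! Suc i)" "is_abs t" "m = Max (tsize ` set ss)"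
    unfolding evaluates_def by auto
  then obtain ss' where ss': "ss = s # ss'" by (cases ss) auto
  have nn: "ss' \<noteq> []" using ss ss' by auto
  have "step s (ss' ! 0)" using ss(4)[rule_format, of 0] ss' by simp
  moreover have "evaluates (ss' ! 0) t j (Max (tsize ` set ss'))"
    unfolding evaluates_def using ss ss' by (intro exI[of _ ss']) auto
  ultimately have "big_step s t (Suc j) (max (tsize s) (Max (tsize ` set ss')))"
    using Suc.IH step_big_step by blast
  then show ?case using ss(6) ss' nn by simp
qed

section \<open>Closedness, scopes and sizes under substitution\<close>

lemma bound_mono: "bound d s \<Longrightarrow> d \<le> d' \<Longrightarrow> bound d' s"
proof (induction s arbitrary: d d')
  case (Lam s)
  then show ?case using Lam.IH[of "Suc d" "Suc d'"] by simp
qed auto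

lemma bound_subst: "bound (Suc d) a \<Longrightarrow> bound 0 u \<Longrightarrow> bound d (subst a d u)"
  by (induction a arbitrary: d) (auto intro: bound_mono)

lemma subst_bound: "bound d s \<Longrightarrow> d \<le> k \<Longrightarrow> subst s k u = s"
proof (induction s arbitrary: d k)
  case (Lam s)
  then show ?case using Lam.IH[of "Suc d" "Suc k"] by simp
qed auto

lemma scoped_emb: "scoped l d (emb s) = bound d s"
  by (induction s arbitrary: d) auto

lemma scoped_mono: "scoped l d p \<Longrightarrow> l \<le> l' \<Longrightarrow> d \<le> d' \<Longrightarrow> scoped l' d' p"
proof (induction p arbitrary: d d')
  case (PLam p)
  then show ?case using PLam.IH[of "Suc d" "Suc d'"] by simp
qed auto

lemma scoped_psubst: "scoped l (Suc d) p \<Longrightarrow> scoped l 0 u \<Longrightarrow> scoped l d (psubst p d u)"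
  by (induction p arbitrary: d) (auto intro: scoped_mono)

text \<open>Crude, but in terms of the operands only: the cost of a substitution can thus be bounded
  by the budget before it is known whether the result fits.\<close>

lemma length_enc_psubst: "length (enc (psubst p k r)) \<le> length (enc p) * length (enc r)"
proof (induction p arbitrary: k)
  case (PVar n)
  have "Suc n * 1 \<le> Suc n * length (enc r)" by (intro mult_le_mono2) (simp add: Suc_le_eq)
  then show ?case by auto
next
  case (PPtr n)
  have "Suc n * 1 \<le> Suc n * length (enc r)" by (intro mult_le_mono2) (simp add: Suc_le_eq)
  then show ?case by auto
next
  case (PApp p q)
  then have "length (enc (psubst (PApp p q) k r)) \<le> length (enc p) * length (enc r) + length (enc q) * length (enc r) + 1"
    by (simp add: add_mono)
  also have "\<dots> \<le> length (enc (PApp p q)) * length (enc r)"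
    by (simp add: algebra_simps Suc_le_eq)
  finally show ?case .
next
  case (PLam p)
  have "length (enc (psubst (PLam p) k r)) \<le> length (enc p) * length (enc r) + 2 * 1"
    using PLam[of "Suc k"] by simp
  also have "\<dots> \<le> length (enc p) * length (enc r) + 2 * length (enc r)"
    by (intro add_mono mult_le_mono) (auto simp: Suc_le_eq)
  also have "\<dots> = length (enc (PLam p)) * length (enc r)" by (simp add: algebra_simps)
  finally show ?case .
qed

lemma length_enc_emb: "length (enc (emb s)) \<le> 2 * tsize s"
  by (induction s) auto

section \<open>Space from time, and runs cut off at a budget\<close>

lemma store_size_istep: "store_size (snd (istep c)) \<le> Suc (store_size (snd c))"
proof -
  have u: "store_size (s(i := xs)) \<le> store_size s + k" if "length xs \<le> length (s i) + k" for s i xs k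
    using that store_size_upd[of i s xs] by (cases "i < nstacks") (auto simp: store_size_def)
  have m: "store_size (s(i := tl (s i), j := x # s j)) \<le> Suc (store_size s)" for s i j x
  proof (cases "i = j")
    case True
    then show ?thesis using u[of "x # s j" s j 1] by simp
  next
    case False
    then show ?thesis using u[of "tl (s i)" s i 0] u[of "x # s j" "s(i := tl (s i))" j 1] by simp
  qed
  show ?thesis
    by (cases c rule: istep.cases) (auto intro: order.trans[OF u[of _ _ _ 1]] m)
qed

lemma store_size_istep_pow: "store_size (snd ((istep ^^ n) c)) \<le> store_size (snd c) + n"
proof (induction n)
  case (Suc n)
  then show ?case using store_size_istep[of "(istep ^^ n) c"] by simp
qed simp

text \<open>Records only the peak. The number of steps is left open because evaluating without a
  budget by substitution may take exponentially long.\<close>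

definition reaches_within :: "nat \<Rightarrow> prog list \<times> store \<Rightarrow> prog list \<times> store \<Rightarrow> bool" where
  "reaches_within z c c' \<longleftrightarrow> (\<exists>n. (istep ^^ n) c = c' \<and> (\<forall>i \<le> n. store_size (snd ((istep ^^ i) c)) \<le> z))"

text \<open>Unlike \<^const>\<open>reaches\<close>, this notion gives time bounds that are polynomial in \<open>B\<close> even if terms grow exponentially.\<close>
definition reaches_or_exceeds :: "nat \<Rightarrow> prog list \<times> store \<Rightarrow> nat \<Rightarrow> prog list \<times> store \<Rightarrow> bool" where
  "reaches_or_exceeds B c t c' \<longleftrightarrow> (\<exists>n \<le> t. (istep ^^ n) c = c' \<or> B < store_size (snd ((istep ^^ n) c)))"

text \<open>A step adds at most one cell, so a time bound is also a bound on the additional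
  space.\<close>

lemma reaches_imp_within:
  "reaches c t c' \<Longrightarrow> store_size (snd c) + t \<le> z \<Longrightarrow> reaches_within z c c'" (is "_ \<Longrightarrow> _ \<Longrightarrow> ?thesis")
proof -
  assume "reaches c t c'" and z: "store_size (snd c) + t \<le> z"
  then obtain n where n: "n \<le> t" "(istep ^^ n) c = c'" unfolding reaches_def by blast
  have "store_size (snd ((istep ^^ i) c)) \<le> z" if "i \<le> n" for i
    using store_size_istep_pow[of i c] that n z by linarith
  then show ?thesis unfolding reaches_within_def using n by blast
qed

lemma reaches_imp_or_exceeds: "reaches c t c' \<Longrightarrow> reaches_or_exceeds B c t c'"
  unfolding reaches_def reaches_or_exceeds_def by blast

lemma reaches_or_exceeds_now: "B < store_size (snd c) \<Longrightarrow> reaches_or_exceeds B c t c'"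
  unfolding reaches_or_exceeds_def by (intro exI[of _ 0]) auto

lemma reaches_or_exceeds_mono: "reaches_or_exceeds B c t c' \<Longrightarrow> t \<le> t' \<Longrightarrow> reaches_or_exceeds B c t' c'"
  unfolding reaches_or_exceeds_def using le_trans by blast

lemma reaches_or_exceeds_trans: "reaches_or_exceeds B c t c' \<Longrightarrow> reaches_or_exceeds B c' t' c'' \<Longrightarrow> reaches_or_exceeds B c (t + t') c''"
proof -
  assume a: "reaches_or_exceeds B c t c'" "reaches_or_exceeds B c' t' c''"
  obtain n where n: "n \<le> t" "(istep ^^ n) c = c' \<or> B < store_size (snd ((istep ^^ n) c))"
    using a(1) unfolding reaches_or_exceeds_def by blast
  obtain n' where n': "n' \<le> t'" "(istep ^^ n') c' = c'' \<or> B < store_size (snd ((istep ^^ n') c'))"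
    using a(2) unfolding reaches_or_exceeds_def by blast
  show ?thesis
  proof (cases "(istep ^^ n) c = c'")
    case True
    then have "(istep ^^ (n' + n)) c = (istep ^^ n') c'" by (simp add: funpow_add)
    then show ?thesis unfolding reaches_or_exceeds_def using n n' by (intro exI[of _ "n' + n"]) auto
  next
    case False
    then show ?thesis unfolding reaches_or_exceeds_def using n by (intro exI[of _ n]) auto
  qed
qed

lemma reaches_within_trans: "reaches_within z c c' \<Longrightarrow> reaches_within z c' c'' \<Longrightarrow> reaches_within z c c''"
proof -
  assume a: "reaches_within z c c'" "reaches_within z c' c''"
  obtain n where n: "(istep ^^ n) c = c'" "\<forall>i \<le> n. store_size (snd ((istep ^^ i) c)) \<le> z"
    using a(1) unfolding reaches_within_def by blast
  obtain n' where n': "(istep ^^ n') c' = c''" "\<forall>i \<le> n'. store_size (snd ((istep ^^ i) c')) \<le> z"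
    using a(2) unfolding reaches_within_def by blast
  have add: "(istep ^^ (i + n)) c = (istep ^^ i) c'" for i using n(1) by (simp add: funpow_add)
  have "store_size (snd ((istep ^^ i) c)) \<le> z" if "i \<le> n' + n" for i
  proof (cases "i \<le> n")
    case False
    then have "(istep ^^ i) c = (istep ^^ (i - n)) c'" using add[of "i - n"] by simp
    then show ?thesis using n'(2) that by simp
  qed (use n in blast)
  then show ?thesis unfolding reaches_within_def using n' add by (intro exI[of _ "n' + n"]) auto
qed

lemma reaches_within_mono: "reaches_within z c c' \<Longrightarrow> z \<le> z' \<Longrightarrow> reaches_within z' c c'"
  unfolding reaches_within_def using le_trans by blast

definition St :: "nat list \<Rightarrow> nat list \<Rightarrow> nat list \<Rightarrow> nat list \<Rightarrow> nat list \<Rightarrow> nat list \<Rightarrow> store" where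
  "St w md vs ps es ns = (\<lambda>_. [])(0 := rev w, 4 := md, 5 := vs, 6 := ps, 7 := es, 14 := ns)"

lemma store_size_fresh: "i < nstacks \<Longrightarrow> s i = [] \<Longrightarrow> store_size (s(i := xs)) = store_size s + length xs"
  using store_size_upd[of i s xs] by simp

lemma store_size_St [simp]:
  "store_size (St w md vs ps es ns) = length w + length md + length vs + length ps + length es + length ns"
proof -
  have "store_size (\<lambda>_. []) = 0" by (simp add: store_size_def)
  then show ?thesis unfolding St_def by (simp add: store_size_fresh nstacks_def)
qed

definition ev_loop :: prog where
  "ev_loop = Loop 6 UNIV (Cond 6 {3} (move_block 3 0 6 5) (Cond 6 {9} fetch apply_prog))"

lemma iter_loop_lam:
  "iter ev_loop (St w md vs (enc (PLam u) @ ps) es ns) (6 * length (enc (PLam u)) + 20)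
     (St w md (rev (enc (PLam u)) @ vs) ps es ns)"
proof -
  let ?s = "St w md vs (enc (PLam u) @ ps) es ns"
  have t: "top_in UNIV (?s 6)" "top_in {3} (?s 6)" by (auto simp: St_def)
  show ?thesis unfolding ev_loop_def
    by (rule iter_eq, rule iter_step, rule t, rule does_Cond, simp only: t if_True,
        rule does_move_block[OF balanced_enc[of u], of _ _ _ ps]) (auto simp: St_def fun_eq_iff)
qed

lemma iter_loop_ptr:
  "hd_ok ps \<Longrightarrow> n < length es \<Longrightarrow>
   iter ev_loop (St w md vs (enc (PPtr n) @ ps) (rev (enc_entries es)) ns) (60 * length (enc_entries es) + 50)
     (St w md (rev (enc (PLam (es ! n))) @ vs) ps (rev (enc_entries es)) ns)"
proof -
  assume a: "hd_ok ps" "n < length es"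
  let ?s = "St w md vs (enc (PPtr n) @ ps) (rev (enc_entries es)) ns"
  have t: "top_in UNIV (?s 6)" "\<not> top_in {3} (?s 6)" "top_in {9} (?s 6)" by (auto simp: St_def)
  show ?thesis unfolding ev_loop_def
    by (rule iter_eq, rule iter_step, rule t, rule does_Cond, simp only: t if_False if_True, rule does_Cond,
        simp only: t if_False if_True,
        rule does_fetch[of _ n ps es]) (use a in \<open>auto simp: St_def fun_eq_iff\<close>)
qed

lemma iter_loop_app:
  assumes "md = [] \<and> r = PLam b \<and> e' = es \<and> n' = ns \<or>
      md = [2] \<and> ns = replicate n 2 \<and> r = PPtr n \<and> e' = rev (enc (PLam b)) @ es \<and> n' = 2 # ns"
    and "scoped l 1 a"
  shows "iter ev_loop (St w md (rev (enc (PLam b)) @ rev (enc (PLam a)) @ vs) (4 # ps) es ns)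
     (40 * (length (enc (PLam a)) + length (enc (psubst a 0 r))) + 10 * length (enc (PLam b)) + 10 * length n' + 110)
     (St w md vs (enc (psubst a 0 r) @ ps) e' n')"
proof -
  let ?s = "St w md (rev (enc (PLam b)) @ rev (enc (PLam a)) @ vs) (4 # ps) es ns"
  have t: "top_in UNIV (?s 6)" "\<not> top_in {3} (?s 6)" "\<not> top_in {9} (?s 6)" by (auto simp: St_def)
  show ?thesis unfolding ev_loop_def
    by (rule iter_eq, rule iter_step, rule t, rule does_Cond, simp only: t if_False if_True, rule does_Cond,
        simp only: t if_False if_True,
        rule does_apply[of _ ps b a vs r e' n' n l]) (use assms in \<open>auto simp: St_def fun_eq_iff\<close>)
qed

section \<open>Evaluation by substitution\<close>

definition sub_cost :: "nat \<Rightarrow> nat" where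
  "sub_cost B = 40 * (B + B * B) + 20 * B + 120"

lemma iter_within: "iter W s t s' \<Longrightarrow> store_size s + t \<le> z \<Longrightarrow> reaches_within z (W # k, s) (W # k, s')"
  unfolding iter_def using reaches_imp_within by fastforce

lemma iter_or_exceeds:
  assumes "iter W s t s'" "store_size s \<le> B \<Longrightarrow> t \<le> t'"
  shows "reaches_or_exceeds B (W # k, s) t' (W # k, s')"
proof (cases "store_size s \<le> B")
  case True
  then show ?thesis using assms reaches_or_exceeds_mono reaches_imp_or_exceeds unfolding iter_def by blast
next
  case False
  then show ?thesis by (intro reaches_or_exceeds_now) simp
qed

text \<open>Space: the code and the values that wait on the stacks while a subterm is evaluated fit
  into the excess of \<open>m\<close> over the maximum for that subterm; the factor 300 absorbs the
  time of one round, which bounds its space.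

  Time: a derivation with \<open>j\<close> ternary application nodes has \<open>2 * j + 1\<close>
  leaves, hence \<open>3 * j + 1\<close> nodes, each costing one round. A round that starts within
  \<open>B\<close> costs at most \<open>sub_cost B\<close>, and one that does not is already an
  overflow.\<close>

lemma sub_eval:
  assumes "big_step s v j m" "bound 0 s"
  shows "bound 0 v \<and>
    (\<forall>vs ps k. reaches_within (length w + length vs + length ps + 300 * m)
      (ev_loop # k, St w [] vs (enc (emb s) @ ps) [] []) (ev_loop # k, St w [] (rev (enc (emb v)) @ vs) ps [] [])) \<and>
    (\<forall>B vs ps k. reaches_or_exceeds B (ev_loop # k, St w [] vs (enc (emb s) @ ps) [] []) ((3 * j + 1) * sub_cost B)
      (ev_loop # k, St w [] (rev (enc (emb v)) @ vs) ps [] []))"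
  using assms
proof (induction rule: big_step.induct)
  case (big_step_lam u)
  note it = iter_loop_lam[of w "[]" _ "emb u" _ "[]" "[]"]
  have "reaches_within (length w + length vs + length ps + 300 * tsize (Lam u))
      (ev_loop # k, St w [] vs (enc (emb (Lam u)) @ ps) [] [])
      (ev_loop # k, St w [] (rev (enc (emb (Lam u))) @ vs) ps [] [])" for vs ps k
    using iter_within[OF it[of vs ps], of "length w + length vs + length ps + 300 * tsize (Lam u)" k]
      length_enc_emb[of u] by simp
  moreover have "reaches_or_exceeds B (ev_loop # k, St w [] vs (enc (emb (Lam u)) @ ps) [] []) ((3 * 0 + 1) * sub_cost B)
      (ev_loop # k, St w [] (rev (enc (emb (Lam u))) @ vs) ps [] [])" for vs ps k B
    using iter_or_exceeds[OF it[of vs ps], of B "sub_cost B" k] by (simp add: sub_cost_def)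
  ultimately show ?case using big_step_lam by blast
next
  case (big_step_app s a j1 m1 t b j2 m2 v j3 m3 m)
  let ?a = "emb a" and ?b = "emb b"
  have bs: "bound 0 s" "bound 0 t" using big_step_app.prems by auto
  note IH1 = big_step_app.IH(1)[OF bs(1)] and IH2 = big_step_app.IH(2)[OF bs(2)]
  have ba: "bound 1 a" "bound 0 (Lam b)" using IH1 IH2 by auto
  have "bound 0 (subst a 0 (Lam b))" using bound_subst[of 0 a "Lam b"] ba by simp
  note IH3 = big_step_app.IH(3)[OF this]
  have mm: "Suc (m1 + tsize t) \<le> m" "Suc (tsize (Lam a) + m2) \<le> m" "m3 \<le> m" using big_step_app.hyps by auto
  have sizes: "tsize (Lam b) \<le> m2" "tsize (subst a 0 (Lam b)) \<le> m3"
    using big_step_size[OF big_step_app.hyps(2)] big_step_size[OF big_step_app.hyps(3)] by auto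
  have sub: "psubst ?a 0 (PLam ?b) = emb (subst a 0 (Lam b))" using emb_subst[of a 0 "Lam b"] by simp
  note it = iter_loop_app[where md = "[]" and r = "PLam ?b" and b = ?b and e' = "[]" and es = "[]" and n' = "[]"
      and ns = "[]" and l = 0 and a = ?a and w = w, unfolded sub]
  have sca: "scoped 0 1 ?a" using ba by (simp only: scoped_emb)
  have lens: "length (enc (PLam ?a)) \<le> 2 * tsize (Lam a)" "length (enc (PLam ?b)) \<le> 2 * tsize (Lam b)"
    "length (enc (emb (subst a 0 (Lam b)))) \<le> 2 * tsize (subst a 0 (Lam b))"
    using length_enc_emb[of "Lam a"] length_enc_emb[of "Lam b"] length_enc_emb by auto
  have lt: "length (enc (emb t)) \<le> 2 * tsize t" by (rule length_enc_emb)
  have pk: "reaches_within (length w + length vs + length ps + 300 * m)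
      (ev_loop # k, St w [] vs (enc (emb (App s t)) @ ps) [] []) (ev_loop # k, St w [] (rev (enc (emb v)) @ vs) ps [] [])"
    for vs ps k
  proof -
    let ?z = "length w + length vs + length ps + 300 * m"
    have 1: "reaches_within ?z (ev_loop # k, St w [] vs (enc (emb s) @ enc (emb t) @ [4] @ ps) [] [])
       (ev_loop # k, St w [] (rev (enc (emb (Lam a))) @ vs) (enc (emb t) @ [4] @ ps) [] [])"
      using IH1 mm lt by (intro reaches_within_mono[OF IH1[THEN conjunct2, THEN conjunct1, rule_format]]) auto
    have 2: "reaches_within ?z (ev_loop # k, St w [] (rev (enc (emb (Lam a))) @ vs) (enc (emb t) @ [4] @ ps) [] [])
       (ev_loop # k, St w [] (rev (enc (emb (Lam b))) @ rev (enc (emb (Lam a))) @ vs) ([4] @ ps) [] [])"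
      using mm lens by (intro reaches_within_mono[OF IH2[THEN conjunct2, THEN conjunct1, rule_format]]) auto
    have 3: "reaches_within ?z (ev_loop # k, St w [] (rev (enc (PLam ?b)) @ rev (enc (PLam ?a)) @ vs) (4 # ps) [] [])
       (ev_loop # k, St w [] vs (enc (emb (subst a 0 (Lam b))) @ ps) [] [])"
      using mm lens sizes by (intro iter_within[OF it] sca) auto
    have 4: "reaches_within ?z (ev_loop # k, St w [] vs (enc (emb (subst a 0 (Lam b))) @ ps) [] [])
       (ev_loop # k, St w [] (rev (enc (emb v)) @ vs) ps [] [])"
      using mm by (intro reaches_within_mono[OF IH3[THEN conjunct2, THEN conjunct1, rule_format]]) auto
    show ?thesis using reaches_within_trans[OF 1 reaches_within_trans[OF 2 reaches_within_trans[OF _ 4]]] 3 by simp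
  qed
  have ob: "reaches_or_exceeds B (ev_loop # k, St w [] vs (enc (emb (App s t)) @ ps) [] []) ((3 * Suc (j1 + j2 + j3) + 1) * sub_cost B)
      (ev_loop # k, St w [] (rev (enc (emb v)) @ vs) ps [] [])" for B vs ps k
  proof -
    have 1: "reaches_or_exceeds B (ev_loop # k, St w [] vs (enc (emb s) @ enc (emb t) @ [4] @ ps) [] []) ((3 * j1 + 1) * sub_cost B)
       (ev_loop # k, St w [] (rev (enc (emb (Lam a))) @ vs) (enc (emb t) @ [4] @ ps) [] [])"
      using IH1 by blast
    have 2: "reaches_or_exceeds B (ev_loop # k, St w [] (rev (enc (emb (Lam a))) @ vs) (enc (emb t) @ [4] @ ps) [] []) ((3 * j2 + 1) * sub_cost B)
       (ev_loop # k, St w [] (rev (enc (emb (Lam b))) @ rev (enc (emb (Lam a))) @ vs) ([4] @ ps) [] [])"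
      using IH2 by blast
    have 3: "reaches_or_exceeds B (ev_loop # k, St w [] (rev (enc (PLam ?b)) @ rev (enc (PLam ?a)) @ vs) (4 # ps) [] []) (sub_cost B)
       (ev_loop # k, St w [] vs (enc (emb (subst a 0 (Lam b))) @ ps) [] [])"
    proof (rule iter_or_exceeds[OF it])
      assume "store_size (St w [] (rev (enc (PLam ?b)) @ rev (enc (PLam ?a)) @ vs) (4 # ps) [] []) \<le> B"
      then have B: "length (enc (PLam ?a)) \<le> B" "length (enc (PLam ?b)) \<le> B" by auto
      \<comment> \<open>Only the operands are known to fit into \<open>B\<close>; the product bound
        gives the quadratic term of \<open>sub_cost\<close>.\<close>
      have "length (enc (emb (subst a 0 (Lam b)))) \<le> length (enc ?a) * length (enc (PLam ?b))"
        using length_enc_psubst[of ?a 0 "PLam ?b"] by (simp only: sub)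
      also have "\<dots> \<le> B * B" using B by (intro mult_le_mono) auto
      finally show "40 * (length (enc (PLam ?a)) + length (enc (emb (subst a 0 (Lam b))))) +
        10 * length (enc (PLam ?b)) + 10 * length ([]::nat list) + 110 \<le> sub_cost B"
        using B unfolding sub_cost_def by simp
    qed (use sca in auto)
    have h3: "reaches_or_exceeds B (ev_loop # k, St w [] (rev (enc (emb (Lam b))) @ rev (enc (emb (Lam a))) @ vs) ([4] @ ps) [] [])
      (sub_cost B) (ev_loop # k, St w [] vs (enc (emb (subst a 0 (Lam b))) @ ps) [] [])"
      using 3 by simp
    have 4: "reaches_or_exceeds B (ev_loop # k, St w [] vs (enc (emb (subst a 0 (Lam b))) @ ps) [] []) ((3 * j3 + 1) * sub_cost B)
       (ev_loop # k, St w [] (rev (enc (emb v)) @ vs) ps [] [])"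
      using IH3 by blast
    have "reaches_or_exceeds B (ev_loop # k, St w [] vs (enc (emb (App s t)) @ ps) [] [])
      ((3 * j1 + 1) * sub_cost B + ((3 * j2 + 1) * sub_cost B + (sub_cost B + (3 * j3 + 1) * sub_cost B)))
      (ev_loop # k, St w [] (rev (enc (emb v)) @ vs) ps [] [])"
      using reaches_or_exceeds_trans[OF 1 reaches_or_exceeds_trans[OF 2 reaches_or_exceeds_trans[OF h3 4]]] by simp
    then show ?thesis by (rule reaches_or_exceeds_mono) (simp add: algebra_simps)
  qed
  show ?case using pk ob IH3 by blast
qed

section \<open>Evaluation with sharing\<close>

fun expand :: "lterm list \<Rightarrow> pterm \<Rightarrow> lterm" where
  "expand rs (PVar n) = Var n"
| "expand rs (PPtr k) = rs ! k"
| "expand rs (PApp s t) = App (expand rs s) (expand rs t)"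
| "expand rs (PLam s) = Lam (expand rs s)"

text \<open>A pointer has size 1 whatever its index, so that replacing a variable by a pointer never
  increases the size. The length of the index is accounted for separately by the factor
  \<open>Suc l\<close> in \<open>length_enc_le\<close>.\<close>

fun psize :: "pterm \<Rightarrow> nat" where
  "psize (PVar n) = Suc n"
| "psize (PPtr k) = 1"
| "psize (PApp s t) = Suc (psize s + psize t)"
| "psize (PLam s) = Suc (psize s)"

lemma psize_emb: "psize (emb s) = tsize s"
  by (induction s) auto

lemma expand_emb: "expand rs (emb s) = s"
  by (induction s) auto

lemma psize_psubst: "psize (psubst p k (PPtr n)) \<le> psize p"
  by (induction p arbitrary: k) (auto intro: add_mono)

lemma expand_append: "scoped (length rs) d p \<Longrightarrow> expand (rs @ rs') p = expand rs p"
  by (induction p arbitrary: d) (auto simp: nth_append)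

text \<open>Stored values are closed, so a substitution passes unchanged through what the pointers
  stand for.\<close>

lemma expand_psubst:
  "scoped (length rs) d p \<Longrightarrow> \<forall>k < length rs. bound 0 (rs ! k) \<Longrightarrow>
    expand rs (psubst p k u) = subst (expand rs p) k (expand rs u)"
  by (induction p arbitrary: d k) (auto simp: subst_bound[of 0])

lemma length_enc_le: "scoped l d p \<Longrightarrow> length (enc p) \<le> 2 * psize p * Suc l"
proof (induction p arbitrary: d)
  case (PApp p q)
  then show ?case using PApp.IH(1)[of d] PApp.IH(2)[of d] by (simp add: algebra_simps)
next
  case (PLam p)
  then have "length (enc p) \<le> 2 * psize p * Suc l" by auto
  then show ?case by simp
qed auto

text \<open>\<open>rs\<close> lists the terms that the stored values stand for. Entry
  \<open>k\<close> points only below \<open>k\<close>, so its expansion depends on earlier entries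
  alone and survives every extension of the list.\<close>

definition env_ok :: "nat \<Rightarrow> pterm list \<Rightarrow> lterm list \<Rightarrow> bool" where
  "env_ok S es rs \<longleftrightarrow> length es = length rs \<and> (\<forall>k < length es. scoped k 1 (es ! k) \<and> psize (PLam (es ! k)) \<le> S \<and>
     bound 0 (rs ! k) \<and> rs ! k = Lam (expand rs (es ! k)))"

lemma bound_expand: "scoped (length rs) d p \<Longrightarrow> \<forall>k < length rs. bound 0 (rs ! k) \<Longrightarrow> bound d (expand rs p)"
  by (induction p arbitrary: d) (auto intro: bound_mono)

lemma env_ok_bound: "env_ok S es rs \<Longrightarrow> \<forall>k < length rs. bound 0 (rs ! k)"
  unfolding env_ok_def by metis

lemma env_ok_snoc:
  assumes "env_ok S es rs" "scoped (length es) 1 q" "psize (PLam q) \<le> S"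
  shows "env_ok S (es @ [q]) (rs @ [Lam (expand rs q)])"
proof -
  have l: "length es = length rs" using assms(1) by (simp add: env_ok_def)
  have "bound 0 (Lam (expand rs q))"
    using bound_expand[OF _ env_ok_bound[OF assms(1)], of 1 q] assms(2) l by simp
  moreover have "expand (rs @ [Lam (expand rs q)]) (es ! k) = expand rs (es ! k)" if "k < length es" for k
  proof (rule expand_append)
    have "scoped k 1 (es ! k)" using that assms(1) by (simp add: env_ok_def)
    then show "scoped (length rs) 1 (es ! k)" using that l by (auto intro: scoped_mono)
  qed
  moreover have "expand (rs @ [Lam (expand rs q)]) q = expand rs q"
    using assms(2) l by (intro expand_append[of _ 1]) simp
  ultimately show ?thesis using assms l unfolding env_ok_def
    by (auto simp: nth_append less_Suc_eq)
qed

definition blk_len :: "nat \<Rightarrow> nat \<Rightarrow> nat" where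
  "blk_len S J = 2 * S * Suc J"

definition heap_cost :: "nat \<Rightarrow> nat \<Rightarrow> nat" where
  "heap_cost S J = 60 * (J * blk_len S J) + 100 * blk_len S J + 20 * J + 200"

lemma blk_le: "scoped l d p \<Longrightarrow> psize p \<le> S \<Longrightarrow> l \<le> J \<Longrightarrow> length (enc p) \<le> blk_len S J"
  (is "_ \<Longrightarrow> _ \<Longrightarrow> _ \<Longrightarrow> ?thesis")
proof -
  assume a: "scoped l d p" "psize p \<le> S" "l \<le> J"
  have "2 * psize p * Suc l \<le> 2 * S * Suc J" using a by (intro mult_le_mono) simp_all
  then show ?thesis using length_enc_le[OF a(1)] unfolding blk_len_def by linarith
qed

lemma env_ok_blk: "env_ok S es rs \<Longrightarrow> length es \<le> J \<Longrightarrow> k < length es \<Longrightarrow> length (enc (PLam (es ! k))) \<le> blk_len S J"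
  by (intro blk_le[of k 0]) (auto simp: env_ok_def)

lemma length_enc_entries: "\<forall>k < length es. length (enc (PLam (es ! k))) \<le> b \<Longrightarrow> length (enc_entries es) \<le> length es * b"
  by (induction es) (auto simp: All_less_Suc2)

lemma env_ok_encs: "env_ok S es rs \<Longrightarrow> length es \<le> J \<Longrightarrow> length (enc_entries es) \<le> J * blk_len S J"
  using length_enc_entries[of es "blk_len S J"] env_ok_blk[of S es rs J]
  by (meson le_trans mult_le_mono1)

definition Sh :: "nat list \<Rightarrow> pterm list \<Rightarrow> nat list \<Rightarrow> nat list \<Rightarrow> store" where
  "Sh w es vs ps = St w [2] vs ps (rev (enc_entries es)) (replicate (length es) 2)"

text \<open>The size bound \<open>S\<close> is an invariant of the whole evaluation, not just of its
  start, because arguments enter as pointers. Exactly one entry is stored per reduction step, so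
  \<open>J\<close> bounds the number of entries and thereby the length of every pointer. The time
  factor counts derivation nodes, as for substitution.\<close>

lemma heap_eval:
  assumes "big_step s v j m" "env_ok S es rs" "scoped (length es) 0 p" "expand rs p = s" "psize p \<le> S" "hd_ok ps"
    "length es + j \<le> J"
  shows "\<exists>q es' rs'. env_ok S (es @ es') (rs @ rs') \<and> length es' = j \<and> scoped (length es + j) 0 (PLam q) \<and>
    psize (PLam q) \<le> S \<and> expand (rs @ rs') (PLam q) = v \<and>
    iter ev_loop (Sh w es vs (enc p @ ps)) ((3 * j + 1) * heap_cost S J)
      (Sh w (es @ es') (rev (enc (PLam q)) @ vs) ps)"
  using assms
proof (induction arbitrary: es rs p vs ps rule: big_step.induct)
  case (big_step_lam u)
  have le: "length es \<le> J" using big_step_lam by simp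
  show ?case
  proof (cases p)
    case (PLam q)
    have "length (enc (PLam q)) \<le> blk_len S J"
      using big_step_lam.prems PLam by (intro blk_le[of "length es" 0]) auto
    then have "iter ev_loop (Sh w es vs (enc p @ ps)) (heap_cost S J) (Sh w es (rev (enc (PLam q)) @ vs) ps)"
      unfolding Sh_def PLam by (intro iter_eq[OF iter_loop_lam]) (auto simp: heap_cost_def)
    then show ?thesis using big_step_lam.prems PLam
      by (intro exI[of _ q] exI[of _ "[]"]) auto
  next
    case (PPtr k)
    then have k: "k < length es" using big_step_lam.prems by simp
    have q: "scoped k 1 (es ! k)" "psize (PLam (es ! k)) \<le> S" "expand rs (PLam (es ! k)) = Lam u"
      using big_step_lam.prems k PPtr by (auto simp: env_ok_def)
    have "iter ev_loop (Sh w es vs (enc p @ ps)) (heap_cost S J) (Sh w es (rev (enc (PLam (es ! k))) @ vs) ps)"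
      unfolding Sh_def PPtr using env_ok_encs[OF big_step_lam.prems(1) le] big_step_lam.prems(5) k
      by (intro iter_eq[OF iter_loop_ptr]) (auto simp: heap_cost_def)
    then show ?thesis using big_step_lam.prems q k
      by (intro exI[of _ "es ! k"] exI[of _ "[]"]) (auto intro: scoped_mono)
  qed (use big_step_lam.prems in auto)
next
  case (big_step_app s a j1 m1 t b j2 m2 v j3 m3 m)
  let ?Q = "heap_cost S J"
  \<comment> \<open>Stored values are abstractions, so a term that expands to an application is
    itself an application and no pointer.\<close>
  obtain p1 p2 where p: "p = PApp p1 p2" "expand rs p1 = s" "expand rs p2 = t"
  proof (cases p)
    case (PPtr k)
    then show ?thesis using big_step_app.prems by (auto simp: env_ok_def)
  qed (use big_step_app.prems that in auto)
  have lr: "length es = length rs" using big_step_app.prems by (simp add: env_ok_def)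
  obtain q1 es1 rs1 where 1: "env_ok S (es @ es1) (rs @ rs1)" "length es1 = j1" "scoped (length es + j1) 0 (PLam q1)"
    "psize (PLam q1) \<le> S" "expand (rs @ rs1) (PLam q1) = Lam a"
    "iter ev_loop (Sh w es vs (enc p1 @ enc p2 @ 4 # ps)) ((3 * j1 + 1) * ?Q)
      (Sh w (es @ es1) (rev (enc (PLam q1)) @ vs) (enc p2 @ 4 # ps))"
    using big_step_app.IH(1)[of es rs p1 "enc p2 @ 4 # ps" vs] big_step_app.prems p by auto
  have lr1: "length rs1 = j1" using 1 lr by (simp add: env_ok_def)
  have ex2: "expand (rs @ rs1) p2 = t"
    using expand_append[of rs 0 p2 rs1] big_step_app.prems p lr by simp
  have scp2: "scoped (length (es @ es1)) 0 p2" using big_step_app.prems(2) p(1) by (auto intro: scoped_mono)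
  obtain q2 es2 rs2 where 2: "env_ok S ((es @ es1) @ es2) ((rs @ rs1) @ rs2)" "length es2 = j2"
    "scoped (length (es @ es1) + j2) 0 (PLam q2)"
    "psize (PLam q2) \<le> S" "expand ((rs @ rs1) @ rs2) (PLam q2) = Lam b"
    "iter ev_loop (Sh w (es @ es1) (rev (enc (PLam q1)) @ vs) (enc p2 @ 4 # ps)) ((3 * j2 + 1) * ?Q)
      (Sh w ((es @ es1) @ es2) (rev (enc (PLam q2)) @ rev (enc (PLam q1)) @ vs) (4 # ps))"
    using big_step_app.IH(2)[of "es @ es1" "rs @ rs1" p2 "4 # ps" "rev (enc (PLam q1)) @ vs"] big_step_app.prems p 1(1,2) ex2 scp2
    by auto
  define fs where "fs = (es @ es1) @ es2"
  define gs where "gs = (rs @ rs1) @ rs2"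
  have lf: "length fs = length es + j1 + j2" by (simp add: fs_def 1 2)
  have lg: "length fs = length gs" using 2(1) by (simp add: env_ok_def fs_def gs_def)
  have sc2: "scoped (length fs) 1 q2" using 2(2,3) 1(2) by (simp add: fs_def add.assoc)
  have sc1: "scoped (length fs) 1 q1" using 1(3) lf by (auto intro: scoped_mono)
  let ?fs = "fs @ [q2]" and ?gs = "gs @ [Lam b]" and ?n = "length fs"
  have b: "expand gs q2 = b" using 2(5) by (simp add: gs_def)
  have inv3: "env_ok S ?fs ?gs" using env_ok_snoc[OF 2(1)[folded fs_def gs_def] sc2 2(4)] b by simp
  have ex1: "expand gs q1 = a"
  proof -
    have "expand ((rs @ rs1) @ rs2) q1 = expand (rs @ rs1) q1"
      using 1(3) lr lr1 by (intro expand_append[of _ 1]) simp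
    then show ?thesis using 1(5) by (simp add: gs_def)
  qed
  have ex1': "expand ?gs q1 = a" using expand_append[of gs 1 q1 "[Lam b]"] sc1 lg ex1 by simp
  let ?p3 = "psubst q1 0 (PPtr ?n)"
  have exp3: "expand ?gs ?p3 = subst a 0 (Lam b)"
    using expand_psubst[OF _ env_ok_bound[OF inv3], of 1 q1 0 "PPtr ?n"] scoped_mono[OF sc1, of "Suc ?n" 1] lg ex1'
    by simp
  have sc3: "scoped (length ?fs) 0 ?p3"
    using scoped_psubst[of "Suc ?n" 0 q1 "PPtr ?n"] scoped_mono[OF sc1, of "Suc ?n" 1] by simp
  have sz3: "psize ?p3 \<le> S" using psize_psubst[of q1 0 ?n] 1(4) by simp
  have J: "length ?fs + j3 \<le> J" using big_step_app.prems(6) lf by simp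
  obtain q3 es3 rs3 where 3: "env_ok S (?fs @ es3) (?gs @ rs3)" "length es3 = j3" "scoped (length ?fs + j3) 0 (PLam q3)"
    "psize (PLam q3) \<le> S" "expand (?gs @ rs3) (PLam q3) = v"
    "iter ev_loop (Sh w ?fs vs (enc ?p3 @ ps)) ((3 * j3 + 1) * ?Q) (Sh w (?fs @ es3) (rev (enc (PLam q3)) @ vs) ps)"
    using big_step_app.IH(3)[OF inv3 sc3 exp3 sz3 big_step_app.prems(5) J] by blast
  have lens: "length (enc (PLam q1)) \<le> blk_len S J" "length (enc (PLam q2)) \<le> blk_len S J" "length (enc ?p3) \<le> blk_len S J"
    using blk_le[of ?n 0 "PLam q1" S J] blk_le[of ?n 0 "PLam q2" S J] blk_le[OF sc3 sz3, of J] J sc1 sc2 1(4) 2(4)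
    by auto
  have 4: "iter ev_loop (Sh w fs (rev (enc (PLam q2)) @ rev (enc (PLam q1)) @ vs) (4 # ps)) ?Q (Sh w ?fs vs (enc ?p3 @ ps))"
    unfolding Sh_def
    by (rule iter_eq[OF iter_loop_app[of "[2]" "PPtr ?n" q2 "rev (enc_entries ?fs)" _ "replicate (length ?fs) 2" _ ?n ?n]])
      (use sc1 lens J in \<open>auto simp: heap_cost_def\<close>)
  have "iter ev_loop (Sh w es vs (enc p @ ps)) ((3 * Suc (j1 + j2 + j3) + 1) * ?Q)
    (Sh w (?fs @ es3) (rev (enc (PLam q3)) @ vs) ps)"
  proof (rule iter_eq)
    show "iter ev_loop (Sh w es vs (enc p @ ps)) ((3 * j1 + 1) * ?Q + ((3 * j2 + 1) * ?Q + (?Q + (3 * j3 + 1) * ?Q)))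
      (Sh w (?fs @ es3) (rev (enc (PLam q3)) @ vs) ps)"
      using iter_trans[OF 1(6) iter_trans[OF 2(6)[folded fs_def] iter_trans[OF 4 3(6)]]] p(1) by simp
  qed (auto simp: algebra_simps)
  moreover have "length es + Suc (j1 + j2 + j3) = length ?fs + j3" using lf by simp
  ultimately show ?case using 3 lf
    by (intro exI[of _ q3] exI[of _ "es1 @ es2 @ [q2] @ es3"] exI[of _ "rs1 @ rs2 @ [Lam b] @ rs3"])
      (auto simp: fs_def gs_def 1 2 add.assoc)
qed

section \<open>Unfolding the printed heap\<close>

lemma length_heap_of [simp]: "length (heap_of a es) = length es"
  by (induction es arbitrary: a) auto

lemma nth_heap_of: "k < length es \<Longrightarrow> heap_of a es ! k = ((gamma (close_ptrs (a + k) 1 (es ! k)), a + k), a + k)"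
  by (induction es arbitrary: a k) (auto simp: nth_Cons split: nat.split)

declare lookup.simps [simp del]

lemma lookup_heap_of:
  "n < a \<Longrightarrow> a \<le> length es \<Longrightarrow>
    lookup (heap_of 0 es) a n = Some (gamma (close_ptrs (a - 1 - n) 1 (es ! (a - 1 - n))), a - 1 - n)"
proof (induction n arbitrary: a)
  case 0
  then show ?case by (simp add: lookup.simps nth_heap_of)
next
  case (Suc n)
  then show ?case using Suc.IH[of "a - 1"] by (simp add: lookup.simps[of _ a] nth_heap_of)
qed

text \<open>The outer induction is on the address: a pointer leads to an entry \<open>k < a\<close>,
  whose body was printed relative to address \<open>k\<close>. Within one address the induction is
  on the term.\<close>

lemma unf_close_ptrs:
  assumes "env_ok S es rs"
  shows "scoped a d p \<Longrightarrow> a \<le> length es \<Longrightarrow> unf (heap_of 0 es) a d (close_ptrs a d p) (expand rs p)"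
proof (induction a arbitrary: d p rule: less_induct)
  case (less a)
  show ?case using less.prems
  proof (induction p arbitrary: d)
    case (PVar n)
    then show ?case by (auto intro: unf_bound)
  next
    case (PPtr k)
    then have k: "k < a" "a - 1 - (a - 1 - k) = k" by auto
    have "scoped k 0 (PLam (es ! k))" using assms k PPtr by (auto simp: env_ok_def)
    then have "unf (heap_of 0 es) k 0 (close_ptrs k 0 (PLam (es ! k))) (expand rs (PLam (es ! k)))"
      using less.IH[OF k(1), of 0 "PLam (es ! k)"] k PPtr by simp
    moreover have "expand rs (PLam (es ! k)) = rs ! k" using assms k PPtr by (simp add: env_ok_def)
    moreover have "lookup (heap_of 0 es) a (d + (a - 1 - k) - d) = Some (gamma (close_ptrs k 1 (es ! k)), k)"
      using lookup_heap_of[of "a - 1 - k" a es] k PPtr by simp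
    ultimately show ?case
      using unf_free[of d "d + (a - 1 - k)" "heap_of 0 es" a "gamma (close_ptrs k 1 (es ! k))" k "Lam (close_ptrs k 1 (es ! k))" "rs ! k"]
      by (auto simp: prog_rep_def)
  qed (auto intro: unf_lam unf_app)
qed

lemma clos_rep_close_ptrs:
  assumes "env_ok S es rs" "scoped (length es) 0 (PLam q)" "expand rs (PLam q) = v"
  shows "clos_rep (heap_of 0 es) (gamma (close_ptrs (length es) 1 q), length es) v"
  using unf_close_ptrs[OF assms(1), of "length es" 0 "PLam q"] assms(2,3)
  by (auto simp: clos_rep_def prog_rep_def)

section \<open>The main loop\<close>

definition copy_in :: prog where
  "copy_in = copy_all 0 6 3 ;; move_all 3 0"

definition body :: prog where
  "body = copy_in ;; ev_loop ;; out_prog"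

definition main_prog :: prog where
  "main_prog = body ;; deliver_prog"

text \<open>The final move closes the zipper: if the overflow hit while the input was being copied,
  part of the input is still on stack 3.\<close>

fun clear_all :: "nat list \<Rightarrow> prog" where
  "clear_all [] = move_all 3 0"
| "clear_all (i # is) = clear i ;; clear_all is"

text \<open>It ends in \<open>main_prog\<close>, where a further overflow jumps to the handler
  again, so the restarts need no loop. \<open>Grow\<close> comes before the change of mode, so the
  mark for the mode always fits.\<close>

definition handler :: prog where
  "handler = clear_all [5..<nstacks] ;; Grow ;; Cond 4 {2} (Pop 4) (Push 4 2) ;; main_prog"

lemmas prog_defs = main_prog_def body_def copy_in_def ev_loop_def out_prog_def deliver_prog_def copy_all_def move_all_def clear_def
  move_block_def block_loop_def fetch_def apply_prog_def share_def sub_loop_def sub_body_def var_case_def entry_body_def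
  conv_prog_def conv_loop_def conv_ptr_def bin_prog_def incr_prog_def

lemma wf_prog_main: "wf_prog main_prog"
  unfolding prog_defs by (simp add: nstacks_def)

lemma wf_prog_handler: "wf_prog handler"
proof -
  have "\<forall>i \<in> set is. i < nstacks \<and> 4 < i \<Longrightarrow> wf_prog (clear_all is)" for "is"
    by (induction "is") (auto simp: clear_def move_all_def nstacks_def)
  then have "wf_prog (clear_all [5..<nstacks])" by auto
  then show ?thesis using wf_prog_main by (simp add: handler_def nstacks_def)
qed

text \<open>What an overflow may interrupt: the pair of stacks 0 and 3 is a zipper over the input, so
  the input survives at any time.\<close>
fun safe :: "prog \<Rightarrow> bool" where
  "safe (Push j a) \<longleftrightarrow> 4 < j"
| "safe (Pop i) \<longleftrightarrow> 4 < i"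
| "safe (Mv i j) \<longleftrightarrow> i = 0 \<and> j = 3 \<or> i = 3 \<and> j = 0 \<or> 4 < i \<and> 4 < j"
| "safe (Cp i j) \<longleftrightarrow> 4 < j"
| "safe (Cond i A p q) \<longleftrightarrow> safe p \<and> safe q"
| "safe (Loop i A p) \<longleftrightarrow> safe p"
| "safe (Seq p q) \<longleftrightarrow> safe p \<and> safe q"
| "safe Grow \<longleftrightarrow> False"
| "safe Skip \<longleftrightarrow> True"

lemma safe_body: "safe body"
  unfolding prog_defs by simp

definition input_ok :: "nat list \<Rightarrow> nat list \<Rightarrow> store \<Rightarrow> bool" where
  "input_ok w md s \<longleftrightarrow> rev (s 0) @ s 3 = w \<and> s 4 = md \<and> s 1 = [] \<and> s 2 = [] \<and> (\<forall>i \<ge> nstacks. s i = [])"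

section \<open>Programs under a budget\<close>

lemma rev_tl_hd: "xs \<noteq> [] \<Longrightarrow> rev (tl xs) @ [hd xs] = rev xs"
  by (cases xs) auto

lemma istep_safe:
  assumes "istep (c, s) = (c', s')" "list_all (\<lambda>p. wf_prog p \<and> safe p) c" "input_ok w md s"
  shows "list_all (\<lambda>p. wf_prog p \<and> safe p) c' \<and> input_ok w md s'"
  using assms by (cases "(c, s)" rule: istep.cases) (auto simp: input_ok_def nstacks_def rev_tl_hd split: if_splits)

lemma istep_append: "c \<noteq> [] \<Longrightarrow> istep (c, s) = (c', s') \<Longrightarrow> istep (c @ k, s) = (c' @ k, s')"
  by (cases "(c, s)" rule: istep.cases) auto

definition brun :: "prog list \<times> store \<times> nat \<Rightarrow> nat \<Rightarrow> prog list \<times> store \<times> nat \<Rightarrow> bool" where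
  "brun X t Y \<longleftrightarrow> (\<exists>n \<le> t. (bstep [handler] ^^ n) X = Y)"

lemma brun_refl [simp]: "brun X t X"
  unfolding brun_def by (intro exI[of _ 0]) auto

lemma brun_trans: "brun X t Y \<Longrightarrow> brun Y t' Z \<Longrightarrow> brun X (t + t') Z"
proof -
  assume "brun X t Y" "brun Y t' Z"
  then obtain n n' where n: "n \<le> t" "(bstep [handler] ^^ n) X = Y" "n' \<le> t'" "(bstep [handler] ^^ n') Y = Z"
    unfolding brun_def by blast
  then have "(bstep [handler] ^^ (n' + n)) X = Z" by (simp add: funpow_add)
  then show ?thesis unfolding brun_def using n by (intro exI[of _ "n' + n"]) auto
qed

lemma brun_mono: "brun X t Y \<Longrightarrow> t \<le> t' \<Longrightarrow> brun X t' Y"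
  unfolding brun_def using le_trans by blast

lemma brun_step: "bstep [handler] X = Y \<Longrightarrow> brun X 1 Y"
  unfolding brun_def by (intro exI[of _ 1]) auto

lemma bstep_fits:
  assumes "istep (c, s) = (c', s')" "store_size s' \<le> B" "c = [] \<or> hd c \<noteq> Grow"
  shows "bstep h (c, s, B) = (c', s', B)"
  using assms by (auto simp: bstep_def)

text \<open>Up to the first overflow the bounded and the unbounded run proceed in lockstep.
  Afterwards the claim just keeps the configuration at the handler, which is possible because
  \<open>brun\<close> only bounds the number of steps.\<close>

lemma safe_run:
  assumes c: "list_all (\<lambda>p. wf_prog p \<and> safe p) c" and s: "input_ok w md s" "store_size s \<le> B"
  shows "(\<exists>c' s'. (istep ^^ n) (c, s) = (c', s') \<and> brun (c @ k, s, B) n (c' @ k, s', B) \<and>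
      list_all (\<lambda>p. wf_prog p \<and> safe p) c' \<and> input_ok w md s' \<and> store_size s' \<le> B) \<or>
    (\<exists>s'. brun (c @ k, s, B) n ([handler], s', B) \<and> input_ok w md s' \<and> store_size s' \<le> B \<and>
      (\<exists>i \<le> n. B < store_size (snd ((istep ^^ i) (c, s)))))"
proof (induction n)
  case 0
  then show ?case using assms by auto
next
  case (Suc n)
  from Suc consider (run) c1 s1 where "(istep ^^ n) (c, s) = (c1, s1)" "brun (c @ k, s, B) n (c1 @ k, s1, B)"
      "list_all (\<lambda>p. wf_prog p \<and> safe p) c1" "input_ok w md s1" "store_size s1 \<le> B"
    | (ovf) s' where "brun (c @ k, s, B) n ([handler], s', B)" "input_ok w md s'" "store_size s' \<le> B"
      "\<exists>i \<le> n. B < store_size (snd ((istep ^^ i) (c, s)))"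
    by blast
  then show ?case
  proof cases
    case ovf
    then show ?thesis using brun_mono[OF ovf(1), of "Suc n"] le_SucI by blast
  next
    case run
    obtain c2 s2 where st: "istep (c1, s1) = (c2, s2)" by fastforce
    have pow: "(istep ^^ Suc n) (c, s) = (c2, s2)" using run(1) st by simp
    note safe = istep_safe[OF st run(3,4)]
    show ?thesis
    proof (cases "c1 = []")
      case True
      then have "c2 = []" "s2 = s1" using st by auto
      then show ?thesis using True run pow brun_mono[OF run(2), of "Suc n"] by auto
    next
      case False
      have ng: "hd (c1 @ k) \<noteq> Grow" using run(3) False by (cases c1) auto
      have st': "istep (c1 @ k, s1) = (c2 @ k, s2)" using istep_append[OF False st] .
      show ?thesis
      proof (cases "store_size s2 \<le> B")
        case True
        have "bstep [handler] (c1 @ k, s1, B) = (c2 @ k, s2, B)"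
          using bstep_fits[OF st' True] ng by auto
        then show ?thesis using brun_trans[OF run(2) brun_step] pow safe True by auto
      next
        case ovf: False
        then have "bstep [handler] (c1 @ k, s1, B) = ([handler], s1, B)"
          using st' by (simp add: bstep_def)
        then have "brun (c @ k, s, B) (Suc n) ([handler], s1, B)"
          using brun_trans[OF run(2) brun_step] by simp
        moreover have "\<exists>i \<le> Suc n. B < store_size (snd ((istep ^^ i) (c, s)))"
          using pow ovf by (intro exI[of _ "Suc n"]) auto
        ultimately show ?thesis using run by blast
      qed
    qed
  qed
qed

lemma istep_nil_pow: "(istep ^^ n) ([], s) = ([], s)"
  by (induction n) auto

text \<open>Combines the two measures: \<open>reaches_or_exceeds\<close> says when the run has
  finished or overflowed, and \<open>reaches_within\<close> says that an overflow is possible only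
  for \<open>B < z\<close>.\<close>

lemma safe_run_or_exceeds:
  assumes c: "list_all (\<lambda>p. wf_prog p \<and> safe p) c" and s: "input_ok w md s" "store_size s \<le> B"
    and out_prog: "reaches_or_exceeds B (c, s) t ([], s')" and pk: "reaches_within z (c, s) ([], s')"
  shows "brun (c @ k, s, B) t (k, s', B) \<and> store_size s' \<le> B \<or>
    (\<exists>s'. brun (c @ k, s, B) t ([handler], s', B) \<and> input_ok w md s' \<and> store_size s' \<le> B \<and> B < z)"
proof -
  obtain n where n: "n \<le> t" "(istep ^^ n) (c, s) = ([], s') \<or> B < store_size (snd ((istep ^^ n) (c, s)))"
    using out_prog unfolding reaches_or_exceeds_def by blast
  obtain N where N: "(istep ^^ N) (c, s) = ([], s')" "\<forall>i \<le> N. store_size (snd ((istep ^^ i) (c, s))) \<le> z"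
    using pk unfolding reaches_within_def by blast
  \<comment> \<open>A finished run is idle, so the bound on its peak holds at every time.\<close>
  have all: "store_size (snd ((istep ^^ i) (c, s))) \<le> z" for i
  proof (cases "i \<le> N")
    case False
    then have "i = (i - N) + N" by simp
    then have "(istep ^^ i) (c, s) = (istep ^^ N) (c, s)"
      using N(1) istep_nil_pow by (metis comp_apply funpow_add)
    then show ?thesis using N(2) by auto
  qed (use N in blast)
  from safe_run[OF c s, of n k] show ?thesis
  proof
    assume "\<exists>c' s'. (istep ^^ n) (c, s) = (c', s') \<and> brun (c @ k, s, B) n (c' @ k, s', B) \<and>
      list_all (\<lambda>p. wf_prog p \<and> safe p) c' \<and> input_ok w md s' \<and> store_size s' \<le> B"
    then have "brun (c @ k, s, B) n (k, s', B) \<and> store_size s' \<le> B" using n(2) by auto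
    then show ?thesis using brun_mono n(1) by blast
  next
    assume "\<exists>s'. brun (c @ k, s, B) n ([handler], s', B) \<and> input_ok w md s' \<and> store_size s' \<le> B \<and>
      (\<exists>i \<le> n. B < store_size (snd ((istep ^^ i) (c, s))))"
    then show ?thesis using brun_mono n(1) all by (meson less_le_trans)
  qed
qed

fun shrink :: "prog \<Rightarrow> bool" where
  "shrink (Pop i) \<longleftrightarrow> True"
| "shrink (Mv i j) \<longleftrightarrow> i < nstacks \<and> j < nstacks \<and> i \<noteq> j"
| "shrink (Cond i A p q) \<longleftrightarrow> shrink p \<and> shrink q"
| "shrink (Loop i A p) \<longleftrightarrow> shrink p"
| "shrink (Seq p q) \<longleftrightarrow> shrink p \<and> shrink q"
| "shrink Skip \<longleftrightarrow> True"
| "shrink _ \<longleftrightarrow> False"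

lemma istep_shrink:
  assumes "istep (c, s) = (c', s')" "list_all shrink c"
  shows "list_all shrink c' \<and> store_size s' \<le> store_size s \<and> (c = [] \<or> hd c \<noteq> Grow)"
proof -
  have pop: "store_size (s(i := tl (s i))) \<le> store_size s" for i s
    using store_size_upd[of i s "tl (s i)"] by (cases "i < nstacks") (auto simp: store_size_def)
  show ?thesis
    using assms by (cases "(c, s)" rule: istep.cases) (auto simp: pop store_size_mv split: if_splits)
qed

text \<open>A program that never enlarges the store cannot overflow. So recovery and delivery run to
  completion under any budget that their start respects.\<close>

lemma shrink_run:
  "list_all shrink c \<Longrightarrow> store_size s \<le> B \<Longrightarrow> (istep ^^ n) (c, s) = (c', s') \<Longrightarrow>
    brun (c @ k, s, B) n (c' @ k, s', B) \<and> store_size s' \<le> B"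
proof (induction n arbitrary: c s)
  case (Suc n)
  obtain c1 s1 where st: "istep (c, s) = (c1, s1)" by fastforce
  note sh = istep_shrink[OF st Suc.prems(1)]
  have IH: "brun (c1 @ k, s1, B) n (c' @ k, s', B) \<and> store_size s' \<le> B"
    using Suc.prems sh st by (intro Suc.IH) (auto simp: funpow_Suc_right simp del: funpow.simps)
  show ?case
  proof (cases "c = []")
    case True
    then show ?thesis using st IH brun_mono[of _ n _ "Suc n"] by auto
  next
    case False
    have "bstep [handler] (c @ k, s, B) = (c1 @ k, s1, B)"
      using istep_append[OF False st] sh Suc.prems False by (intro bstep_fits) auto
    then show ?thesis using brun_trans[OF brun_step] IH by fastforce
  qed
qed auto

lemma does_shrink:
  assumes "does p s t s'" "shrink p" "store_size s \<le> B"
  shows "brun (p # k, s, B) t (k, s', B) \<and> store_size s' \<le> B"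
proof -
  obtain n where "n \<le> t" "(istep ^^ n) ([p], s) = ([], s')"
    using assms(1) unfolding does_def reaches_def by blast
  then show ?thesis using shrink_run[of "[p]" s B n "[]" s' k] assms brun_mono by auto
qed

definition init :: "nat list \<Rightarrow> nat list \<Rightarrow> store" where
  "init w md = St w md [] [] [] []"

lemma does_clear_all:
  "0 \<notin> set is \<Longrightarrow> 3 \<notin> set is \<Longrightarrow> \<forall>i. length (s i) \<le> B \<Longrightarrow>
    does (clear_all is) s (length is * (2 * B + 2) + 2 * B + 1)
      (\<lambda>i. if i \<in> set is \<or> i = 3 then [] else if i = 0 then rev (s 3) @ s 0 else s i)"
proof (induction "is" arbitrary: s)
  case Nil
  then show ?case by (auto intro!: does_eq[OF does_move_all] simp: fun_eq_iff)
next
  case (Cons i "is")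
  show ?case unfolding clear_all.simps
  proof (rule does_eq[OF does_Seq[OF does_clear Cons.IH]])
    show "Suc (2 * length (s i) + 1 + (length is * (2 * B + 2) + 2 * B + 1))
      \<le> length (i # is) * (2 * B + 2) + 2 * B + 1"
      using Cons.prems(3)[rule_format, of i] by simp
  qed (use Cons.prems in \<open>auto simp: fun_eq_iff\<close>)
qed

lemma shrink_clear_all: "\<forall>i \<in> set is. i < nstacks \<Longrightarrow> shrink (clear_all is)"
  by (induction "is") (auto simp: clear_def move_all_def nstacks_def)

lemma run_handler:
  assumes s: "input_ok w md s" "store_size s \<le> B" and md: "md = [] \<and> md' = [2] \<or> md = [2] \<and> md' = []"
  shows "brun ([handler], s, B) (40 * B + 50) ([main_prog], init w md', Suc B)"
proof -
  let ?c = "Cond 4 {2} (Pop 4) (Push 4 2)"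
  let ?s = "\<lambda>i. if i \<in> set [5..<nstacks] \<or> i = 3 then [] else if i = 0 then rev (s 3) @ s 0 else s i"
  have len: "length (s i) \<le> B" for i
    using s length_le_store_size[of i s] by (cases "i < nstacks") (auto simp: input_ok_def)
  have rw: "rev (s 3) @ s 0 = rev w" using s(1) unfolding input_ok_def by (auto dest: arg_cong[where f = rev])
  have eq: "?s = init w md"
  proof (intro ext)
    fix i
    have mem: "i \<in> set [5..<nstacks] \<longleftrightarrow> 5 \<le> i \<and> i < nstacks" by auto
    consider "i = 0" | "i = 1" | "i = 2" | "i = 3" | "i = 4" | "5 \<le> i" "i < nstacks" | "nstacks \<le> i" by linarith
    then show "?s i = init w md i"
      unfolding mem using s(1) rw by cases (auto simp: init_def St_def input_ok_def nstacks_def)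
  qed
  have 1: "brun ([handler], s, B) 1 (clear_all [5..<nstacks] # [Grow ;; ?c ;; main_prog], s, B)"
    by (rule brun_step, rule bstep_fits) (use s in \<open>auto simp: handler_def\<close>)
  have d: "does (clear_all [5..<nstacks]) s (length [5..<nstacks] * (2 * B + 2) + 2 * B + 1) (init w md)"
    unfolding eq[symmetric] by (rule does_clear_all) (use len in auto)
  have "shrink (clear_all [5..<nstacks])" by (rule shrink_clear_all) auto
  note 2 = does_shrink[OF d this s(2), of "[Grow ;; ?c ;; main_prog]"]
  then have sB: "length w + length md \<le> B" by (auto simp: init_def)
  have 3: "brun ([Grow ;; ?c ;; main_prog], init w md, B) 1 (Grow # [?c ;; main_prog], init w md, B)"
    by (rule brun_step, rule bstep_fits) (use sB in \<open>auto simp: init_def\<close>)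
  have 4: "brun (Grow # [?c ;; main_prog], init w md, B) 1 ([?c ;; main_prog], init w md, Suc B)"
    by (rule brun_step) (use sB in \<open>auto simp: init_def bstep_def\<close>)
  have 5: "brun ([?c ;; main_prog], init w md, Suc B) 1 ([?c, main_prog], init w md, Suc B)"
    by (rule brun_step, rule bstep_fits) (use sB in \<open>auto simp: init_def\<close>)
  have 6: "brun ([?c, main_prog], init w md, Suc B) 1
      ([if top_in {2} md then Pop 4 else Push 4 2, main_prog], init w md, Suc B)"
  proof (rule brun_step, rule bstep_fits)
    have "init w md 4 = md" by (simp add: init_def St_def)
    then show "istep ([?c, main_prog], init w md) =
      ([if top_in {2} md then Pop 4 else Push 4 2, main_prog], init w md)" by simp
    show "store_size (init w md) \<le> Suc B" using sB by (simp add: init_def)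
  qed simp
  have 7: "brun ([if top_in {2} md then Pop 4 else Push 4 2, main_prog], init w md, Suc B) 1
      ([main_prog], init w md', Suc B)"
  proof (rule brun_step, rule bstep_fits)
    show "istep ([if top_in {2} md then Pop 4 else Push 4 2, main_prog], init w md) = ([main_prog], init w md')"
      using md by (auto simp: init_def St_def fun_eq_iff)
    show "store_size (init w md') \<le> Suc B" using sB md by (auto simp: init_def)
  qed (simp add: top_in_def)
  show ?thesis
    by (rule brun_mono[OF brun_trans[OF 1 brun_trans[OF conjunct1[OF 2] brun_trans[OF 3 brun_trans[OF 4
      brun_trans[OF 5 brun_trans[OF 6 7]]]]]]]) (simp add: nstacks_def)
qed

lemma input_ok_init: "input_ok w md (init w md)"
  by (auto simp: input_ok_def init_def St_def nstacks_def)

section \<open>Cost of one attempt in each mode\<close>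

lemma reaches_seq: "reaches ([p ;; q], s) 1 ([p, q], s)"
  using reaches_step[of "([p ;; q], s)" 0] by simp

lemma reaches_copy_in:
  "reaches ([body], init w md) (6 * length w + 10) ([ev_loop, out_prog], St w md [] w [] [])"
proof -
  have 1: "does (copy_all 0 6 3) (init w md) (4 * length w + 1) ((init w md)(0 := [], 6 := w, 3 := w))"
    by (rule does_eq[OF does_copy_all]) (auto simp: init_def St_def fun_eq_iff)
  have 2: "does (move_all 3 0) ((init w md)(0 := [], 6 := w, 3 := w)) (2 * length w + 1) (St w md [] w [] [])"
    by (rule does_eq[OF does_move_all]) (auto simp: init_def St_def fun_eq_iff)
  have "does copy_in (init w md) (6 * length w + 3) (St w md [] w [] [])"
    unfolding copy_in_def by (rule does_eq[OF does_Seq[OF 1 2]]) auto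
  then have 3: "reaches ([copy_in, ev_loop ;; out_prog], init w md) (6 * length w + 3) ([ev_loop ;; out_prog], St w md [] w [] [])"
    by (simp add: does_def)
  show ?thesis unfolding body_def
    by (rule reaches_mono[OF reaches_trans[OF reaches_seq reaches_trans[OF 3 reaches_seq]]]) simp
qed

lemma reaches_exit:
  "s 6 = [] \<Longrightarrow> reaches ([ev_loop, out_prog], s) 1 ([out_prog], s)"
  unfolding ev_loop_def using reaches_step[of "(Loop _ _ _ # _, s)" 0] by simp

definition result :: "lterm \<Rightarrow> store \<Rightarrow> bool" where
  "result t s \<longleftrightarrow> (\<exists>H g. s 21 = rev (enc_clos g) \<and> s 22 = rev (enc_heap H) \<and> clos_rep H g t \<and>
     s 9 = [] \<and> s 1 = [] \<and> s 2 = [])"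

lemma reaches_out:
  assumes "env_ok S es rs" "scoped (length es) 0 (PLam q)" "expand rs (PLam q) = t"
    and "\<forall>k < length es. length (enc (PLam (es ! k))) \<le> dm" "length (enc (PLam q)) \<le> dm"
  shows "\<exists>s'. reaches ([out_prog], St w md (rev (enc (PLam q))) [] (rev (enc_entries es)) ns) (out_cost (length es) dm) ([], s') \<and> result t s'"
proof -
  have sc: "\<forall>k < length es. scoped k 1 (es ! k) \<and> length (enc (PLam (es ! k))) \<le> dm"
    using assms(1,4) by (auto simp: env_ok_def)
  obtain s' where s': "does out_prog (St w md (rev (enc (PLam q))) [] (rev (enc_entries es)) ns) (out_cost (length es) dm) s'"
    "s' 21 = rev (enc_clos (gamma (close_ptrs (length es) 1 q), length es))" "s' 22 = rev (enc_heap (heap_of 0 es))"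
    "s' 9 = []" "s' 1 = []" "s' 2 = []"
    using does_out[of "St w md (rev (enc (PLam q))) [] (rev (enc_entries es)) ns" es q dm "length es"] sc assms(2,5)
    by (auto simp: St_def)
  then show ?thesis using clos_rep_close_ptrs[OF assms(1-3)] unfolding result_def does_def by blast
qed

definition init_cost :: "nat \<Rightarrow> nat" where "init_cost x = 12 * x + 20"

definition sub_time :: "nat \<Rightarrow> nat \<Rightarrow> nat" where
  "sub_time x B = init_cost x + (3 * x + 1) * sub_cost B + 40 * B + 70"

definition heap_time :: "nat \<Rightarrow> nat" where
  "heap_time x = init_cost x + (3 * x + 1) * heap_cost x x + out_cost x (blk_len x x) + 10"

text \<open>The peak \<open>500 * m\<close> is what ties the budget to the space of the reduction:
  an overflow in this mode forces \<open>B < 500 * m\<close>. The time bound depends on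
  \<open>B\<close> instead of \<open>m\<close>, because \<open>m\<close> may be exponential in
  \<open>x\<close>.\<close>

lemma sub_body_run:
  assumes "big_step s t j m" "bound 0 s" "tsize s + j \<le> x" "w = enc (emb s)"
  shows "\<exists>s'. result t s' \<and> reaches_within (500 * m) ([body], init w []) ([], s') \<and>
    (\<forall>B. reaches_or_exceeds B ([body], init w []) (sub_time x B) ([], s'))"
proof -
  have w: "length w \<le> 2 * tsize s" using length_enc_emb assms(4) by simp
  have m: "tsize s \<le> m" "tsize t \<le> m" "1 \<le> m" using big_step_size[OF assms(1)] by auto
  obtain u where u: "t = Lam u" using big_step_size[OF assms(1)] by auto
  note se = sub_eval[OF assms(1,2), of w]
  define dm where "dm = length (enc (emb t))"
  have dm: "dm \<le> 2 * m" unfolding dm_def using length_enc_emb[of t] m by simp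
  let ?s2 = "St w [] (rev (enc (emb t))) [] [] []"
  have cp: "reaches ([body], init w []) (6 * length w + 10) ([ev_loop, out_prog], St w [] [] (enc (emb s) @ []) [] [])"
    using reaches_copy_in[of w "[]"] assms(4) by simp
  have expand: "reaches ([ev_loop, out_prog], ?s2) 1 ([out_prog], ?s2)"
    by (rule reaches_exit) (simp add: St_def)
  obtain s' where s': "reaches ([out_prog], ?s2) (out_cost 0 dm) ([], s')" "result t s'"
    using reaches_out[of 0 "[]" "[]" "emb u" t dm w "[]" "[]"] se u scoped_emb[of 0 0 t] expand_emb[of "[]" t]
    by (auto simp: env_ok_def dm_def)
  have oc: "out_cost 0 dm = 40 * dm + 60" by (simp add: out_cost_def)
  have "reaches_within (500 * m) ([body], init w []) ([ev_loop, out_prog], St w [] [] (enc (emb s) @ []) [] [])"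
    by (rule reaches_imp_within[OF cp]) (use w m in \<open>auto simp: init_def\<close>)
  moreover have "reaches_within (500 * m) ([ev_loop, out_prog], St w [] [] (enc (emb s) @ []) [] []) ([ev_loop, out_prog], ?s2)"
  proof (rule reaches_within_mono)
    show "reaches_within (length w + length ([]::nat list) + length ([]::nat list) + 300 * m)
      ([ev_loop, out_prog], St w [] [] (enc (emb s) @ []) [] []) ([ev_loop, out_prog], ?s2)"
      using se[THEN conjunct2, THEN conjunct1, rule_format, of "[]" "[]" "[out_prog]"] by simp
  qed (use w m in simp)
  moreover have "reaches_within (500 * m) ([ev_loop, out_prog], ?s2) ([out_prog], ?s2)"
    by (rule reaches_imp_within[OF expand]) (use w m dm in \<open>auto simp: dm_def\<close>)
  moreover have "reaches_within (500 * m) ([out_prog], ?s2) ([], s')"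
    by (rule reaches_imp_within[OF s'(1)]) (use w m dm oc in \<open>auto simp: dm_def\<close>)
  ultimately have pk: "reaches_within (500 * m) ([body], init w []) ([], s')"
    using reaches_within_trans by blast
  have "reaches_or_exceeds B ([body], init w []) (sub_time x B) ([], s')" for B
  proof -
    have 1: "reaches_or_exceeds B ([body], init w []) (6 * length w + 10) ([ev_loop, out_prog], St w [] [] (enc (emb s) @ []) [] [])"
      by (rule reaches_imp_or_exceeds[OF cp])
    have 2: "reaches_or_exceeds B ([ev_loop, out_prog], St w [] [] (enc (emb s) @ []) [] []) ((3 * j + 1) * sub_cost B) ([ev_loop, out_prog], ?s2)"
      using se[THEN conjunct2, THEN conjunct2, rule_format, of B "[out_prog]" "[]" "[]"] by simp
    have 3: "reaches_or_exceeds B ([ev_loop, out_prog], ?s2) 1 ([out_prog], ?s2)" by (rule reaches_imp_or_exceeds[OF expand])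
    have 4: "reaches_or_exceeds B ([out_prog], ?s2) (40 * B + 60) ([], s')"
    proof (cases "store_size ?s2 \<le> B")
      case True
      then show ?thesis using oc by (intro reaches_or_exceeds_mono[OF reaches_imp_or_exceeds[OF s'(1)]]) (simp add: dm_def)
    qed (auto intro: reaches_or_exceeds_now)
    have "(3 * j + 1) * sub_cost B \<le> (3 * x + 1) * sub_cost B"
      using assms(3) by (intro mult_le_mono) auto
    moreover have "6 * length w + 11 \<le> init_cost x" using w assms(3) by (simp add: init_cost_def)
    ultimately have "6 * length w + 10 + ((3 * j + 1) * sub_cost B + (1 + (40 * B + 60))) \<le> sub_time x B"
      unfolding sub_time_def by linarith
    then show ?thesis by (rule reaches_or_exceeds_mono[OF reaches_or_exceeds_trans[OF 1 reaches_or_exceeds_trans[OF 2 reaches_or_exceeds_trans[OF 3 4]]]])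
  qed
  then show ?thesis using s' pk by blast
qed

lemma out_cost_mono: "J \<le> J' \<Longrightarrow> out_cost J dm \<le> out_cost J' dm"
  unfolding out_cost_def by (intro mult_le_mono add_mono) auto

text \<open>Here \<open>x\<close> serves both as the bound on the size of code and as the bound on
  the number of stored values.\<close>

lemma heap_body_run:
  assumes "big_step s t j m" "bound 0 s" "tsize s + j \<le> x" "w = enc (emb s)"
  shows "\<exists>s'. result t s' \<and> reaches ([body], init w [2]) (heap_time x) ([], s')"
proof -
  have w: "length w \<le> 2 * tsize s" using length_enc_emb assms(4) by simp
  obtain q es rs where h: "env_ok x es rs" "length es = j" "scoped j 0 (PLam q)" "psize (PLam q) \<le> x" "expand rs (PLam q) = t"
    "iter ev_loop (Sh w [] [] (enc (emb s) @ [])) ((3 * j + 1) * heap_cost x x) (Sh w es (rev (enc (PLam q))) [])"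
    using heap_eval[OF assms(1), of x "[]" "[]" "emb s" "[]" x w "[]"] assms(2,3)
    by (auto simp: env_ok_def scoped_emb expand_emb psize_emb)
  have jx: "j \<le> x" using assms(3) by simp
  let ?s2 = "St w [2] (rev (enc (PLam q))) [] (rev (enc_entries es)) (replicate (length es) 2)"
  have 1: "reaches ([body], init w [2]) (6 * length w + 10) ([ev_loop, out_prog], Sh w [] [] (enc (emb s) @ []))"
    using reaches_copy_in[of w "[2]"] assms(4) by (simp add: Sh_def)
  have 2: "reaches ([ev_loop, out_prog], Sh w [] [] (enc (emb s) @ [])) ((3 * j + 1) * heap_cost x x) ([ev_loop, out_prog], ?s2)"
    using h(6) unfolding iter_def Sh_def by blast
  have 3: "reaches ([ev_loop, out_prog], ?s2) 1 ([out_prog], ?s2)"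
    by (rule reaches_exit) (simp add: St_def)
  have "\<forall>k < length es. length (enc (PLam (es ! k))) \<le> blk_len x x"
    using env_ok_blk[OF h(1)] h(2) jx by simp
  moreover have "length (enc (PLam q)) \<le> blk_len x x" using blk_le[OF h(3,4) jx] .
  ultimately obtain s' where s': "reaches ([out_prog], ?s2) (out_cost (length es) (blk_len x x)) ([], s')" "result t s'"
    using reaches_out[OF h(1) _ h(5)] h(2,3) by blast
  have "(3 * j + 1) * heap_cost x x \<le> (3 * x + 1) * heap_cost x x"
    using jx by (intro mult_le_mono) auto
  moreover have "out_cost (length es) (blk_len x x) \<le> out_cost x (blk_len x x)"
    using jx h(2) by (intro out_cost_mono) simp
  moreover have "6 * length w + 11 \<le> init_cost x" using w assms(3) by (simp add: init_cost_def)
  ultimately have "6 * length w + 10 + ((3 * j + 1) * heap_cost x x + (1 + out_cost (length es) (blk_len x x)))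
    \<le> heap_time x" unfolding heap_time_def by linarith
  then have "reaches ([body], init w [2]) (heap_time x) ([], s')"
    by (rule reaches_mono[OF reaches_trans[OF 1 reaches_trans[OF 2 reaches_trans[OF 3 s'(1)]]]])
  then show ?thesis using s' by blast
qed

section \<open>Attempts, rounds and the final budget\<close>

definition delivers :: "lterm \<Rightarrow> store \<Rightarrow> bool" where
  "delivers t s \<longleftrightarrow> (\<exists>H g. s 1 = rev (enc_clos g) \<and> s 2 = rev (enc_heap H) \<and> clos_rep H g t)"

text \<open>One attempt ends either with a delivered result or at the handler, in the latter case
  with the information \<open>B < z\<close>. For substitution \<open>z\<close> is linear in the
  space of the reduction; for sharing it is polynomial in \<open>x\<close>.\<close>

lemma phase:
  assumes r: "result t s'" and ob: "reaches_or_exceeds B ([body], init w md) T ([], s')" and pk: "reaches_within z ([body], init w md) ([], s')"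
    and B: "length w + length md \<le> B"
  shows "(\<exists>s''. brun ([main_prog], init w md, B) (T + 8 * B + 11) ([], s'', B) \<and> delivers t s'') \<or>
    (\<exists>s''. brun ([main_prog], init w md, B) (T + 8 * B + 11) ([handler], s'', B) \<and> input_ok w md s'' \<and> store_size s'' \<le> B \<and> B < z)"
proof -
  have 0: "brun ([main_prog], init w md, B) 1 ([body, deliver_prog], init w md, B)"
    by (rule brun_step, rule bstep_fits) (use B in \<open>auto simp: main_prog_def init_def\<close>)
  have "list_all (\<lambda>p. wf_prog p \<and> safe p) [body]" using safe_body wf_prog_main by (simp add: main_prog_def)
  moreover have "store_size (init w md) \<le> B" using B by (simp add: init_def)
  ultimately have "brun ([body] @ [deliver_prog], init w md, B) T ([deliver_prog], s', B) \<and> store_size s' \<le> B \<or>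
    (\<exists>s'. brun ([body] @ [deliver_prog], init w md, B) T ([handler], s', B) \<and> input_ok w md s' \<and> store_size s' \<le> B \<and> B < z)"
    using safe_run_or_exceeds[OF _ input_ok_init _ ob pk, of "[deliver_prog]"] by blast
  then show ?thesis
  proof
    assume a: "brun ([body] @ [deliver_prog], init w md, B) T ([deliver_prog], s', B) \<and> store_size s' \<le> B"
    have l: "length (s' 21) \<le> B" "length (s' 22) \<le> B"
      using a length_le_store_size[of 21 s'] length_le_store_size[of 22 s'] by (auto simp: nstacks_def)
    have d: "does deliver_prog s' (8 * B + 10) (s'(21 := [], 22 := [], 1 := s' 21, 2 := s' 22))"
      by (rule does_eq[OF does_fin]) (use r l in \<open>auto simp: result_def\<close>)
    have "shrink deliver_prog" by (simp add: deliver_prog_def move_all_def nstacks_def)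
    then have "brun ([deliver_prog], s', B) (8 * B + 10) ([], s'(21 := [], 22 := [], 1 := s' 21, 2 := s' 22), B)"
      using does_shrink[OF d, of B "[]"] a by blast
    moreover have "brun ([body, deliver_prog], init w md, B) T ([deliver_prog], s', B)" using a by simp
    ultimately have "brun ([main_prog], init w md, B) (1 + (T + (8 * B + 10)))
       ([], s'(21 := [], 22 := [], 1 := s' 21, 2 := s' 22), B)"
      using brun_trans[OF 0 brun_trans] by blast
    then have "brun ([main_prog], init w md, B) (T + 8 * B + 11)
       ([], s'(21 := [], 22 := [], 1 := s' 21, 2 := s' 22), B)"
      by (rule brun_mono) simp
    moreover have "delivers t (s'(21 := [], 22 := [], 1 := s' 21, 2 := s' 22))"
      using r unfolding result_def delivers_def by auto
    ultimately show ?thesis by blast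
  next
    assume "\<exists>s'. brun ([body] @ [deliver_prog], init w md, B) T ([handler], s', B) \<and> input_ok w md s' \<and> store_size s' \<le> B \<and> B < z"
    then obtain s'' where s'': "brun ([body, deliver_prog], init w md, B) T ([handler], s'', B)" "input_ok w md s''" "store_size s'' \<le> B" "B < z"
      by auto
    have "brun ([main_prog], init w md, B) (T + 8 * B + 11) ([handler], s'', B)"
      by (rule brun_mono[OF brun_trans[OF 0 s''(1)]]) simp
    then show ?thesis using s'' by blast
  qed
qed

text \<open>A budget at which sharing cannot fail: the initial store, consisting of the input code
  and the mode, plus the running time.\<close>

definition heap_bound :: "nat \<Rightarrow> nat" where
  "heap_bound x = 2 * x + 2 + heap_time x"

definition round_time :: "nat \<Rightarrow> nat" where
  "round_time x = sub_time x (heap_bound x) + heap_time x + 100 * heap_bound x + 200"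

lemma sub_time_mono: "B \<le> B' \<Longrightarrow> sub_time x B \<le> sub_time x B'"
  unfolding sub_time_def sub_cost_def by (intro add_mono mult_le_mono mult_le_mono2) auto

text \<open>A round is an attempt in each mode. If both fail, the first failure gives
  \<open>B < 500 * m\<close> and the second \<open>Suc B < heap_bound x\<close>, so the two upper
  bounds on the budget still hold for \<open>B + 2\<close>. The distance to
  \<open>heap_bound x\<close> decreases, which bounds the number of rounds.\<close>

lemma all_rounds:
  assumes e: "big_step s t j m" and cl: "bound 0 s" and x: "tsize s + j \<le> x" and w: "w = enc (emb s)"
  shows "length w \<le> B \<Longrightarrow> B \<le> heap_bound x \<Longrightarrow> B \<le> 500 * m + 1 \<Longrightarrow>
    \<exists>s' B'. brun ([main_prog], init w [], B) ((heap_bound x + 1 - B) * round_time x) ([], s', B') \<and>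
      delivers t s' \<and> B' \<le> 500 * m + 1"
proof (induction "heap_bound x - B" arbitrary: B rule: less_induct)
  case less
  let ?Z = "heap_bound x" and ?R = "round_time x"
  obtain s1 where s1: "result t s1" "reaches_within (500 * m) ([body], init w []) ([], s1)"
    "reaches_or_exceeds B ([body], init w []) (sub_time x B) ([], s1)"
    using sub_body_run[OF e cl x w] by blast
  obtain s2 where s2: "result t s2" "reaches ([body], init w [2]) (heap_time x) ([], s2)"
    using heap_body_run[OF e cl x w] by blast
  have lw: "length w \<le> 2 * x" using length_enc_emb[of s] w x by simp
  have pk2: "reaches_within ?Z ([body], init w [2]) ([], s2)"
    by (rule reaches_imp_within[OF s2(2)]) (use lw in \<open>auto simp: heap_bound_def init_def\<close>)
  have R: "?R \<le> (?Z + 1 - B) * ?R" using less.prems by (simp add: Suc_diff_le)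
  have st: "sub_time x B \<le> sub_time x ?Z" using less.prems by (intro sub_time_mono)
  from phase[OF s1(1,3,2)] less.prems consider
    (done1) s' where "brun ([main_prog], init w [], B) (sub_time x B + 8 * B + 11) ([], s', B)" "delivers t s'"
  | (ovf1) s' where "brun ([main_prog], init w [], B) (sub_time x B + 8 * B + 11) ([handler], s', B)"
      "input_ok w [] s'" "store_size s' \<le> B" "B < 500 * m" by auto
  then show ?case
  proof cases
    case done1
    have "sub_time x B + 8 * B + 11 \<le> ?R"
      using st less.prems(2) unfolding round_time_def by linarith
    then have "sub_time x B + 8 * B + 11 \<le> (?Z + 1 - B) * ?R" using R by (rule le_trans)
    then show ?thesis using done1 less.prems brun_mono by blast
  next
    case ovf1
    have h1: "brun ([handler], s', B) (40 * B + 50) ([main_prog], init w [2], Suc B)"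
      by (rule run_handler[OF ovf1(2,3)]) simp
    have T1: "brun ([main_prog], init w [], B) (sub_time x B + 8 * B + 11 + (40 * B + 50)) ([main_prog], init w [2], Suc B)"
      by (rule brun_trans[OF ovf1(1) h1])
    from phase[OF s2(1) reaches_imp_or_exceeds[OF s2(2)] pk2, of "Suc B"] less.prems(1) consider
      (done2) s' where "brun ([main_prog], init w [2], Suc B) (heap_time x + 8 * Suc B + 11) ([], s', Suc B)" "delivers t s'"
    | (ovf2) s' where "brun ([main_prog], init w [2], Suc B) (heap_time x + 8 * Suc B + 11) ([handler], s', Suc B)"
        "input_ok w [2] s'" "store_size s' \<le> Suc B" "Suc B < ?Z" by auto
    then show ?thesis
    proof cases
      case done2
      have "sub_time x B + 8 * B + 11 + (40 * B + 50) + (heap_time x + 8 * Suc B + 11) \<le> ?R"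
        using st less.prems(2) unfolding round_time_def by simp
      then have "sub_time x B + 8 * B + 11 + (40 * B + 50) + (heap_time x + 8 * Suc B + 11) \<le> (?Z + 1 - B) * ?R"
        using R by (rule le_trans)
      then show ?thesis using brun_mono[OF brun_trans[OF T1 done2(1)]] done2(2) ovf1(4)
        by (intro exI[of _ s'] exI[of _ "Suc B"]) auto
    next
      case ovf2
      have h2: "brun ([handler], s', Suc B) (40 * Suc B + 50) ([main_prog], init w [], Suc (Suc B))"
        by (rule run_handler[OF ovf2(2,3)]) simp
      have lt: "?Z - Suc (Suc B) < ?Z - B" using ovf2(4) by linarith
      obtain s3 B3 where f: "brun ([main_prog], init w [], Suc (Suc B)) ((?Z + 1 - Suc (Suc B)) * ?R) ([], s3, B3)"
        "delivers t s3" "B3 \<le> 500 * m + 1"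
        using less.hyps[OF lt] less.prems ovf1(4) ovf2(4) by auto
      have "brun ([main_prog], init w [], B) (sub_time x B + 8 * B + 11 + (40 * B + 50) +
        (heap_time x + 8 * Suc B + 11 + (40 * Suc B + 50 + (?Z + 1 - Suc (Suc B)) * ?R))) ([], s3, B3)"
        by (rule brun_trans[OF T1 brun_trans[OF ovf2(1) brun_trans[OF h2 f(1)]]])
      moreover have "sub_time x B + 8 * B + 11 + (40 * B + 50) +
        (heap_time x + 8 * Suc B + 11 + (40 * Suc B + 50 + (?Z + 1 - Suc (Suc B)) * ?R)) \<le>
          ?R + (?Z + 1 - Suc (Suc B)) * ?R"
      proof -
        have "sub_time x B + 8 * B + 11 + (40 * B + 50) +
          (heap_time x + 8 * Suc B + 11 + (40 * Suc B + 50)) \<le> ?R"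
          using st ovf2(4) unfolding round_time_def by simp
        then show ?thesis by (simp only: add.assoc[symmetric] add_le_cancel_right)
      qed
      moreover have "?R + (?Z + 1 - Suc (Suc B)) * ?R \<le> (?Z + 1 - B) * ?R"
      proof -
        have "Suc (?Z + 1 - Suc (Suc B)) \<le> ?Z + 1 - B" using ovf2(4) by simp
        then have "Suc (?Z + 1 - Suc (Suc B)) * ?R \<le> (?Z + 1 - B) * ?R" by (rule mult_le_mono1)
        then show ?thesis by simp
      qed
      ultimately show ?thesis using f brun_mono le_trans by blast
    qed
  qed
qed

section \<open>Polynomial bounds and conclusion\<close>

definition poly_bounded :: "(nat \<Rightarrow> nat) \<Rightarrow> bool" where
  "poly_bounded f \<longleftrightarrow> (\<exists>c d. \<forall>x. f x \<le> c * (x + 1) ^ d)"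

lemma poly_bounded_const: "poly_bounded (\<lambda>x. c)"
  unfolding poly_bounded_def by (intro exI[of _ c] exI[of _ 0]) simp

lemma poly_bounded_id: "poly_bounded (\<lambda>x. x)"
  unfolding poly_bounded_def by (intro exI[of _ 1]) simp

lemma poly_bounded_add:
  assumes "poly_bounded f" "poly_bounded g"
  shows "poly_bounded (\<lambda>x. f x + g x)"
proof -
  obtain c d c' d' where *: "\<And>x. f x \<le> c * (x + 1) ^ d" "\<And>x. g x \<le> c' * (x + 1) ^ d'"
    using assms unfolding poly_bounded_def by blast
  have "f x + g x \<le> (c + c') * (x + 1) ^ (d + d')" for x
  proof -
    have "c * (x + 1) ^ d \<le> c * (x + 1) ^ (d + d')" "c' * (x + 1) ^ d' \<le> c' * (x + 1) ^ (d + d')"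
      by (intro mult_le_mono2 power_increasing; simp)+
    then show ?thesis using *[of x] unfolding add_mult_distrib by linarith
  qed
  then show ?thesis unfolding poly_bounded_def by blast
qed

lemma poly_bounded_mult:
  assumes "poly_bounded f" "poly_bounded g"
  shows "poly_bounded (\<lambda>x. f x * g x)"
proof -
  obtain c d c' d' where *: "\<And>x. f x \<le> c * (x + 1) ^ d" "\<And>x. g x \<le> c' * (x + 1) ^ d'"
    using assms unfolding poly_bounded_def by blast
  have "f x * g x \<le> (c * c') * (x + 1) ^ (d + d')" for x
    using mult_le_mono[OF *[of x]] by (simp add: power_add ac_simps)
  then show ?thesis unfolding poly_bounded_def by blast
qed

lemma poly_bounded_Suc: "poly_bounded f \<Longrightarrow> poly_bounded (\<lambda>x. Suc (f x))"
  using poly_bounded_add[OF _ poly_bounded_const[of 1]] by simp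

lemma poly_bounded_total: "poly_bounded (\<lambda>x. 2 * x + 1 + 2 * ((heap_bound x + 1) * round_time x))"
  unfolding round_time_def heap_bound_def sub_time_def heap_time_def sub_cost_def heap_cost_def init_cost_def
    out_cost_def blk_len_def
  by (intro poly_bounded_add poly_bounded_mult poly_bounded_Suc poly_bounded_id poly_bounded_const)

theorem theorem20:
  shows "\<exists>M c d e. wf_tm M \<and> 3 \<le> tm_tapes M \<and> 9 \<le> tm_syms M \<and>
    (\<forall>s t j m. closed s \<longrightarrow> evaluates s t j m \<longrightarrow>
       (\<exists>k c' H g. tm_halts_in M (initial_config M (enc_prog (gamma s))) k c'
          \<and> tape_contents (snd c' ! 1) = enc_clos g
          \<and> tape_contents (snd c' ! 2) = enc_heap H
          \<and> clos_rep H g t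
          \<and> k \<le> c * (tsize s + j + 1) ^ d
          \<and> tm_space M (initial_config M (enc_prog (gamma s))) k \<le> e * m))"
proof -
  let ?M = "mach main_prog handler"
  obtain c d where cd: "\<And>x. 2 * x + 1 + 2 * ((heap_bound x + 1) * round_time x) \<le> c * (x + 1) ^ d"
    using poly_bounded_total unfolding poly_bounded_def by blast
  have "\<exists>k c' H g. tm_halts_in ?M (initial_config ?M (enc_prog (gamma s))) k c'
          \<and> tape_contents (snd c' ! 1) = enc_clos g
          \<and> tape_contents (snd c' ! 2) = enc_heap H
          \<and> clos_rep H g t
          \<and> k \<le> c * (tsize s + j + 1) ^ d
          \<and> tm_space ?M (initial_config ?M (enc_prog (gamma s))) k \<le> 15000 * m"
    if "closed s" "evaluates s t j m" for s t j m
  proof -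
    define w where "w = enc (emb s)"
    let ?x = "tsize s + j"
    have e: "big_step s t j m" using that evaluates_big_step by blast
    have cl: "bound 0 s" using that by (simp add: closed_def)
    have m: "tsize s \<le> m" "1 \<le> m" using big_step_size[OF e] by auto
    have lw: "length w \<le> 2 * tsize s" unfolding w_def by (rule length_enc_emb)
    have sym: "\<forall>a \<in> set (enc p). a < 10" for p by (induction p) auto
    have "length w \<le> heap_bound ?x" "length w \<le> 500 * m + 1"
      using lw m by (auto simp: heap_bound_def)
    then obtain s' B n where r: "n \<le> (heap_bound ?x + 1 - length w) * round_time ?x"
      "(bstep [handler] ^^ n) ([main_prog], init w [], length w) = ([], s', B)"
      "delivers t s'" "B \<le> 500 * m + 1"
      using all_rounds[OF e cl order.refl w_def, of "length w"] unfolding brun_def by blast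
    have "init w [] = (\<lambda>_. [])(0 := rev w)" by (auto simp: init_def St_def fun_eq_iff)
    then obtain k c' where k: "tm_halts_in ?M (initial_config ?M w) k c'"
      "tape_contents (snd c' ! 1) = rev (s' 1)" "tape_contents (snd c' ! 2) = rev (s' 2)"
      "k \<le> Suc (length w) + 2 * n" "tm_space ?M (initial_config ?M w) k \<le> Suc nstacks * B"
      using mach_correct[OF wf_prog_main wf_prog_handler, of w n s' B] r(2) sym[of "emb s"] by (auto simp: w_def)
    have "n \<le> (heap_bound ?x + 1) * round_time ?x"
      using r(1) by (rule order.trans) (intro mult_le_mono1, simp)
    moreover define P where "P = (heap_bound ?x + 1) * round_time ?x"
    ultimately have "k \<le> c * (?x + 1) ^ d" using k(4) lw cd[of ?x, folded P_def] by simp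
    \<comment> \<open>There are 24 tapes of length at most \<open>500 * m + 1\<close> each, and
      \<open>m\<close> is at least 1.\<close>
    moreover have "Suc nstacks * B \<le> 15000 * m" using r(4) m by (simp add: nstacks_def)
    moreover obtain H g where "s' 1 = rev (enc_clos g)" "s' 2 = rev (enc_heap H)" "clos_rep H g t"
      using r(3) unfolding delivers_def by blast
    ultimately show ?thesis unfolding enc_emb w_def[symmetric] using k
      by (intro exI[of _ k] exI[of _ c'] exI[of _ H] exI[of _ g]) auto
  qed
  then show ?thesis using wf_mach[OF wf_prog_main wf_prog_handler]
    by (intro exI[of _ ?M] exI[of _ c] exI[of _ d] exI[of _ 15000]) (auto simp: mach_def nstacks_def)
qed

end
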